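(* Let $0\le\omega<\mu\le\pi$ and let $\mathcal H$ be a two-sided quaternionic Hilbert space. Let $T\in\Omega$ be a right-linear operator on $\mathcal H$ with $\mathbb S\subseteq\rho_S(T)$, such that every function in $\mathcal{SH}_L^\infty(\mathcal S^0_\mu)$ admits an admissible regularizer, and assume that the adjoint $T^*$ is also of type $\omega$. Suppose that $T$ satisfies a quadratic estimate with respect to some $\psi\in\Psi^+(\mathcal S^0_\mu)$ and $T^*$ satisfies a quadratic estimate with respect to some $\tilde\psi\in\Psi^+(\mathcal S^0_\mu)$. Then there exists $C>0$ such that for every $f\in\mathcal{SH}_L^\infty(\mathcal S^0_\mu)$ the operator $f(T)$ is bounded and $\|f(T)\|\le C\|f\|_\infty$.
   Context: $\mathbb H$ denotes the quaternions, $\mathbb S=\{q\in\mathbb H:q^2=-1\}$ the sphere of imaginary units, and for $i\in\mathbb S$, $\mathbb C_i=\{u+iv:u,v\in\mathbb R\}$. $\mathcal H$ is a right quaternionic Hilbert space with $\mathbb H$-valued inner product $\langle\cdot,\cdot\rangle$ ($\langle x,y\rangle=\overline{\langle y,x\rangle}$, $\langle x\alpha+y\beta,z\rangle=\langle x,z\rangle\alpha+\langle y,z\rangle\beta$, $\|x\|^2=\langle x,x\rangle$), made two-sided via a choice of Hilbert basis; $\mathcal B(\mathcal H)$ denotes bounded right-linear operators, $\mathcal I$ the identity. For a closed right-linear operator $T:\mathcal D(T)\subseteq \mathcal H\to \mathcal H$: $\rho_S(T)=\{s\in\mathbb H:(T^2-2\mathrm{Re}(s)T+|s|^2\mathcal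 I)^{-1}\in\mathcal B(\mathcal H)\}$ (acting on $\mathcal D(T^2)$), $\sigma_S(T)=\mathbb H\setminus\rho_S(T)$; for $s\in\rho_S(T)$, $Q_s(T)=(T^2-2\mathrm{Re}(s)T+|s|^2\mathcal I)^{-1}$, $S_L^{-1}(s,T)=Q_s(T)\bar s-TQ_s(T)$, $S_R^{-1}(s,T)=-(T-\mathcal I\bar s)Q_s(T)$. Slice hyperholomorphy: a real differentiable $f:U\to\mathbb H$ on open $U\subseteq\mathbb H$ is left slice hyperholomorphic if for every $i\in\mathbb S$ its restriction $f_i$ to $U\cap\mathbb C_i$ satisfies $\frac12(\partial_u f_i(u+iv)+i\,\partial_v f_i(u+iv))=0$; it is intrinsic if in addition $f(U\cap\mathbb C_i)\subseteq\mathbb C_i$ for all $i\in\mathbb S$. For $s\in\mathbb H\setminus\{0\}$, $\arg(s)\in[0,\pi]$ is the unique $\theta$ with $s=|s|e^{\theta i_s}$, $i_s=\mathrm{Im}(s)/|\mathrm{Im}(s)|$ if $\mathrm{Im}(s)\ne0$ (any $i_s$ if $s$ real). $\mathcal S_\vartheta=\{s: s=0 \text{ or } \arg(s)\le\vartheta\}$, $\mathcal S_\vartheta^0=\{s\ne0:\arg(s)<\vartheta\}$. Operator of type $\omega$ ($\omega\in[0,\pi)$): a closed, densely defined right-linear operator $T$ with $\sigma_S(T)\subseteq\mathcal S_\omega$ such that for every $\vartheta\in(\omega,\pi]$ there is $C_\vartheta>0$ with $\|S_L^{-1}(s,T)\|\le C_\vartheta/|s|$ and $\|S_R^{-1}(s,T)\|\le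 C_\vartheta/|s|$ for all nonzero $s\in\mathbb H\setminus\mathcal S_\vartheta$. $\Omega$ is the set of operators of type $\omega$ that are injective with dense range. Function classes: $\mathcal{SH}_L^\infty(\mathcal S^0_\mu)$: bounded left slice hyperholomorphic functions on $\mathcal S^0_\mu$, $\|f\|_\infty=\sup_{\mathcal S^0_\mu}|f|$. $\Psi_L(\mathcal S_\mu^0)$ (resp. $\Psi(\mathcal S^0_\mu)$): left slice hyperholomorphic (resp. intrinsic) $f$ on $\mathcal S_\mu^0$ with $|f(s)|\le c|s|^\alpha/(1+|s|^{2\alpha})$ for some $\alpha,c>0$. $\Psi^+(\mathcal S^0_\mu)=\{\psi\in\Psi(\mathcal S^0_\mu):\psi(t)>0 \text{ for all } t\in(0,\infty)\}$. S-functional calculus: for $\psi\in\Psi_L(\mathcal S_\mu^0)$ and $T$ of type $\omega$, $\psi(T):=\frac{1}{2\pi}\int_\Gamma S_L^{-1}(s,T)\,ds_i\,\psi(s)$, $ds_i=-i\,ds$, with $i\in\mathbb S$ and $\Gamma\subseteq\mathbb C_i$ a piecewise smooth path which for some $\theta'\in(\omega,\mu)$ satisfies $\Gamma\setminus\{0\}\subseteq\mathcal S^0_\mu\setminus\mathcal S_{\theta'}$ and outside a ball coincides with the rays $re^{\pm i\theta}$ ($\theta\in(\omega,\mu)$), oriented from $\infty e^{i\theta}$ to $\infty e^{-i\theta}$; it is bounded and independent of $\Gamma$, $i$. Quadratic estimate: a right-linear operator $T$ of type $\omega$ satisfies a quadratic estimate with respect to $\psi\in\Psi(\mathcal S^0_\mu)$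 if there is $\beta>0$ with $\int_0^\infty\|\psi(tT)u\|^2\,\frac{dt}{t}\le\beta^2\|u\|^2$ for all $u\in\mathcal H$, where $\psi(tT)$ is given by the S-functional calculus of the type-$\omega$ operator $tT$. Regularizers and H^\infty calculus: $\psi_k(s)=\big(s/(1+s^2)\big)^{k+1}$, $k\in\mathbb N\cup\{0\}$; if $\mathbb S\subseteq\rho_S(T)$, $\psi_k(T):=\big(T(\mathcal I+T^2)^{-1}\big)^{k+1}\in\mathcal B(\mathcal H)$ (injective). $k$ is an admissible regularizer for $f$ if $\psi_kf\in\Psi_L(\mathcal S^0_\mu)$, and then $f(T):=\psi_k(T)^{-1}(\psi_kf)(T)$, with domain $\{v:(\psi_kf)(T)v\in\mathrm{Ran}\,\psi_k(T)\}$ (independent of admissible $k$). *)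

theory Defs
  imports "HOL-Analysis.Analysis"
begin

codatatype quat = Quat (qRe: real) (qI: real) (qJ: real) (qK: real)

lemma quat_eq_iff: "x = y \<longleftrightarrow> qRe x = qRe y \<and> qI x = qI y \<and> qJ x = qJ y \<and> qK x = qK y"
  by (auto intro: quat.expand)

instantiation quat :: ab_group_add
begin
primcorec zero_quat where "qRe 0 = 0" | "qI 0 = 0" | "qJ 0 = 0" | "qK 0 = 0"
primcorec plus_quat where "qRe (x + y) = qRe x + qRe y" | "qI (x + y) = qI x + qI y"
  | "qJ (x + y) = qJ x + qJ y" | "qK (x + y) = qK x + qK y"
primcorec uminus_quat where "qRe (- x) = - qRe x" | "qI (- x) = - qI x"
  | "qJ (- x) = - qJ x" | "qK (- x) = - qK x"
primcorec minus_quat where "qRe (x - y) = qRe x - qRe y" | "qI (x - y) = qI x - qI y"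
  | "qJ (x - y) = qJ x - qJ y" | "qK (x - y) = qK x - qK y"
instance by standard (simp_all add: quat_eq_iff)
end

instantiation quat :: ring_1
begin
primcorec one_quat where "qRe 1 = 1" | "qI 1 = 0" | "qJ 1 = 0" | "qK 1 = 0"
primcorec times_quat where
  "qRe (x * y) = qRe x * qRe y - qI x * qI y - qJ x * qJ y - qK x * qK y"
| "qI (x * y) = qRe x * qI y + qI x * qRe y + qJ x * qK y - qK x * qJ y"
| "qJ (x * y) = qRe x * qJ y - qI x * qK y + qJ x * qRe y + qK x * qI y"
| "qK (x * y) = qRe x * qK y + qI x * qJ y - qJ x * qI y + qK x * qRe y"
instance by standard (simp_all add: quat_eq_iff algebra_simps)
end

instantiation quat :: real_algebra_1
begin
primcorec scaleR_quat where "qRe (scaleR r x) = r * qRe x" | "qI (scaleR r x) = r * qI x"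
  | "qJ (scaleR r x) = r * qJ x" | "qK (scaleR r x) = r * qK x"
instance by standard (simp_all add: quat_eq_iff algebra_simps)
end

lemma sqrt_add4_tri:
  fixes a b c d e f g h :: real
  shows "sqrt ((a+e)^2 + (b+f)^2 + (c+g)^2 + (d+h)^2) \<le> sqrt (a^2+b^2+c^2+d^2) + sqrt (e^2+f^2+g^2+h^2)"
proof -
  have cs: "a*e+b*f+c*g+d*h \<le> sqrt (a^2+b^2+c^2+d^2) * sqrt (e^2+f^2+g^2+h^2)"
  proof -
    have "(a*e+b*f+c*g+d*h)^2 \<le> (a^2+b^2+c^2+d^2) * (e^2+f^2+g^2+h^2)"
    proof -
      have "(a^2+b^2+c^2+d^2) * (e^2+f^2+g^2+h^2) - (a*e+b*f+c*g+d*h)^2 =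
        (a*f-b*e)^2 + (a*g-c*e)^2 + (b*g-c*f)^2 + (a*h-d*e)^2 + (b*h-d*f)^2 + (c*h-d*g)^2"
        by (simp add: power2_eq_square algebra_simps)
      moreover have "0 \<le> (a*f-b*e)^2 + (a*g-c*e)^2 + (b*g-c*f)^2 + (a*h-d*e)^2 + (b*h-d*f)^2 + (c*h-d*g)^2"
        by simp
      ultimately show ?thesis by linarith
    qed
    then have "\<bar>a*e+b*f+c*g+d*h\<bar> \<le> sqrt ((a^2+b^2+c^2+d^2) * (e^2+f^2+g^2+h^2))"
      using real_le_rsqrt by (metis real_sqrt_abs real_sqrt_le_iff)
    then show ?thesis by (simp add: real_sqrt_mult)
  qed
  have "(a+e)^2 + (b+f)^2 + (c+g)^2 + (d+h)^2 \<le> (sqrt (a^2+b^2+c^2+d^2) + sqrt (e^2+f^2+g^2+h^2))^2"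
    using cs by (simp add: power2_eq_square algebra_simps power2_sum[of "sqrt _"])
  then show ?thesis
    by (meson add_nonneg_nonneg real_le_lsqrt real_sqrt_ge_zero sum_squares_ge_zero zero_le_power2)
qed

instantiation quat :: real_normed_algebra_1
begin
definition norm_quat_def: "norm z = sqrt ((qRe z)\<^sup>2 + (qI z)\<^sup>2 + (qJ z)\<^sup>2 + (qK z)\<^sup>2)"
definition sgn_quat_def: "sgn (x::quat) = x /\<^sub>R norm x"
definition dist_quat_def: "dist (x::quat) y = norm (x - y)"
definition uniformity_quat_def [code del]:
  "(uniformity :: (quat \<times> quat) filter) = (INF e\<in>{0 <..}. principal {(x, y). dist x y < e})"
definition open_quat_def [code del]:
  "open (U :: quat set) \<longleftrightarrow> (\<forall>x\<in>U. eventually (\<lambda>(x', y). x' = x \<longrightarrow> y \<in> U) uniformity)"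
lemma norm_mult_q: "norm (x * y) = norm x * norm (y::quat)"
  by (simp add: norm_quat_def real_sqrt_mult [symmetric] power2_eq_square algebra_simps)
instance
proof
  fix r :: real and x y :: quat
  show "(norm x = 0) = (x = 0)"
    by (auto simp add: norm_quat_def quat_eq_iff add_nonneg_eq_0_iff)
  show "norm (x + y) \<le> norm x + norm y"
    unfolding norm_quat_def by (simp add: sqrt_add4_tri)
  show "norm (scaleR r x) = \<bar>r\<bar> * norm x"
    by (simp add: norm_quat_def power_mult_distrib distrib_left [symmetric] real_sqrt_mult)
  show "norm (x * y) \<le> norm x * norm y" by (simp add: norm_mult_q)
  show "norm (1::quat) = 1" by (simp add: norm_quat_def)
qed (simp_all add: sgn_quat_def dist_quat_def uniformity_quat_def open_quat_def)
end


primcorec cnj :: "quat \<Rightarrow> quat" where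
  "qRe (cnj x) = qRe x" | "qI (cnj x) = - qI x" | "qJ (cnj x) = - qJ x" | "qK (cnj x) = - qK x"

lemma norm_sq_quat: "(norm (x::quat))^2 = (qRe x)\<^sup>2 + (qI x)\<^sup>2 + (qJ x)\<^sup>2 + (qK x)\<^sup>2"
  by (simp add: norm_quat_def add_nonneg_nonneg)

instantiation quat :: division_ring
begin
definition inverse_quat_def: "inverse (x::quat) = inverse ((norm x)^2) *\<^sub>R cnj x"
definition divide_quat_def: "(x::quat) div y = x * inverse y"
instance
proof
  fix a :: quat assume a: "a \<noteq> 0"
  then have n: "(qRe a)\<^sup>2 + (qI a)\<^sup>2 + (qJ a)\<^sup>2 + (qK a)\<^sup>2 \<noteq> 0"
    by (metis norm_eq_zero norm_sq_quat power_not_zero zero_neq_numeral)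
  have i: "inverse a = inverse ((qRe a)\<^sup>2 + (qI a)\<^sup>2 + (qJ a)\<^sup>2 + (qK a)\<^sup>2) *\<^sub>R cnj a"
    by (simp add: inverse_quat_def norm_sq_quat)
  show "inverse a * a = 1" using n unfolding i
    by (simp add: quat_eq_iff field_simps power2_eq_square)
  show "a * inverse a = 1" using n unfolding i
    by (simp add: quat_eq_iff field_simps power2_eq_square)
qed (simp_all add: divide_quat_def inverse_quat_def)
end

instance quat :: real_normed_div_algebra
  by standard (simp add: norm_mult_q)




definition qii :: quat where "qii = Quat 0 1 0 0"

definition imag_units :: "quat set" where "imag_units = {q. q * q = -1}"
definition qslice :: "quat \<Rightarrow> quat set" where
  "qslice i = {of_real u + i * of_real v | u v. True}"

definition qarg :: "quat \<Rightarrow> real" where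
  "qarg s = (THE \<theta>. 0 \<le> \<theta> \<and> \<theta> \<le> pi \<and>
      (\<exists>i\<in>imag_units. s = of_real (norm s) * (of_real (cos \<theta>) + i * of_real (sin \<theta>))))"

definition qsector :: "real \<Rightarrow> quat set" where
  "qsector \<theta> = {s. s = 0 \<or> qarg s \<le> \<theta>}"
definition qsector0 :: "real \<Rightarrow> quat set" where
  "qsector0 \<theta> = {s. s \<noteq> 0 \<and> qarg s < \<theta>}"

text \<open>rm x a = x a (right scalar multiplication), ip = quaternion-valued inner product.
  The real vector space structure and norm of the type 'h are required to agree with them.\<close>
definition qhilbert :: "('h::{real_normed_vector,complete_space} \<Rightarrow> quat \<Rightarrow> 'h) \<Rightarrow> ('h \<Rightarrow> 'h \<Rightarrow> quat) \<Rightarrow> bool" where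
  "qhilbert rm ip \<longleftrightarrow>
     (\<forall>x y a. rm (x + y) a = rm x a + rm y a) \<and>
     (\<forall>x a b. rm x (a + b) = rm x a + rm x b) \<and>
     (\<forall>x a b. rm x (a * b) = rm (rm x a) b) \<and>
     (\<forall>x r. rm x (of_real r) = r *\<^sub>R x) \<and>
     (\<forall>x y. ip x y = cnj (ip y x)) \<and>
     (\<forall>x y z a b. ip (rm x a + rm y b) z = ip x z * a + ip y z * b) \<and>
     (\<forall>x. ip x x = of_real ((norm x)\<^sup>2))"

definition hilbert_basis :: "('h::{real_normed_vector,complete_space} \<Rightarrow> quat \<Rightarrow> 'h) \<Rightarrow> ('h \<Rightarrow> 'h \<Rightarrow> quat) \<Rightarrow> 'h set \<Rightarrow> bool" where
  "hilbert_basis rm ip N \<longleftrightarrow>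
     (\<forall>e\<in>N. ip e e = 1) \<and> (\<forall>e\<in>N. \<forall>f\<in>N. e \<noteq> f \<longrightarrow> ip e f = 0) \<and>
     (\<forall>x. (\<forall>e\<in>N. ip x e = 0) \<longrightarrow> x = 0)"

definition lmul :: "('h::{real_normed_vector,complete_space} \<Rightarrow> quat \<Rightarrow> 'h) \<Rightarrow> ('h \<Rightarrow> 'h \<Rightarrow> quat) \<Rightarrow> 'h set \<Rightarrow> quat \<Rightarrow> 'h \<Rightarrow> 'h" where
  "lmul rm ip N q x = (\<Sum>\<^sub>\<infinity>e\<in>N. rm e (q * ip x e))"

definition rlin :: "('h::real_normed_vector \<Rightarrow> quat \<Rightarrow> 'h) \<Rightarrow> 'h set \<Rightarrow> ('h \<Rightarrow> 'h) \<Rightarrow> bool" where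
  "rlin rm D T \<longleftrightarrow> 0 \<in> D \<and>
     (\<forall>x\<in>D. \<forall>y\<in>D. \<forall>a b. rm x a + rm y b \<in> D \<and> T (rm x a + rm y b) = rm (T x) a + rm (T y) b)"

definition bop :: "('h::real_normed_vector \<Rightarrow> quat \<Rightarrow> 'h) \<Rightarrow> ('h \<Rightarrow> 'h) \<Rightarrow> bool" where
  "bop rm A \<longleftrightarrow> rlin rm UNIV A \<and> (\<exists>K. \<forall>x. norm (A x) \<le> K * norm x)"

definition closed_op :: "'h::real_normed_vector set \<Rightarrow> ('h \<Rightarrow> 'h) \<Rightarrow> bool" where
  "closed_op D T \<longleftrightarrow> closed {(x, T x) | x. x \<in> D}"

definition dom2 :: "'h set \<Rightarrow> ('h \<Rightarrow> 'h) \<Rightarrow> 'h set" where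
  "dom2 D T = {x \<in> D. T x \<in> D}"

definition Lq :: "('h::real_normed_vector \<Rightarrow> 'h) \<Rightarrow> quat \<Rightarrow> 'h \<Rightarrow> 'h" where
  "Lq T s x = T (T x) - (2 * qRe s) *\<^sub>R T x + ((norm s)\<^sup>2) *\<^sub>R x"

definition is_Qinv :: "('h::real_normed_vector \<Rightarrow> quat \<Rightarrow> 'h) \<Rightarrow> 'h set \<Rightarrow> ('h \<Rightarrow> 'h) \<Rightarrow> quat \<Rightarrow> ('h \<Rightarrow> 'h) \<Rightarrow> bool" where
  "is_Qinv rm D T s Q \<longleftrightarrow> bop rm Q \<and> (\<forall>y. Q y \<in> dom2 D T \<and> Lq T s (Q y) = y) \<and>
     (\<forall>x\<in>dom2 D T. Q (Lq T s x) = x)"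

definition rhoS :: "('h::real_normed_vector \<Rightarrow> quat \<Rightarrow> 'h) \<Rightarrow> 'h set \<Rightarrow> ('h \<Rightarrow> 'h) \<Rightarrow> quat set" where
  "rhoS rm D T = {s. \<exists>Q. is_Qinv rm D T s Q}"

definition sigmaS :: "('h::real_normed_vector \<Rightarrow> quat \<Rightarrow> 'h) \<Rightarrow> 'h set \<Rightarrow> ('h \<Rightarrow> 'h) \<Rightarrow> quat set" where
  "sigmaS rm D T = UNIV - rhoS rm D T"

definition Qs :: "('h::real_normed_vector \<Rightarrow> quat \<Rightarrow> 'h) \<Rightarrow> 'h set \<Rightarrow> ('h \<Rightarrow> 'h) \<Rightarrow> quat \<Rightarrow> 'h \<Rightarrow> 'h" where
  "Qs rm D T s = (THE Q. is_Qinv rm D T s Q)"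

text \<open>S_L^{-1}(s,T) = Q_s(T) conj(s) - T Q_s(T), where (B a) v = B (a v)\<close>
definition SLinv :: "('h::{real_normed_vector,complete_space} \<Rightarrow> quat \<Rightarrow> 'h) \<Rightarrow> ('h \<Rightarrow> 'h \<Rightarrow> quat) \<Rightarrow> 'h set \<Rightarrow> 'h set \<Rightarrow> ('h \<Rightarrow> 'h) \<Rightarrow> quat \<Rightarrow> 'h \<Rightarrow> 'h" where
  "SLinv rm ip N D T s u = Qs rm D T s (lmul rm ip N (cnj s) u) - T (Qs rm D T s u)"

definition SRinv :: "('h::{real_normed_vector,complete_space} \<Rightarrow> quat \<Rightarrow> 'h) \<Rightarrow> ('h \<Rightarrow> 'h \<Rightarrow> quat) \<Rightarrow> 'h set \<Rightarrow> 'h set \<Rightarrow> ('h \<Rightarrow> 'h) \<Rightarrow> quat \<Rightarrow> 'h \<Rightarrow> 'h" where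
  "SRinv rm ip N D T s u = - (T (Qs rm D T s u) - lmul rm ip N (cnj s) (Qs rm D T s u))"

definition type_op :: "('h::{real_normed_vector,complete_space} \<Rightarrow> quat \<Rightarrow> 'h) \<Rightarrow> ('h \<Rightarrow> 'h \<Rightarrow> quat) \<Rightarrow> 'h set \<Rightarrow> real \<Rightarrow> 'h set \<Rightarrow> ('h \<Rightarrow> 'h) \<Rightarrow> bool" where
  "type_op rm ip N \<omega> D T \<longleftrightarrow> 0 \<le> \<omega> \<and> \<omega> < pi \<and>
     rlin rm D T \<and> closed_op D T \<and> closure D = UNIV \<and>
     sigmaS rm D T \<subseteq> qsector \<omega> \<and>
     (\<forall>\<theta>. \<omega> < \<theta> \<and> \<theta> \<le> pi \<longrightarrow> (\<exists>C>0. \<forall>s. s \<noteq> 0 \<and> s \<notin> qsector \<theta> \<longrightarrow>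
        (\<forall>u. norm (SLinv rm ip N D T s u) \<le> C / norm s * norm u) \<and>
        (\<forall>u. norm (SRinv rm ip N D T s u) \<le> C / norm s * norm u)))"

definition Omega_op :: "('h::{real_normed_vector,complete_space} \<Rightarrow> quat \<Rightarrow> 'h) \<Rightarrow> ('h \<Rightarrow> 'h \<Rightarrow> quat) \<Rightarrow> 'h set \<Rightarrow> real \<Rightarrow> 'h set \<Rightarrow> ('h \<Rightarrow> 'h) \<Rightarrow> bool" where
  "Omega_op rm ip N \<omega> D T \<longleftrightarrow> type_op rm ip N \<omega> D T \<and> inj_on T D \<and> closure (T ` D) = UNIV"

definition adj_dom :: "('h \<Rightarrow> 'h \<Rightarrow> quat) \<Rightarrow> 'h set \<Rightarrow> ('h \<Rightarrow> 'h) \<Rightarrow> 'h set" where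
  "adj_dom ip D T = {y. \<exists>z. \<forall>x\<in>D. ip (T x) y = ip x z}"
definition adj :: "('h \<Rightarrow> 'h \<Rightarrow> quat) \<Rightarrow> 'h set \<Rightarrow> ('h \<Rightarrow> 'h) \<Rightarrow> 'h \<Rightarrow> 'h" where
  "adj ip D T y = (THE z. \<forall>x\<in>D. ip (T x) y = ip x z)"

definition left_slice_hol :: "quat set \<Rightarrow> (quat \<Rightarrow> quat) \<Rightarrow> bool" where
  "left_slice_hol U f \<longleftrightarrow> (\<forall>x\<in>U. f differentiable (at x)) \<and>
     (\<forall>i\<in>imag_units. \<forall>u v. of_real u + i * of_real v \<in> U \<longrightarrow>
        (\<exists>D1 D2. ((\<lambda>t. f (of_real t + i * of_real v)) has_vector_derivative D1) (at u) \<and>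
                 ((\<lambda>t. f (of_real u + i * of_real t)) has_vector_derivative D2) (at v) \<and>
                 (1/2) *\<^sub>R (D1 + i * D2) = 0))"

definition intrinsic :: "quat set \<Rightarrow> (quat \<Rightarrow> quat) \<Rightarrow> bool" where
  "intrinsic U f \<longleftrightarrow> left_slice_hol U f \<and> (\<forall>i\<in>imag_units. f ` (U \<inter> qslice i) \<subseteq> qslice i)"

definition SHinf :: "real \<Rightarrow> (quat \<Rightarrow> quat) set" where
  "SHinf \<mu> = {f. left_slice_hol (qsector0 \<mu>) f \<and> bounded (f ` qsector0 \<mu>)}"

definition supnorm :: "real \<Rightarrow> (quat \<Rightarrow> quat) \<Rightarrow> real" where
  "supnorm \<mu> f = (SUP s\<in>qsector0 \<mu>. norm (f s))"

definition decays :: "real \<Rightarrow> (quat \<Rightarrow> quat) \<Rightarrow> bool" where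
  "decays \<mu> f \<longleftrightarrow> (\<exists>\<alpha>>0. \<exists>c>0. \<forall>s\<in>qsector0 \<mu>.
      norm (f s) \<le> c * norm s powr \<alpha> / (1 + norm s powr (2 * \<alpha>)))"

definition PsiL :: "real \<Rightarrow> (quat \<Rightarrow> quat) set" where
  "PsiL \<mu> = {f. left_slice_hol (qsector0 \<mu>) f \<and> decays \<mu> f}"

definition Psi :: "real \<Rightarrow> (quat \<Rightarrow> quat) set" where
  "Psi \<mu> = {f. intrinsic (qsector0 \<mu>) f \<and> decays \<mu> f}"

definition Psi_plus :: "real \<Rightarrow> (quat \<Rightarrow> quat) set" where
  "Psi_plus \<mu> = {f \<in> Psi \<mu>. \<forall>t>0. \<exists>r>0. f (of_real t) = of_real r}"

text \<open>psi(T) = 1/(2 pi) int_Gamma S_L^{-1}(s,T) ds_i psi(s), computed on the path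
  Gamma = {r e^{+-i theta}} in the slice of i = qii with theta = (omega+mu)/2, oriented from
  infinity e^{i theta} through 0 to infinity e^{-i theta}; ds_i = -i ds.\<close>
definition SFC :: "('h::{real_normed_vector,complete_space} \<Rightarrow> quat \<Rightarrow> 'h) \<Rightarrow> ('h \<Rightarrow> 'h \<Rightarrow> quat) \<Rightarrow> 'h set \<Rightarrow> real \<Rightarrow> real \<Rightarrow> 'h set \<Rightarrow> ('h \<Rightarrow> 'h) \<Rightarrow> (quat \<Rightarrow> quat) \<Rightarrow> 'h \<Rightarrow> 'h" where
  "SFC rm ip N \<omega> \<mu> D T \<psi> u =
     (let \<theta> = (\<omega> + \<mu>) / 2;
          ep = of_real (cos \<theta>) + qii * of_real (sin \<theta>);
          em = of_real (cos \<theta>) - qii * of_real (sin \<theta>)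
      in (1 / (2 * pi)) *\<^sub>R
         (integral {0<..} (\<lambda>r. SLinv rm ip N D T (of_real r * em)
                  (lmul rm ip N ((- qii) * em * \<psi> (of_real r * em)) u))
        - integral {0<..} (\<lambda>r. SLinv rm ip N D T (of_real r * ep)
                  (lmul rm ip N ((- qii) * ep * \<psi> (of_real r * ep)) u))))"

text \<open>quadratic estimate; psi(tT) via the S-functional calculus of tT (domain D, map t T)\<close>
definition quad_est :: "('h::{real_normed_vector,complete_space} \<Rightarrow> quat \<Rightarrow> 'h) \<Rightarrow> ('h \<Rightarrow> 'h \<Rightarrow> quat) \<Rightarrow> 'h set \<Rightarrow> real \<Rightarrow> real \<Rightarrow> 'h set \<Rightarrow> ('h \<Rightarrow> 'h) \<Rightarrow> (quat \<Rightarrow> quat) \<Rightarrow> bool" where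
  "quad_est rm ip N \<omega> \<mu> D T \<psi> \<longleftrightarrow> (\<exists>\<beta>>0. \<forall>u.
     (\<integral>\<^sup>+ t. indicator {0<..} t * ennreal ((norm (SFC rm ip N \<omega> \<mu> D (\<lambda>x. t *\<^sub>R T x) \<psi> u))\<^sup>2 / t) \<partial>lborel)
       \<le> ennreal (\<beta>\<^sup>2 * (norm u)\<^sup>2))"

definition psik :: "nat \<Rightarrow> quat \<Rightarrow> quat" where
  "psik k s = (s * inverse (1 + s * s)) ^ Suc k"

text \<open>psi_k(T) = (T (I + T^2)^{-1})^{k+1}; note (I + T^2)^{-1} = Q_i(T) for the unit i = qii\<close>
definition psikT :: "('h::real_normed_vector \<Rightarrow> quat \<Rightarrow> 'h) \<Rightarrow> 'h set \<Rightarrow> ('h \<Rightarrow> 'h) \<Rightarrow> nat \<Rightarrow> 'h \<Rightarrow> 'h" where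
  "psikT rm D T k = (\<lambda>u. T (Qs rm D T qii u)) ^^ Suc k"

definition admissible :: "real \<Rightarrow> nat \<Rightarrow> (quat \<Rightarrow> quat) \<Rightarrow> bool" where
  "admissible \<mu> k f \<longleftrightarrow> (\<lambda>s. psik k s * f s) \<in> PsiL \<mu>"

definition regk :: "real \<Rightarrow> (quat \<Rightarrow> quat) \<Rightarrow> nat" where
  "regk \<mu> f = (LEAST k. admissible \<mu> k f)"

definition hinf_dom :: "('h::{real_normed_vector,complete_space} \<Rightarrow> quat \<Rightarrow> 'h) \<Rightarrow> ('h \<Rightarrow> 'h \<Rightarrow> quat) \<Rightarrow> 'h set \<Rightarrow> real \<Rightarrow> real \<Rightarrow> 'h set \<Rightarrow> ('h \<Rightarrow> 'h) \<Rightarrow> (quat \<Rightarrow> quat) \<Rightarrow> 'h set" where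
  "hinf_dom rm ip N \<omega> \<mu> D T f =
     {v. SFC rm ip N \<omega> \<mu> D T (\<lambda>s. psik (regk \<mu> f) s * f s) v \<in> range (psikT rm D T (regk \<mu> f))}"

definition hinf_op :: "('h::{real_normed_vector,complete_space} \<Rightarrow> quat \<Rightarrow> 'h) \<Rightarrow> ('h \<Rightarrow> 'h \<Rightarrow> quat) \<Rightarrow> 'h set \<Rightarrow> real \<Rightarrow> real \<Rightarrow> 'h set \<Rightarrow> ('h \<Rightarrow> 'h) \<Rightarrow> (quat \<Rightarrow> quat) \<Rightarrow> 'h \<Rightarrow> 'h" where
  "hinf_op rm ip N \<omega> \<mu> D T f v =
     (THE w. psikT rm D T (regk \<mu> f) w = SFC rm ip N \<omega> \<mu> D T (\<lambda>s. psik (regk \<mu> f) s * f s) v)"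

end

theory Submission
  imports Defs "HOL-Complex_Analysis.Complex_Analysis" "HOL-Real_Asymp.Real_Asymp"
begin

text \<open>
  Right multiplication by one slice \<open>\<complex>\<^sub>i\<close> turns the space into a complex Hilbert space on which \<open>T\<close> is an
  ordinary sectorial operator. A slice hyperholomorphic function is a combination
  \<open>f\<^sub>0 + f\<^sub>1 i + f\<^sub>2 j + f\<^sub>3 k\<close> of intrinsic functions, and \<open>f(T) v\<close> is the sum of the \<open>f\<^sub>p(T) (e\<^sub>p v)\<close>, where
  \<open>f\<^sub>p(T)\<close> is given by a scalar Cauchy integral. With \<open>s = exp \<zeta>\<close> the sector becomes a strip and dilations of \<open>T\<close>
  become translations.

  The constant function \<open>1\<close> has a regularizer only if \<open>\<mu> < \<pi>/2\<close>, because \<open>\<psi>\<^sub>k\<close> has a pole at \<open>i\<close>. The scalar calculus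
  is multiplicative, so that \<open>A\<^sup>k = \<psi>\<^sub>0(T)\<^sup>k\<close> corresponds to \<open>\<psi>\<^sub>0\<^sup>k\<close>. McIntosh's argument with the two quadratic estimates yields
  \<open>\<parallel>(\<psi>\<^sub>0\<^sup>k F)(T) u\<parallel> \<le> C (sup \<bar>F\<bar>) \<parallel>A\<^sup>k u\<parallel>\<close> with \<open>C\<close> independent of \<open>F\<close> and \<open>k\<close>. As \<open>A\<^sup>k\<close> is injective with dense range, \<open>F(T)\<close> is
  everywhere defined with norm at most \<open>C sup \<bar>F\<bar>\<close>.
\<close>

section \<open>Quaternions and sectors\<close>

text \<open>The left multiplication \<open>lm\<close> depends on a Hilbert basis and in general
  commutes neither with \<open>T\<close> nor with \<open>Qs\<close>, so \<open>SLinv\<close> is not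
  a complex resolvent. The reduction works because \<open>Qs\<close> takes the same value at
  conjugate points: when an intrinsic function is integrated over two conjugate rays, only real
  multiples of \<open>Q u\<close> and \<open>T (Q u)\<close> survive (\<open>Vc_diff\<close>), and
  real scalars act alike from both sides. The space need not be separable, so vector integrals are
  gauge integrals and are evaluated only through the complex functionals in \<open>clf\<close>;
  operator identities thereby become identities of scalar line integrals, to which Fubini and Cauchy
  apply. A merely bounded \<open>F\<close> has no convergent Cauchy integral of its own. The factor
  \<open>p0 ^ Suc k\<close> provides convergence, and placing \<open>A ^^ Suc k\<close> on the right
  of the estimate removes it again, so \<open>F\<close> itself is never approximated by decaying
  functions.\<close>

hide_const (open) Defs.cnj

definition emb :: "complex \<Rightarrow> quat" where "emb z = Quat (Re z) (Im z) 0 0"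

lemma emb_simps [simp]: "qRe (emb z) = Re z" "qI (emb z) = Im z" "qJ (emb z) = 0" "qK (emb z) = 0"
  by (simp_all add: emb_def)

lemma qii_simps [simp]: "qRe qii = 0" "qI qii = 1" "qJ qii = 0" "qK qii = 0"
  by (simp_all add: qii_def)

lemma of_real_quat: "(of_real r :: quat) = Quat r 0 0 0"
  by (simp add: of_real_def quat_eq_iff)

lemma of_real_quat_simps [simp]: "qRe (of_real r) = r" "qI (of_real r) = 0" "qJ (of_real r) = 0"
    "qK (of_real r) = 0"
  by (simp_all add: of_real_quat)

lemma emb_add: "emb (a + b) = emb a + emb b" and emb_mult: "emb (a * b) = emb a * emb b"
  and emb_diff: "emb (a - b) = emb a - emb b" and emb_minus: "emb (- a) = - emb a"
  and emb_0 [simp]: "emb 0 = 0" and emb_1 [simp]: "emb 1 = 1" and emb_i: "emb \<i> = qii"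
  and emb_of_real: "emb (of_real r) = of_real r" and emb_scaleR: "emb (r *\<^sub>R a) = r *\<^sub>R emb a"
  by (simp_all add: quat_eq_iff)

lemma norm_emb [simp]: "norm (emb z) = norm z"
  by (simp add: norm_quat_def cmod_def)

lemma emb_eq_0_iff [simp]: "emb z = 0 \<longleftrightarrow> z = 0"
  by (metis norm_emb norm_eq_zero)

lemma emb_cnj: "emb (cnj z) = Defs.cnj (emb z)"
  by (simp add: quat_eq_iff)

lemma cnj_mult_quat: "Defs.cnj (a * b) = Defs.cnj b * Defs.cnj a"
  by (simp add: quat_eq_iff)

lemma cnj_simps_quat [simp]: "Defs.cnj (Defs.cnj a) = a" "Defs.cnj (a + b) = Defs.cnj a + Defs.cnj b"
  "Defs.cnj 0 = 0" "Defs.cnj 1 = 1" "Defs.cnj (of_real r) = of_real r" "Defs.cnj (a - b) = Defs.cnj a - Defs.cnj b"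
  "Defs.cnj (- a) = - Defs.cnj a" "Defs.cnj (r *\<^sub>R a) = r *\<^sub>R Defs.cnj a"
  by (simp_all add: quat_eq_iff)

lemma norm_cnj_quat [simp]: "norm (Defs.cnj a) = norm a"
  by (simp add: norm_quat_def)

lemma mult_cnj_quat: "a * Defs.cnj a = of_real ((norm a)\<^sup>2)" "Defs.cnj a * a = of_real ((norm a)\<^sup>2)"
  by (simp_all add: quat_eq_iff norm_sq_quat) (simp_all add: power2_eq_square)

lemma abs_qRe_le: "\<bar>qRe a\<bar> \<le> norm a" and abs_qI_le: "\<bar>qI a\<bar> \<le> norm a"
  and abs_qJ_le: "\<bar>qJ a\<bar> \<le> norm a" and abs_qK_le: "\<bar>qK a\<bar> \<le> norm a"
proof -
  have s: "(qRe a)\<^sup>2 + (qI a)\<^sup>2 + (qJ a)\<^sup>2 + (qK a)\<^sup>2 = (norm a)\<^sup>2" by (simp add: norm_sq_quat)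
  have p: "0 \<le> (qRe a)\<^sup>2" "0 \<le> (qI a)\<^sup>2" "0 \<le> (qJ a)\<^sup>2" "0 \<le> (qK a)\<^sup>2" by simp_all
  have "(qRe a)\<^sup>2 \<le> (norm a)\<^sup>2" "(qI a)\<^sup>2 \<le> (norm a)\<^sup>2" "(qJ a)\<^sup>2 \<le> (norm a)\<^sup>2" "(qK a)\<^sup>2 \<le> (norm a)\<^sup>2"
    using s p by linarith+
  then show "\<bar>qRe a\<bar> \<le> norm a" "\<bar>qI a\<bar> \<le> norm a" "\<bar>qJ a\<bar> \<le> norm a" "\<bar>qK a\<bar> \<le> norm a"
    by (simp_all flip: abs_le_square_iff)
qed

lemma bounded_linear_qRe: "bounded_linear qRe" and bounded_linear_qI: "bounded_linear qI"
  and bounded_linear_qJ: "bounded_linear qJ" and bounded_linear_qK: "bounded_linear qK"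
  by (auto intro!: bounded_linear_intro[where K=1] simp: abs_qRe_le abs_qI_le abs_qJ_le abs_qK_le)

lemma bounded_linear_emb: "bounded_linear emb"
  by (auto intro!: bounded_linear_intro[where K=1] simp: emb_add emb_scaleR)

lemma emb_inverse: "emb (inverse z) = inverse (emb z)"
proof (cases "z = 0")
  case False
  have "emb (inverse z) * emb z = 1" using False by (simp flip: emb_mult)
  then show ?thesis by (metis inverse_inverse_eq inverse_unique)
qed auto

lemma emb_power: "emb (z ^ n) = emb z ^ n"
  by (induction n) (simp_all add: emb_mult)

text \<open>If \<open>q\<close> has nonzero real part, the imaginary components of
  \<open>q * q = -1\<close> force \<open>q\<close> to be real, and no real square is negative.
  Conversely, a purely imaginary \<open>q\<close> satisfies
  \<open>q * q = - of_real ((norm q)\<^sup>2)\<close>.\<close>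

lemma imag_units_iff: "q \<in> imag_units \<longleftrightarrow> qRe q = 0 \<and> norm q = 1"
proof
  assume q: "q \<in> imag_units"
  then have e: "q * q = -1" by (simp add: imag_units_def)
  then have n: "norm q = 1"
    by (metis norm_minus_cancel norm_mult norm_one power2_eq_square real_sqrt_abs real_sqrt_one abs_norm_cancel)
  have "qRe q = 0"
  proof (rule ccontr)
    assume a: "qRe q \<noteq> 0"
    have "qI q = 0" "qJ q = 0" "qK q = 0" using e a by (auto simp: quat_eq_iff)
    then show False using e a
      by (simp add: quat_eq_iff) (metis add.commute add.inverse_inverse less_le mult_eq_0_iff neg_0_less_iff_less
        neg_less_0_iff_less not_square_less_zero zero_less_one)
  qed
  with n show "qRe q = 0 \<and> norm q = 1" by simp
next
  assume a: "qRe q = 0 \<and> norm q = 1"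
  then have "(qI q)\<^sup>2 + (qJ q)\<^sup>2 + (qK q)\<^sup>2 = 1" using norm_sq_quat[of q] by simp
  with a show "q \<in> imag_units" unfolding imag_units_def by (simp add: quat_eq_iff power2_eq_square)
qed

lemma qii_imag_units [simp]: "qii \<in> imag_units"
  by (simp add: imag_units_iff norm_quat_def)

text \<open>Taking real parts determines \<open>cos \<theta>\<close>, and \<open>cos\<close> is
  injective between 0 and pi. For nonreal \<open>s\<close> the unit is the normalized imaginary
  part; for real \<open>s\<close> the sine vanishes and any unit serves.\<close>

lemma qarg_eq: assumes "s \<noteq> 0" shows "qarg s = arccos (qRe s / norm s)"
proof -
  let ?t = "arccos (qRe s / norm s)"
  have n: "norm s > 0" using assms by simp
  have b: "\<bar>qRe s / norm s\<bar> \<le> 1" using abs_qRe_le[of s] n by simp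
  then have b': "-1 \<le> qRe s / norm s" "qRe s / norm s \<le> 1" by (unfold abs_le_iff) auto
  have ct: "cos ?t = qRe s / norm s" using b by (simp add: cos_arccos_abs)
  have t: "0 \<le> ?t" "?t \<le> pi" using b' by (auto intro: arccos_lbound arccos_ubound)
  define w where "w = s - of_real (qRe s)"
  have rw: "qRe w = 0" by (simp add: w_def)
  have nw: "(norm s)\<^sup>2 = (qRe s)\<^sup>2 + (norm w)\<^sup>2" by (simp add: norm_sq_quat w_def)
  have st: "norm s * sin ?t = norm w"
  proof -
    have "sin ?t \<ge> 0" using t by (simp add: sin_ge_zero)
    moreover have "(norm s * sin ?t)\<^sup>2 = (norm w)\<^sup>2"
    proof -
      have "(norm s * sin ?t)\<^sup>2 = (norm s)\<^sup>2 - (norm s * cos ?t)\<^sup>2"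
        by (simp add: power_mult_distrib sin_squared_eq algebra_simps)
      also have "norm s * cos ?t = qRe s" using ct n by simp
      finally show ?thesis using nw by simp
    qed
    ultimately show ?thesis by (smt (verit) n norm_ge_zero power2_eq_imp_eq zero_le_mult_iff)
  qed
  have ex: "\<exists>i\<in>imag_units. s = of_real (norm s) * (of_real (cos ?t) + i * of_real (sin ?t))"
  proof (cases "w = 0")
    case True
    then have "sin ?t = 0" using st n by simp
    moreover have "qI s = 0" "qJ s = 0" "qK s = 0" using True by (simp_all add: w_def quat_eq_iff)
    moreover have "norm s * cos ?t = qRe s" using ct n by simp
    moreover have "s = of_real (norm s) * (of_real c + qii * of_real d)"
      if "d = 0" "qI s = 0" "qJ s = 0" "qK s = 0" "norm s * c = qRe s" for c d
      using that by (simp add: quat_eq_iff)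
    ultimately have "s = of_real (norm s) * (of_real (cos ?t) + qii * of_real (sin ?t))"
      by blast
    then show ?thesis using qii_imag_units by blast
  next
    case False
    let ?i = "w /\<^sub>R norm w"
    have "?i \<in> imag_units" using False rw by (simp add: imag_units_iff)
    moreover have "of_real (norm s) * (of_real (cos ?t) + ?i * of_real (sin ?t)) = of_real (qRe s)
        + (norm s * sin ?t) *\<^sub>R ?i"
    proof -
      have *: "norm s * cos ?t = qRe s" using ct n by simp
      have "of_real a * (of_real c + u * of_real d) = of_real q + (a * d) *\<^sub>R u"
        if "a * c = q" for a c d q and u :: quat
        using that by (auto simp: quat_eq_iff algebra_simps)
      from this[OF *] show ?thesis .
    qed
    then have "s = of_real (norm s) * (of_real (cos ?t) + ?i * of_real (sin ?t))"
      using False by (simp add: st w_def)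
    ultimately show ?thesis by blast
  qed
  show ?thesis unfolding qarg_def
  proof (rule the_equality)
    fix \<theta> assume a: "0 \<le> \<theta> \<and> \<theta> \<le> pi
        \<and> (\<exists>i\<in>imag_units. s = of_real (norm s) * (of_real (cos \<theta>) + i * of_real (sin \<theta>)))"
    then obtain i where i: "i \<in> imag_units" "s = of_real (norm s) * (of_real (cos \<theta>) + i * of_real (sin \<theta>))"
        by blast
    have "qRe s = norm s * cos \<theta>" by (subst i(2)) (use i(1) in \<open>simp add: imag_units_iff\<close>)
    then have "qRe s / norm s = cos \<theta>" using n by simp
    then show "\<theta> = ?t" using a by (simp add: arccos_cos)
  qed (use t ex in auto)
qed

lemma qarg_emb_exp: assumes "\<bar>Im \<zeta>\<bar> \<le> pi" shows "qarg (emb (exp \<zeta>)) = \<bar>Im \<zeta>\<bar>"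
proof -
  have "qarg (emb (exp \<zeta>)) = arccos (cos (Im \<zeta>))"
    by (simp add: qarg_eq Re_exp)
  also have "\<dots> = arccos (cos \<bar>Im \<zeta>\<bar>)" by simp
  also have "\<dots> = \<bar>Im \<zeta>\<bar>" using assms by (intro arccos_cos) auto
  finally show ?thesis .
qed

lemma emb_exp_sector0: "\<bar>Im \<zeta>\<bar> < \<mu> \<Longrightarrow> \<mu> \<le> pi \<Longrightarrow> emb (exp \<zeta>) \<in> qsector0 \<mu>"
  by (simp add: qsector0_def qarg_emb_exp)

lemma emb_exp_not_sector: "\<theta> < \<bar>Im \<zeta>\<bar> \<Longrightarrow> \<bar>Im \<zeta>\<bar> \<le> pi \<Longrightarrow> emb (exp \<zeta>) \<notin> qsector \<theta>"
  by (simp add: qsector_def qarg_emb_exp)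

section \<open>The complex structure of a quaternionic Hilbert space\<close>

definition sc :: "('h \<Rightarrow> quat \<Rightarrow> 'h) \<Rightarrow> complex \<Rightarrow> 'h \<Rightarrow> 'h" where "sc rm c x = rm x (emb c)"

text \<open>The projection of \<open>ip\<close> to the slice of \<open>qii\<close>. Right
  multiplication by that slice preserves both the slice and the span of j and k, which makes the
  projection complex linear in its first argument.\<close>

definition cip :: "('h \<Rightarrow> 'h \<Rightarrow> quat) \<Rightarrow> 'h \<Rightarrow> 'h \<Rightarrow> complex" where
  "cip ip x y = Complex (qRe (ip x y)) (qI (ip x y))"

locale qhil =
  fixes rm :: "'h::{real_normed_vector,complete_space} \<Rightarrow> quat \<Rightarrow> 'h" and ip :: "'h \<Rightarrow> 'h \<Rightarrow> quat"
  assumes qh: "qhilbert rm ip"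
begin

lemma rm_add: "rm (x + y) a = rm x a + rm y a"
  and rm_add_right: "rm x (a + b) = rm x a + rm x b"
  and rm_mult: "rm x (a * b) = rm (rm x a) b"
  and rm_of_real: "rm x (of_real r) = r *\<^sub>R x"
  and ip_cnj: "ip x y = Defs.cnj (ip y x)"
  and ip_lin: "ip (rm x a + rm y b) z = ip x z * a + ip y z * b"
  and ip_self: "ip x x = of_real ((norm x)\<^sup>2)"
  subgoal by (rule qh[unfolded qhilbert_def, THEN conjunct1, rule_format])
  subgoal by (rule qh[unfolded qhilbert_def, THEN conjunct2, THEN conjunct1, rule_format])
  subgoal by (rule qh[unfolded qhilbert_def, THEN conjunct2, THEN conjunct2, THEN conjunct1, rule_format])
  subgoal by (rule qh[unfolded qhilbert_def, THEN conjunct2, THEN conjunct2, THEN conjunct2, THEN conjunct1,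
      rule_format])
  subgoal by (rule qh[unfolded qhilbert_def, THEN conjunct2, THEN conjunct2, THEN conjunct2, THEN conjunct2, THEN
      conjunct1, rule_format])
  subgoal by (rule qh[unfolded qhilbert_def, THEN conjunct2, THEN conjunct2, THEN conjunct2, THEN conjunct2, THEN
      conjunct2, THEN conjunct1, rule_format])
  subgoal by (rule qh[unfolded qhilbert_def, THEN conjunct2, THEN conjunct2, THEN conjunct2, THEN conjunct2, THEN
      conjunct2, THEN conjunct2, rule_format])
  done

lemma rm_1 [simp]: "rm x 1 = x" using rm_of_real[of x 1] by simp
lemma rm_0 [simp]: "rm x 0 = 0" using rm_of_real[of x 0] by simp
lemma rm_zero_left [simp]: "rm 0 a = 0" using rm_add[of 0 0 a] by simp
lemma rm_minus: "rm (- x) a = - rm x a" using rm_add[of x "- x" a] by (simp add: minus_unique)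
lemma rm_minus_right: "rm x (- a) = - rm x a" using rm_add_right[of x a "- a"] by (simp add: minus_unique)
lemma rm_diff: "rm (x - y) a = rm x a - rm y a" using rm_add[of x "- y" a] by (simp add: rm_minus)
lemma rm_scaleR: "rm (r *\<^sub>R x) a = r *\<^sub>R rm x a"
proof -
  have "rm (r *\<^sub>R x) a = rm x (of_real r * a)" by (simp add: rm_mult rm_of_real)
  also have "of_real r * a = a * of_real r" by (simp add: quat_eq_iff)
  finally show ?thesis by (simp add: rm_mult rm_of_real)
qed
lemma rm_scaleR_right: "rm x (r *\<^sub>R a) = r *\<^sub>R rm x a"
proof -
  have "r *\<^sub>R a = a * of_real r" by (simp add: quat_eq_iff)
  then show ?thesis by (simp add: rm_mult rm_of_real)
qed

lemma ip_add: "ip (x + y) z = ip x z + ip y z" using ip_lin[of x 1 y 1 z] by simp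
lemma ip_rm: "ip (rm x a) z = ip x z * a" using ip_lin[of x a 0 0 z] by simp
lemma ip_zero [simp]: "ip 0 z = 0" using ip_add[of 0 0 z] by simp
lemma ip_minus: "ip (- x) z = - ip x z" using ip_add[of x "- x" z] by (simp add: minus_unique)
lemma ip_diff: "ip (x - y) z = ip x z - ip y z" using ip_add[of x "- y" z] by (simp add: ip_minus)
lemma ip_scaleR: "ip (r *\<^sub>R x) z = r *\<^sub>R ip x z"
  using ip_rm[of x "of_real r" z] by (simp add: rm_of_real) (simp add: quat_eq_iff)
lemma ip_add_right: "ip z (x + y) = ip z x + ip z y"
  by (subst (1 2 3) ip_cnj) (simp add: ip_add)
lemma ip_rm_right: "ip z (rm x a) = Defs.cnj a * ip z x"
  by (subst (1 2) ip_cnj) (simp add: ip_rm cnj_mult_quat)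
lemma ip_zero_right [simp]: "ip z 0 = 0" using ip_add_right[of z 0 0] by simp
lemma ip_diff_right: "ip z (x - y) = ip z x - ip z y"
  by (subst (1 2 3) ip_cnj) (simp add: ip_diff)
lemma ip_minus_right: "ip z (- x) = - ip z x" using ip_diff_right[of z 0 x] by simp
lemma ip_scaleR_right: "ip z (r *\<^sub>R x) = r *\<^sub>R ip z x"
  by (subst (1 2) ip_cnj) (simp add: ip_scaleR)
lemma ip_sum: "ip (sum f A) z = (\<Sum>a\<in>A. ip (f a) z)"
  by (induction A rule: infinite_finite_induct) (simp_all add: ip_add)
lemma ip_sum_right: "ip z (sum f A) = (\<Sum>a\<in>A. ip z (f a))"
  by (induction A rule: infinite_finite_induct) (simp_all add: ip_add_right)

lemma norm_rm: "norm (rm x a) = norm x * norm a"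
proof -
  have "of_real ((norm (rm x a))\<^sup>2) = ip (rm x a) (rm x a)" by (simp add: ip_self)
  also have "\<dots> = Defs.cnj a * ip x x * a" by (simp add: ip_rm ip_rm_right mult.assoc)
  also have "\<dots> = Defs.cnj a * of_real ((norm x)\<^sup>2) * a" by (simp only: ip_self)
  also have "\<dots> = of_real ((norm x)\<^sup>2) * (Defs.cnj a * a)"
  proof -
    have "Defs.cnj a * of_real r * a = of_real r * (Defs.cnj a * a)" for r
      by (simp add: quat_eq_iff algebra_simps)
    then show ?thesis .
  qed
  also have "\<dots> = of_real ((norm x)\<^sup>2 * (norm a)\<^sup>2)" by (simp add: mult_cnj_quat)
  finally have "(norm (rm x a))\<^sup>2 = (norm x * norm a)\<^sup>2"
    unfolding of_real_eq_iff by (simp add: power_mult_distrib)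
  then show ?thesis by (simp add: power2_eq_iff_nonneg)
qed

lemma norm_sum_sq: "(norm (x + y))\<^sup>2 = (norm x)\<^sup>2 + (norm y)\<^sup>2 + 2 * qRe (ip x y)"
proof -
  have "ip (x + y) (x + y) = ip x x + ip y y + (ip x y + Defs.cnj (ip x y))"
    by (simp add: ip_add ip_add_right ip_cnj[of y x])
  then have "qRe (ip (x + y) (x + y)) = qRe (ip x x + ip y y + (ip x y + Defs.cnj (ip x y)))" by simp
  then show ?thesis by (simp add: ip_self del: of_real_add of_real_power)
qed

lemma qRe_ip_le: "qRe (ip x y) \<le> norm x * norm y"
proof (cases "x = 0 \<or> y = 0")
  case False
  let ?u = "(1 / norm x) *\<^sub>R x" and ?v = "(- 1 / norm y) *\<^sub>R y"
  have "0 \<le> (norm (?u + ?v))\<^sup>2" by simp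
  also have "\<dots> = 2 - 2 * (qRe (ip x y) / (norm x * norm y))"
    unfolding norm_sum_sq using False by (simp add: ip_scaleR ip_scaleR_right ip_minus_right)
  finally show ?thesis using False by (simp add: field_simps)
qed auto

lemma norm_ip_le: "norm (ip x y) \<le> norm x * norm y"
proof (cases "ip x y = 0")
  case False
  \<comment> \<open>Right multiplication of \<open>x\<close> by this unit quaternion makes the inner
    product equal to its own norm and leaves \<open>norm x\<close> unchanged, so the bound for real
    parts suffices.\<close>
  let ?q = "ip x y" and ?a = "(1 / norm (ip x y)) *\<^sub>R Defs.cnj (ip x y)"
  have "qRe (ip (rm x ?a) y) = norm ?q"
    using False by (simp add: ip_rm mult_cnj_quat power2_eq_square del: of_real_mult of_real_power)
  moreover have "norm (rm x ?a) = norm x" using False by (simp add: norm_rm)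
  ultimately show ?thesis using qRe_ip_le[of "rm x ?a" y] by simp
qed simp

lemma bounded_linear_ip: "bounded_linear (\<lambda>x. ip x y)"
  by (rule bounded_linear_intro[where K="norm y"]) (simp_all add: ip_add ip_scaleR norm_ip_le)

abbreviation csc where "csc \<equiv> sc rm"
abbreviation cin where "cin \<equiv> cip ip"

lemma sc_add: "csc c (x + y) = csc c x + csc c y" and sc_add_left: "csc (a + b) x = csc a x + csc b x"
  and sc_sc: "csc a (csc b x) = csc (a * b) x" and sc_1 [simp]: "csc 1 x = x" and sc_0 [simp]: "csc 0 x = 0"
  and sc_zero [simp]: "csc c 0 = 0"
  and sc_of_real: "csc (of_real r) x = r *\<^sub>R x"
  and sc_minus_left: "csc (- c) x = - csc c x" and sc_diff: "csc c (x - y) = csc c x - csc c y"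
  and sc_diff_left: "csc (a - b) x = csc a x - csc b x" and sc_scaleR: "csc c (r *\<^sub>R x) = r *\<^sub>R csc c x"
  and sc_scaleR_left: "csc (r *\<^sub>R c) x = r *\<^sub>R csc c x"
proof -
  show "csc (a - b) x = csc a x - csc b x"
    unfolding sc_def emb_diff using rm_add_right[of x "emb a" "- emb b"] by (simp add: rm_minus_right)
  show "csc a (csc b x) = csc (a * b) x" unfolding sc_def by (subst mult.commute) (simp add: emb_mult rm_mult)
qed (simp_all add: sc_def rm_add rm_add_right emb_add emb_of_real rm_of_real rm_minus emb_minus rm_minus_right
    rm_diff rm_scaleR emb_scaleR rm_scaleR_right)

lemma norm_sc: "norm (csc c x) = cmod c * norm x" by (simp add: sc_def norm_rm)

lemma bounded_bilinear_sc: "bounded_bilinear csc"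
  by (rule bounded_bilinear.intro)
    (auto simp: sc_add sc_add_left sc_scaleR sc_scaleR_left norm_sc intro: exI[of _ 1])

lemma cip_add: "cin (x + y) z = cin x z + cin y z" and cip_diff: "cin (x - y) z = cin x z - cin y z"
  and cip_sc: "cin (csc c x) z = c * cin x z" and cip_scaleR: "cin (r *\<^sub>R x) z = r *\<^sub>R cin x z"
  and cip_zero [simp]: "cin 0 z = 0" and cip_zero_right [simp]: "cin z 0 = 0"
  and cip_cnj: "cin x y = cnj (cin y x)" and cip_self: "cin x x = of_real ((norm x)\<^sup>2)"
proof -
  show "cin (csc c x) z = c * cin x z"
    by (simp add: cip_def sc_def ip_rm complex_eq_iff algebra_simps)
  show "cin x y = cnj (cin y x)" by (simp add: cip_def ip_cnj[of x y] complex_eq_iff)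
qed (simp_all add: cip_def ip_add ip_diff ip_scaleR ip_minus ip_self complex_eq_iff del: of_real_power)

lemma cmod_cip_le: "cmod (cin x y) \<le> norm x * norm y"
proof -
  have "(cmod (cin x y))\<^sup>2 \<le> (norm (ip x y))\<^sup>2"
    by (simp add: cip_def cmod_power2 norm_sq_quat)
  then have "cmod (cin x y) \<le> norm (ip x y)" by (simp add: power2_le_iff_abs_le abs_le_square_iff[symmetric])
  then show ?thesis using norm_ip_le[of x y] by linarith
qed

lemma cip_eqI: assumes "\<And>w. cin x w = cin y w" shows "x = y"
proof -
  have "cin (x - y) (x - y) = 0" using assms by (simp add: cip_diff)
  then show ?thesis by (simp add: cip_self del: of_real_power)
qed

text \<open>These functionals test all vector identities. Inner products with fixed vectors belong
  to them, so they separate points, and the set is stable under composition with \<open>K\<close>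
  (\<open>clf_K\<close>), which is not visible for the inner products alone.\<close>

definition clf :: "('h \<Rightarrow> complex) set" where
  "clf = {l. bounded_linear l \<and> (\<forall>c x. l (csc c x) = c * l x)}"

lemma clfD: "l \<in> clf \<Longrightarrow> bounded_linear l" "l \<in> clf \<Longrightarrow> l (csc c x) = c * l x"
  by (simp_all add: clf_def)

lemma cip_clf: "(\<lambda>x. cin x w) \<in> clf"
  by (auto simp: clf_def cip_sc cip_add cip_scaleR cmod_cip_le intro!: bounded_linear_intro[where K="norm w"])

end

section \<open>Left multiplication defined by a Hilbert basis\<close>

locale qhilb = qhil rm ip for rm :: "'h::{real_normed_vector,complete_space} \<Rightarrow> quat \<Rightarrow> 'h" and ip +
  fixes N :: "'h set"
  assumes hb: "hilbert_basis rm ip N"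
begin

lemma ip_basis: "e \<in> N \<Longrightarrow> ip e e = 1" "e \<in> N \<Longrightarrow> f \<in> N \<Longrightarrow> e \<noteq> f \<Longrightarrow> ip e f = 0"
  and basis_total: "(\<And>e. e \<in> N \<Longrightarrow> ip x e = 0) \<Longrightarrow> x = 0"
  using hb unfolding hilbert_basis_def by auto

lemma basis_eqI: assumes "\<And>e. e \<in> N \<Longrightarrow> ip x e = ip y e" shows "x = y"
  using basis_total[of "x - y"] assms by (simp add: ip_diff)

lemma norm_basis_sum:
  assumes "finite F" "F \<subseteq> N"
  shows "(norm (\<Sum>e\<in>F. rm e (a e)))\<^sup>2 = (\<Sum>e\<in>F. (norm (a e))\<^sup>2)"
  using assms
proof (induction F)
  case (insert e F)
  have "ip (rm e (a e)) (\<Sum>f\<in>F. rm f (a f)) = 0"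
    unfolding ip_sum_right ip_rm ip_rm_right using insert by (intro sum.neutral)
        (metis ip_basis(2) insert_subset mult_zero_left mult_zero_right subsetD)
  moreover have "norm e = 1"
  proof -
    have "(norm e)\<^sup>2 = 1" using ip_self[of e] ip_basis(1)[of e] insert.prems
        by (simp add: quat_eq_iff del: of_real_power)
    then show ?thesis by (metis norm_ge_zero abs_of_nonneg real_sqrt_abs real_sqrt_one)
  qed
  ultimately show ?case using insert by (simp add: norm_sum_sq norm_rm)
qed simp

lemma bessel:
  assumes "finite F" "F \<subseteq> N" shows "(\<Sum>e\<in>F. (norm (ip x e))\<^sup>2) \<le> (norm x)\<^sup>2"
proof -
  let ?y = "\<Sum>e\<in>F. rm e (ip x e)"
  have c: "ip ?y e = ip x e" if "e \<in> F" for e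
  proof -
    have "ip ?y e = (\<Sum>f\<in>F. if f = e then ip x e else 0)"
      unfolding ip_sum ip_rm using that assms by (intro sum.cong) (auto simp: ip_basis subset_iff)
    then show ?thesis using that assms by simp
  qed
  have "ip (x - ?y) ?y = 0"
    unfolding ip_sum_right ip_rm_right by (intro sum.neutral) (simp add: c ip_diff)
  then have "(norm x)\<^sup>2 = (norm (x - ?y))\<^sup>2 + (norm ?y)\<^sup>2"
    using norm_sum_sq[of "x - ?y" ?y] by simp
  then show ?thesis using norm_basis_sum[OF assms, of "ip x"] by simp
qed

text \<open>The squared norm of a difference of partial sums is, by orthonormality, a difference of
  partial sums of squares, and these converge by Bessel's inequality. Summability is what gives the
  infinite sum in \<open>lmul\<close> a meaning.\<close>

lemma lmul_has_sum: "((\<lambda>e. rm e (q * ip x e)) has_sum lmul rm ip N q x) N"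
proof -
  let ?f = "\<lambda>e. rm e (q * ip x e)" and ?g = "\<lambda>e. (norm (q * ip x e))\<^sup>2"
  have "?g summable_on N"
  proof (rule nonneg_bounded_partial_sums_imp_summable_on[where C="(norm q)\<^sup>2 * (norm x)\<^sup>2"])
    show "\<forall>\<^sub>F F in finite_subsets_at_top N. sum ?g F \<le> (norm q)\<^sup>2 * (norm x)\<^sup>2"
      by (rule eventually_finite_subsets_at_top_weakI)
        (auto simp: norm_mult power_mult_distrib sum_distrib_left[symmetric] intro!: mult_left_mono bessel)
  qed auto
  then obtain L where L: "(sum ?g \<longlongrightarrow> L) (finite_subsets_at_top N)"
    by (auto simp: summable_on_def has_sum_def)
  have "\<exists>P. eventually P (finite_subsets_at_top N) \<and> (\<forall>F F'. P F \<and> P F' \<longrightarrow> dist (sum ?f F) (sum ?f F') < e)"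
      if "e > 0" for e :: real
  proof -
    \<comment> \<open>Two sums within \<open>d\<close> of the limit differ by less than
      \<open>2 * d\<close>, which is the square of \<open>e / 2\<close>.\<close>
    define d where "d = (e / 2)\<^sup>2 / 2"
    have d: "d > 0" using that by (simp add: d_def)
    have "eventually (\<lambda>F. dist (sum ?g F) L < d) (finite_subsets_at_top N)"
      using L d by (rule tendstoD)
    then obtain F0 where *: "finite F0 \<and> F0 \<subseteq> N \<and> (\<forall>F. finite F \<and> F0 \<subseteq> F \<and> F \<subseteq> N \<longrightarrow> dist (sum ?g F) L < d)"
      unfolding eventually_finite_subsets_at_top by (rule exE)
    note F0 = *[THEN conjunct1] *[THEN conjunct2, THEN conjunct1]
    have F0': "dist (sum ?g F) L < d" if "finite F" "F0 \<subseteq> F" "F \<subseteq> N" for F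
      using *[THEN conjunct2, THEN conjunct2, rule_format, of F] that by simp
    have close: "dist (sum ?f F) (sum ?f F0) < e / 2" if F: "finite F" "F0 \<subseteq> F" "F \<subseteq> N" for F
    proof -
      have "sum ?f F - sum ?f F0 = sum ?f (F - F0)" using F by (intro sum_diff[symmetric])
      then have "(dist (sum ?f F) (sum ?f F0))\<^sup>2 = sum ?g (F - F0)"
        unfolding dist_norm using norm_basis_sum[of "F - F0" "\<lambda>e. q * ip x e"] F by auto
      also have "\<dots> = sum ?g F - sum ?g F0" using F by (intro sum_diff)
      also have "\<dots> < 2 * d" using F0'[OF F] F0'[OF F0(1) order.refl F0(2)]
          by (simp add: dist_real_def abs_if split: if_splits)
      also have "\<dots> = (e / 2)\<^sup>2" by (simp add: d_def)
      finally show ?thesis using \<open>e > 0\<close> by (intro power2_less_imp_less[of _ "e / 2"]) auto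
    qed
    show ?thesis
    proof (intro exI conjI allI impI)
      show "eventually (\<lambda>F. finite F \<and> F0 \<subseteq> F \<and> F \<subseteq> N) (finite_subsets_at_top N)"
        unfolding eventually_finite_subsets_at_top using F0 by blast
      fix F F' assume "(finite F \<and> F0 \<subseteq> F \<and> F \<subseteq> N) \<and> (finite F' \<and> F0 \<subseteq> F' \<and> F' \<subseteq> N)"
      then show "dist (sum ?f F) (sum ?f F') < e"
        using close[of F] close[of F'] dist_triangle_half_l[of "sum ?f F" "sum ?f F0" e "sum ?f F'"] by simp
    qed
  qed
  then have "cauchy_filter (filtermap (sum ?f) (finite_subsets_at_top N))"
    by (simp add: cauchy_filter_metric_filtermap)
  moreover have "complete (UNIV :: 'h set)"
    by (meson Cauchy_convergent UNIV_I complete_def convergent_def)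
  ultimately obtain l where "(sum ?f \<longlongrightarrow> l) (finite_subsets_at_top N)"
    using complete_uniform[where S="UNIV :: 'h set"] by (force simp add: filterlim_def)
  then have "?f summable_on N" by (auto simp: summable_on_def has_sum_def)
  then show ?thesis unfolding lmul_def by (rule has_sum_infsum)
qed

abbreviation lm where "lm \<equiv> lmul rm ip N"

lemma ip_lmul: assumes e: "e \<in> N" shows "ip (lm q x) e = q * ip x e"
proof -
  have "((\<lambda>f. ip (rm f (q * ip x f)) e) has_sum ip (lm q x) e) N"
    by (rule has_sum_bounded_linear[OF bounded_linear_ip lmul_has_sum])
  moreover have "((\<lambda>f. ip (rm f (q * ip x f)) e) has_sum (q * ip x e)) N"
  proof -
    have "((\<lambda>f. ip (rm f (q * ip x f)) e) has_sum (\<Sum>f\<in>{e}. ip (rm f (q * ip x f)) e)) {e}"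
      by (rule has_sum_finite) simp
    then have "((\<lambda>f. ip (rm f (q * ip x f)) e) has_sum (q * ip x e)) {e}"
      using e by (simp add: ip_rm ip_basis)
    then show ?thesis
      by (rule has_sum_cong_neutral[THEN iffD1, rotated -1]) (use e in \<open>auto simp: ip_rm ip_basis\<close>)
  qed
  ultimately show ?thesis by (rule has_sum_unique)
qed

lemma lmul_add: "lm q (x + y) = lm q x + lm q y" and lmul_add_left: "lm (p + q) x = lm p x + lm q x"
  and lmul_lmul: "lm p (lm q x) = lm (p * q) x" and lmul_of_real: "lm (of_real r) x = r *\<^sub>R x"
  and lmul_scaleR_left: "lm (r *\<^sub>R q) x = r *\<^sub>R lm q x"
proof -
  have c: "r *\<^sub>R (a::quat) = of_real r * a" "of_real r * a = a * of_real r" for r a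
    by (simp_all add: quat_eq_iff)
  show "lm q (x + y) = lm q x + lm q y" by (rule basis_eqI) (simp add: ip_lmul ip_add distrib_left)
  show "lm (p + q) x = lm p x + lm q x" by (rule basis_eqI) (simp add: ip_lmul ip_add distrib_right)
  show "lm p (lm q x) = lm (p * q) x" by (rule basis_eqI) (simp add: ip_lmul mult.assoc)
  show "lm (of_real r) x = r *\<^sub>R x" by (rule basis_eqI) (simp add: ip_lmul ip_scaleR c(1))
  show "lm (r *\<^sub>R q) x = r *\<^sub>R lm q x" by (rule basis_eqI) (simp add: ip_lmul ip_scaleR)
qed

lemma lmul_1 [simp]: "lm 1 x = x" using lmul_of_real[of 1 x] by simp
lemma lmul_minus_left: "lm (- q) x = - lm q x" using lmul_scaleR_left[of "-1" q x] by simp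
lemma lmul_diff_left: "lm (p - q) x = lm p x - lm q x" using lmul_add_left[of p "- q" x]
    by (simp add: lmul_minus_left)

text \<open>On finite partial sums the coefficient \<open>q\<close> contributes exactly the factor
  \<open>norm q\<close>. Comparing the limits for \<open>q\<close> and for 1, and using
  \<open>lm 1 x = x\<close>, replaces an appeal to Parseval's identity.\<close>

lemma norm_lmul: "norm (lm q x) = norm q * norm x"
proof -
  have lim: "((\<lambda>F. (norm (\<Sum>e\<in>F. rm e (p * ip x e)))\<^sup>2) \<longlongrightarrow> (norm (lm p x))\<^sup>2) (finite_subsets_at_top N)" for p
  proof -
    have "(sum (\<lambda>e. rm e (p * ip x e)) \<longlongrightarrow> lm p x) (finite_subsets_at_top N)"
      using lmul_has_sum[of p x] by (simp only: has_sum_def)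
    from tendsto_power[OF tendsto_norm[OF this]] show ?thesis .
  qed
  have "((\<lambda>F. (norm (\<Sum>e\<in>F. rm e (q * ip x e)))\<^sup>2) \<longlongrightarrow> (norm q)\<^sup>2 * (norm (lm 1 x))\<^sup>2) (finite_subsets_at_top N)"
  proof (rule Lim_transform_eventually)
    show "((\<lambda>F. (norm q)\<^sup>2 * (norm (\<Sum>e\<in>F. rm e (1 * ip x e)))\<^sup>2) \<longlongrightarrow> (norm q)\<^sup>2 * (norm (lm 1 x))\<^sup>2)
        (finite_subsets_at_top N)"
      by (rule tendsto_mult[OF tendsto_const lim])
    show "\<forall>\<^sub>F F in finite_subsets_at_top N. (norm q)\<^sup>2 * (norm (\<Sum>e\<in>F. rm e (1 * ip x e)))\<^sup>2
        = (norm (\<Sum>e\<in>F. rm e (q * ip x e)))\<^sup>2"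
      by (rule eventually_finite_subsets_at_top_weakI)
        (simp add: norm_basis_sum norm_mult power_mult_distrib sum_distrib_left)
  qed
  then have "(norm (lm q x))\<^sup>2 = (norm q * norm x)\<^sup>2"
    using tendsto_unique[OF _ lim[of q]] by (simp add: power_mult_distrib)
  then show ?thesis by (simp add: power2_eq_iff_nonneg)
qed

end

section \<open>Cauchy integrals on a strip\<close>

definition strip :: "real \<Rightarrow> real \<Rightarrow> complex set" where "strip a b = {z. a < Im z \<and> Im z < b}"

lemma open_strip: "open (strip a b)"
proof -
  have "strip a b = {z. a < Im z} \<inter> {z. Im z < b}" by (auto simp: strip_def)
  then show ?thesis by (simp add: open_Int open_halfspace_Im_gt open_halfspace_Im_lt)
qed

lemma convex_strip: "convex (strip a b)"
proof -
  have "strip a b = {z. a < Im z} \<inter> {z. Im z < b}" by (auto simp: strip_def)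
  then show ?thesis by (simp add: convex_Int convex_halfspace_Im_gt convex_halfspace_Im_lt)
qed

lemma continuous_on_Complex_line: "continuous_on A (\<lambda>x. Complex x y)"
proof -
  have "(\<lambda>x. Complex x y) = (\<lambda>x. of_real x + \<i> * of_real y)" by (auto simp: complex_eq_iff)
  then show ?thesis by (simp add: continuous_intros)
qed

lemma integrable_exp_decay: assumes "a > 0" shows "integrable lborel (\<lambda>x::real. exp (- a * \<bar>x\<bar>))"
proof -
  have hi: "(\<lambda>x. exp (- a * x)) integrable_on {0..}"
    using has_integral_exp_minus_to_infinity[OF assms, of 0] by blast
  have "(\<lambda>x. exp (- a * x)) absolutely_integrable_on {0..}"
    by (rule nonnegative_absolutely_integrable_1[OF hi]) simp
  then have "integrable lebesgue (\<lambda>x. indicator {0..} x *\<^sub>R exp (- a * x))"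
    by (simp add: set_integrable_def)
  then have 1: "integrable lborel (\<lambda>x. indicator {0..} x *\<^sub>R exp (- a * x))"
    by (subst (asm) integrable_completion) auto
  have 2: "integrable lborel (\<lambda>x. indicator {0..} (0 + -1 * x) *\<^sub>R exp (- a * (0 + -1 * x)))"
    by (rule lborel_integrable_real_affine[OF 1]) simp
  show ?thesis
    by (rule Bochner_Integration.integrable_bound[OF Bochner_Integration.integrable_add[OF 1 2]])
      (auto simp: indicator_def abs_if)
qed

lemma integrable_cont_decay:
  fixes f :: "real \<Rightarrow> 'a::{banach,second_countable_topology}"
  assumes f: "continuous_on UNIV f" and a: "a > 0"
    and b: "\<And>x. \<bar>x\<bar> \<ge> r \<Longrightarrow> norm (f x) \<le> c * exp (- a * \<bar>x\<bar>)"
  shows "integrable lborel f"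
proof -
  have "compact (f ` {-r..r})"
    using f by (intro compact_continuous_image) (auto intro: continuous_on_subset)
  then obtain M where M: "\<And>x. x \<in> {-r..r} \<Longrightarrow> norm (f x) \<le> M"
    by (meson bounded_iff compact_imp_bounded imageI)
  have "norm (f x) \<le> norm ((\<bar>c\<bar> + \<bar>M\<bar> * exp (a * \<bar>r\<bar>)) * exp (- a * \<bar>x\<bar>))" for x
  proof (cases "\<bar>x\<bar> \<ge> r")
    case True
    have "norm (f x) \<le> c * exp (- a * \<bar>x\<bar>)" using b[OF True] .
    also have "\<dots> \<le> (\<bar>c\<bar> + \<bar>M\<bar> * exp (a * \<bar>r\<bar>)) * exp (- a * \<bar>x\<bar>)"
      by (intro mult_right_mono) (auto intro: order_trans[OF abs_ge_self])
    finally show ?thesis by simp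
  next
    case False
    then have "norm (f x) \<le> M" using False unfolding not_le by (intro M) (simp add: abs_less_iff)
    then have "norm (f x) \<le> \<bar>M\<bar>" by linarith
    also have "\<dots> \<le> \<bar>M\<bar> * (exp (a * \<bar>r\<bar>) * exp (- a * \<bar>x\<bar>))"
    proof -
      have "1 \<le> exp (a * \<bar>r\<bar>) * exp (- a * \<bar>x\<bar>)"
        using False a by (simp flip: exp_add)
      then show ?thesis by (metis abs_ge_zero mult.right_neutral mult_left_mono)
    qed
    also have "\<dots> \<le> (\<bar>c\<bar> + \<bar>M\<bar> * exp (a * \<bar>r\<bar>)) * exp (- a * \<bar>x\<bar>)"
      by (simp add: distrib_right)
    finally show ?thesis by simp
  qed
  then show ?thesis
    using f by (intro Bochner_Integration.integrable_bound[where g=f and f="\<lambda>x. (\<bar>c\<bar> + \<bar>M\<bar> * exp (a * \<bar>r\<bar>))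
        * exp (- a * \<bar>x\<bar>)"]
      integrable_mult_right integrable_exp_decay[OF a] AE_I2) (auto intro: borel_measurable_continuous_onI)
qed

lemma integral_interval_tendsto:
  fixes f :: "real \<Rightarrow> 'a::euclidean_space"
  assumes "integrable lborel f"
  shows "(\<lambda>n. integral {- real n..real n} f) \<longlonglongrightarrow> (LBINT x. f x)"
proof -
  have "(\<lambda>n. LBINT x. indicator {- real n..real n} x *\<^sub>R f x) \<longlonglongrightarrow> (LBINT x. f x)"
  proof (rule integral_dominated_convergence[where w="\<lambda>x. norm (f x)"])
    show "AE x in lborel. (\<lambda>n. indicator {- real n..real n} x *\<^sub>R f x) \<longlonglongrightarrow> f x"
    proof (intro AE_I2)
      fix x :: real
      obtain n0 :: nat where n0: "\<bar>x\<bar> \<le> real n0" using real_arch_simple by blast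
      have "eventually (\<lambda>n. indicator {- real n..real n} x *\<^sub>R f x = f x) sequentially"
        using eventually_ge_at_top[of n0] by eventually_elim (use n0 in \<open>auto simp: indicator_def\<close>)
      then show "(\<lambda>n. indicator {- real n..real n} x *\<^sub>R f x) \<longlonglongrightarrow> f x"
        by (rule tendsto_eventually)
    qed
  qed (use assms in \<open>auto simp: indicator_def\<close>)
  moreover have "(LBINT x. indicator {- real n..real n} x *\<^sub>R f x) = integral {- real n..real n} f" for n
  proof -
    have "set_integrable lborel {- real n..real n} f"
      using assms unfolding set_integrable_def by (intro integrable_mult_indicator) auto
    from set_borel_integral_eq_integral(2)[OF this] show ?thesis by (simp add: set_lebesgue_integral_def)
  qed
  ultimately show ?thesis by simp
qed

section \<open>Line integrals, contour shifts and Cauchy's formula in a strip\<close>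

definition LI :: "real \<Rightarrow> (complex \<Rightarrow> complex) \<Rightarrow> complex" where "LI y h = (LBINT x. h (Complex x y))"

lemma line_integrable:
  assumes h: "continuous_on S h" and S: "\<And>x. Complex x y \<in> S" and a: "\<alpha> > 0"
    and b: "\<And>z. z \<in> S \<Longrightarrow> \<bar>Re z\<bar> \<ge> r \<Longrightarrow> cmod (h z) \<le> c * exp (- \<alpha> * \<bar>Re z\<bar>)"
  shows "integrable lborel (\<lambda>x. h (Complex x y))"
proof (rule integrable_cont_decay[OF _ a])
  show "continuous_on UNIV (\<lambda>x. h (Complex x y))"
    by (rule continuous_on_compose2[OF h continuous_on_Complex_line]) (use S in auto)
  show "cmod (h (Complex x y)) \<le> c * exp (- \<alpha> * \<bar>x\<bar>)" if "\<bar>x\<bar> \<ge> r" for x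
    using b[OF S, of x] that by simp
qed

text \<open>A convex strip carries a primitive \<open>P\<close> of \<open>h\<close>. The truncated
  integrals over the two lines differ by increments of \<open>P\<close> along the two vertical ends,
  and each is at most the length of the end times the decaying bound for \<open>h\<close>.\<close>

lemma LI_shift:
  assumes h: "h holomorphic_on strip a b" and al: "\<alpha> > 0"
    and bd: "\<And>z. z \<in> strip a b \<Longrightarrow> \<bar>Re z\<bar> \<ge> r \<Longrightarrow> cmod (h z) \<le> c * exp (- \<alpha> * \<bar>Re z\<bar>)"
    and y: "a < y1" "y1 < b" "a < y2" "y2 < b"
  shows "LI y1 h = LI y2 h"
proof -
  obtain P where P: "\<And>z. z \<in> strip a b \<Longrightarrow> (P has_field_derivative h z) (at z within strip a b)"
    using holomorphic_convex_primitive'[OF convex_strip open_strip h] by blast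
  have P': "(P has_field_derivative h z) (at z)" if "z \<in> strip a b" for z
    using P[OF that] that by (simp add: at_within_open[OF _ open_strip])
  have int: "integrable lborel (\<lambda>x. h (Complex x y))" if "a < y" "y < b" for y
    by (rule line_integrable[OF holomorphic_on_imp_continuous_on[OF h] _ al bd])
      (use that in \<open>auto simp: strip_def\<close>)
  have ftc: "integral {- real n..real n} (\<lambda>x. h (Complex x y)) = P (Complex (real n) y) - P (Complex (- real n) y)"
    if "a < y" "y < b" for n :: nat and y
  proof -
    have "((\<lambda>x. P (Complex x y)) has_vector_derivative h (Complex x y)) (at x within {- real n..real n})" for x
    proof -
      have "Complex x y \<in> strip a b" using that by (simp add: strip_def)
      from P'[OF this] have 1: "(P has_field_derivative h (Complex x y)) (at (of_real x + \<i> * y))"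
        by (simp add: complex_eq_iff[of _ "Complex x y"] Complex_eq)
      have "((\<lambda>x. P (of_real x + \<i> * y)) has_vector_derivative h (Complex x y)) (at x)"
      proof -
        have "((\<lambda>x. of_real x + \<i> * y) has_vector_derivative (of_real 1 + 0)) (at x)"
          by (rule has_vector_derivative_add[OF
            bounded_linear.has_vector_derivative[OF bounded_linear_of_real has_vector_derivative_id]
            has_vector_derivative_const])
        from field_vector_diff_chain_at[OF this 1] show ?thesis by (simp add: o_def)
      qed
      then show ?thesis by (simp add: Complex_eq has_vector_derivative_at_within)
    qed
    then have "((\<lambda>x. h (Complex x y)) has_integral (P (Complex (real n) y) - P (Complex (- real n) y)))
        {- real n..real n}"
      by (intro fundamental_theorem_of_calculus) auto
    then show ?thesis by (rule integral_unique)
  qed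
  have vert: "cmod (P (Complex x y1) - P (Complex x y2)) \<le> \<bar>c\<bar> * exp (- \<alpha> * \<bar>x\<bar>) * \<bar>y1 - y2\<bar>" if "\<bar>x\<bar> \<ge> r" for x
  proof -
    let ?S = "closed_segment (Complex x y2) (Complex x y1)"
    have sub: "z \<in> strip a b \<and> Re z = x" if zS: "z \<in> ?S" for z
    proof -
      have "?S \<subseteq> strip a b" using y by (intro closed_segment_subset convex_strip) (auto simp: strip_def)
      moreover have "Re z = x"
      proof -
        obtain u where "z = (1 - u) *\<^sub>R Complex x y2 + u *\<^sub>R Complex x y1" using zS by (auto simp: in_segment)
        then have "Re z = (1 - u) * x + u * x" by simp
        then show ?thesis by (simp add: algebra_simps)
      qed
      ultimately show ?thesis using that by auto
    qed
    have "cmod (P (Complex x y1) - P (Complex x y2)) \<le> \<bar>c\<bar> * exp (- \<alpha> * \<bar>x\<bar>) * cmod (Complex x y1 - Complex x y2)"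
    proof (rule field_differentiable_bound[where S="?S" and f'=h])
      fix z assume z: "z \<in> ?S"
      show "(P has_field_derivative h z) (at z within ?S)"
        using P'[of z] sub[OF z] by (simp add: has_field_derivative_at_within)
      show "cmod (h z) \<le> \<bar>c\<bar> * exp (- \<alpha> * \<bar>x\<bar>)"
        using bd[of z] sub[OF z] that by (smt (verit) exp_ge_zero mult_right_mono)
    qed auto
    also have "cmod (Complex x y1 - Complex x y2) = \<bar>y1 - y2\<bar>" by (simp add: cmod_def)
    finally show ?thesis .
  qed
  have lim: "(\<lambda>n. integral {- real n..real n} (\<lambda>x. h (Complex x y1))
      - integral {- real n..real n} (\<lambda>x. h (Complex x y2))) \<longlonglongrightarrow> LI y1 h - LI y2 h"
    unfolding LI_def by (intro tendsto_diff integral_interval_tendsto int y)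
  have "(\<lambda>n. integral {- real n..real n} (\<lambda>x. h (Complex x y1))
      - integral {- real n..real n} (\<lambda>x. h (Complex x y2))) \<longlonglongrightarrow> 0"
  proof (rule Lim_null_comparison)
    show "eventually (\<lambda>n. cmod (integral {- real n..real n} (\<lambda>x. h (Complex x y1))
        - integral {- real n..real n} (\<lambda>x. h (Complex x y2)))
        \<le> 2 * (\<bar>c\<bar> * exp (- \<alpha> * real n) * \<bar>y1 - y2\<bar>)) sequentially"
      using eventually_ge_at_top[of "nat \<lceil>r\<rceil>"]
    proof eventually_elim
      case (elim n)
      then have r: "r \<le> real n" by linarith
      have "cmod ((P (Complex (real n) y1) - P (Complex (real n) y2))
          - (P (Complex (- real n) y1) - P (Complex (- real n) y2)))
        \<le> cmod (P (Complex (real n) y1) - P (Complex (real n) y2)) + cmod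
            (P (Complex (- real n) y1) - P (Complex (- real n) y2))"
        by (rule norm_triangle_ineq4)
      also have "\<dots> \<le> 2 * (\<bar>c\<bar> * exp (- \<alpha> * real n) * \<bar>y1 - y2\<bar>)"
        using vert[of "real n"] vert[of "- real n"] r by simp
      finally show ?case using y by (simp add: ftc algebra_simps)
    qed
    have "(\<lambda>n. exp (- \<alpha> * real n)) \<longlonglongrightarrow> 0"
      using al by real_asymp
    from tendsto_mult_left[OF this, of "2 * \<bar>c\<bar> * \<bar>y1 - y2\<bar>"]
    show "(\<lambda>n. 2 * (\<bar>c\<bar> * exp (- \<alpha> * real n) * \<bar>y1 - y2\<bar>)) \<longlonglongrightarrow> 0"
      by (simp add: mult_ac)
  qed
  from LIMSEQ_unique[OF lim this] show ?thesis by simp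
qed

lemma integral_sech: "integrable lborel (\<lambda>x::real. 1 / cosh x)" "(LBINT x::real. 1 / cosh x) = pi"
proof -
  have c0: "cosh x \<noteq> 0" for x :: real using cosh_real_pos[of x] by linarith
  show int: "integrable lborel (\<lambda>x::real. 1 / cosh x)"
  proof (rule integrable_cont_decay[where a=1 and r=0 and c=2])
    show "continuous_on UNIV (\<lambda>x::real. 1 / cosh x)" by (intro continuous_intros) (simp add: c0)
    show "norm (1 / cosh x) \<le> 2 * exp (- 1 * \<bar>x\<bar>)" for x :: real
    proof -
      have "exp \<bar>x\<bar> \<le> 2 * cosh x" by (simp add: cosh_def abs_if)
      then show ?thesis using cosh_real_pos[of x] by (simp add: exp_minus field_simps)
    qed
  qed simp
  have "integral {- real n..real n} (\<lambda>x. 1 / cosh x) = 2 * arctan (exp (real n)) - 2 * arctan (exp (- real n))"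
      for n
  proof (rule integral_unique, rule fundamental_theorem_of_calculus)
    fix x :: real
    have "((\<lambda>x. 2 * arctan (exp x)) has_real_derivative 2 * (inverse (1 + (exp x)\<^sup>2) * exp x)) (at x)"
      by (auto intro!: derivative_eq_intros)
    also have "2 * (inverse (1 + (exp x)\<^sup>2) * exp x) = 1 / cosh x"
    proof -
      have "1 + (exp x)\<^sup>2 = 2 * cosh x * exp x"
        by (simp add: cosh_def field_simps power2_eq_square exp_minus)
      then show ?thesis by (simp add: field_simps)
    qed
    finally show "((\<lambda>x. 2 * arctan (exp x)) has_vector_derivative 1 / cosh x) (at x within {- real n..real n})"
      by (simp add: has_real_derivative_iff_has_vector_derivative has_vector_derivative_at_within)
  qed auto
  then have "(\<lambda>n. 2 * arctan (exp (real n)) - 2 * arctan (exp (- real n))) \<longlonglongrightarrow> (LBINT x::real. 1 / cosh x)"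
    using integral_interval_tendsto[OF int] by simp
  moreover have "(\<lambda>n. 2 * arctan (exp (real n)) - 2 * arctan (exp (- real n))) \<longlonglongrightarrow> pi"
    by real_asymp
  ultimately show "(LBINT x::real. 1 / cosh x) = pi" by (rule LIMSEQ_unique)
qed

text \<open>The left side is the distance from 1 to the real line through 0 and
  \<open>cis (Im w)\<close>, on which \<open>exp w\<close> lies.\<close>

lemma one_minus_exp_ge: "\<bar>sin (Im w)\<bar> \<le> cmod (1 - exp w)"
proof -
  define r where "r = exp (Re w)"
  have "(cmod (1 - exp w))\<^sup>2 = (1 - r * cos (Im w))\<^sup>2 + (r * sin (Im w))\<^sup>2"
    by (simp add: cmod_power2 Re_exp Im_exp r_def)
  also have "\<dots> = (r - cos (Im w))\<^sup>2 + (sin (Im w))\<^sup>2"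
  proof -
    have "(1 - r * c)\<^sup>2 + (r * s)\<^sup>2 = 1 - 2 * r * c + r\<^sup>2 * (s\<^sup>2 + c\<^sup>2)"
      "(r - c)\<^sup>2 + s\<^sup>2 = r\<^sup>2 - 2 * r * c + (s\<^sup>2 + c\<^sup>2)" for c s
      by (simp_all add: power2_eq_square algebra_simps)
    from this[of "cos (Im w)" "sin (Im w)"] show ?thesis by simp
  qed
  finally have "(sin (Im w))\<^sup>2 \<le> (cmod (1 - exp w))\<^sup>2" by simp
  then show ?thesis by (metis abs_le_square_iff abs_norm_cancel)
qed

text \<open>With \<open>s = exp z\<close> the left side is the Cauchy kernel together with
  \<open>ds = exp z dz\<close>. In the logarithmic coordinate it depends only on the difference of
  the two points.\<close>

lemma exp_kernel_eq: "exp z / (exp z - exp w) = 1 / (1 - exp (w - z))" for z w :: complex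
proof -
  have "exp z - exp w = exp z * (1 - exp (w - z))" by (simp add: algebra_simps flip: exp_add)
  then show ?thesis by simp
qed

lemma exp_kernel_eq': "exp w / (exp z - exp w) = - (1 / (1 - exp (z - w)))" for z w :: complex
proof -
  have "exp w / (exp z - exp w) = - (exp w / (exp w - exp z))" by (metis divide_minus_right minus_diff_eq)
  then show ?thesis by (simp only: exp_kernel_eq)
qed

lemma exp_kernel_far: assumes "\<bar>Re w\<bar> \<ge> 1" shows "cmod (1 / (1 - exp w)) \<le> 2"
proof -
  have "1 / 2 \<le> \<bar>1 - exp (Re w)\<bar>"
  proof (cases "Re w \<ge> 1")
    case True
    then have "exp 1 \<le> exp (Re w)" by simp
    moreover have "2 \<le> exp (1::real)" using exp_ge_add_one_self[of 1] by simp
    ultimately show ?thesis by linarith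
  next
    case False
    then have "exp (Re w) \<le> exp (- 1)" using assms by simp
    also have "exp (- 1) \<le> (1 / 2 :: real)" using exp_ge_add_one_self[of "1::real"]
        by (simp add: exp_minus field_simps)
    finally show ?thesis by linarith
  qed
  also have "\<bar>1 - exp (Re w)\<bar> = \<bar>cmod 1 - cmod (exp w)\<bar>" by simp
  also have "\<dots> \<le> cmod (1 - exp w)" by (rule norm_triangle_ineq3)
  finally have "1 / cmod (1 - exp w) \<le> 1 / (1 / 2)" by (intro frac_le) auto
  then show ?thesis by (simp add: norm_divide)
qed

lemma exp_kernel_bound: assumes "sin (Im w) \<noteq> 0" shows "cmod (1 / (1 - exp w)) \<le> 1 / \<bar>sin (Im w)\<bar>"
  using one_minus_exp_ge[of w] assms by (simp add: norm_divide frac_le)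

lemma exp_eq_strip:
  assumes "exp z = exp w" "\<bar>Im z - Im w\<bar> < 2 * pi" shows "z = w"
proof -
  from assms(1) obtain n :: int where n: "z = w + (of_int (2 * n) * pi) * \<i>" by (auto simp: exp_eq)
  then have "Im z - Im w = of_int (2 * n) * pi" by simp
  with assms(2) have "\<bar>real_of_int n\<bar> * (2 * pi) < 1 * (2 * pi)" by (simp add: abs_mult)
  then have "\<bar>real_of_int n\<bar> < 1" by (subst (asm) mult_less_cancel_right) auto
  then have "n = 0" by linarith
  with n show ?thesis by simp
qed

text \<open>The bound is imposed only for large real parts, so that integrands with poles at finite
  points, such as \<open>1 / sinh (z - \<zeta>)\<close>, are included.\<close>

definition decay :: "complex set \<Rightarrow> (complex \<Rightarrow> complex) \<Rightarrow> bool" where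
  "decay S h \<longleftrightarrow> (\<exists>c \<alpha> r. \<alpha> > 0 \<and> (\<forall>z\<in>S. r \<le> \<bar>Re z\<bar> \<longrightarrow> cmod (h z) \<le> c * exp (- \<alpha> * \<bar>Re z\<bar>)))"

lemma decay_shift: "h holomorphic_on strip a b \<Longrightarrow> decay (strip a b) h \<Longrightarrow> a < y1 \<Longrightarrow> y1 < b \<Longrightarrow> a < y2 \<Longrightarrow> y2 < b \<Longrightarrow> LI y1 h
    = LI y2 h"
  unfolding decay_def by (blast intro: LI_shift)

lemma decay_integrable: "continuous_on S h \<Longrightarrow> decay S h \<Longrightarrow> (\<And>x. Complex x y \<in> S)
    \<Longrightarrow> integrable lborel (\<lambda>x. h (Complex x y))"
  unfolding decay_def by (blast intro: line_integrable)

lemma decay_subset: "decay S h \<Longrightarrow> T \<subseteq> S \<Longrightarrow> decay T h"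
  unfolding decay_def by blast

lemma decay_bound:
  assumes "decay S f" "\<And>z. z \<in> S \<Longrightarrow> r \<le> \<bar>Re z\<bar> \<Longrightarrow> cmod (h z) \<le> M * cmod (f z)"
  shows "decay S h"
proof -
  from assms(1) obtain c \<alpha> s where *: "\<alpha> > 0" "\<And>z. z \<in> S \<Longrightarrow> s \<le> \<bar>Re z\<bar> \<Longrightarrow> cmod (f z) \<le> c * exp (- \<alpha> * \<bar>Re z\<bar>)"
    unfolding decay_def by blast
  show ?thesis unfolding decay_def
  proof (intro exI conjI ballI impI)
    fix z assume z: "z \<in> S" "max r s \<le> \<bar>Re z\<bar>"
    have "cmod (h z) \<le> M * cmod (f z)" using assms(2)[OF z(1)] z(2) by simp
    also have "\<dots> \<le> \<bar>M\<bar> * cmod (f z)" by (rule mult_right_mono) auto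
    also have "\<dots> \<le> \<bar>M\<bar> * (c * exp (- \<alpha> * \<bar>Re z\<bar>))" using *(2)[OF z(1)] z(2) by (intro mult_left_mono) auto
    finally show "cmod (h z) \<le> (\<bar>M\<bar> * c) * exp (- \<alpha> * \<bar>Re z\<bar>)" by (simp add: mult.assoc)
  qed (use * in auto)
qed

lemma decay_diff:
  assumes "decay S f" "decay S g" shows "decay S (\<lambda>z. f z - g z)"
proof -
  from assms obtain c \<alpha> s c' \<beta> s' where *: "\<alpha> > 0" "\<And>z. z \<in> S \<Longrightarrow> s \<le> \<bar>Re z\<bar> \<Longrightarrow> cmod (f z) \<le> c * exp (- \<alpha> * \<bar>Re z\<bar>)"
    "\<beta> > 0" "\<And>z. z \<in> S \<Longrightarrow> s' \<le> \<bar>Re z\<bar> \<Longrightarrow> cmod (g z) \<le> c' * exp (- \<beta> * \<bar>Re z\<bar>)"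
    unfolding decay_def by metis
  show ?thesis unfolding decay_def
  proof (intro exI conjI ballI impI)
    fix z assume z: "z \<in> S" "max s s' \<le> \<bar>Re z\<bar>"
    have m: "exp (- \<alpha> * \<bar>Re z\<bar>) \<le> exp (- min \<alpha> \<beta> * \<bar>Re z\<bar>)" "exp (- \<beta> * \<bar>Re z\<bar>) \<le> exp (- min \<alpha> \<beta> * \<bar>Re z\<bar>)"
      by (auto intro!: mult_right_mono)
    have "cmod (f z - g z) \<le> cmod (f z) + cmod (g z)" by (rule norm_triangle_ineq4)
    also have "\<dots> \<le> c * exp (- \<alpha> * \<bar>Re z\<bar>) + c' * exp (- \<beta> * \<bar>Re z\<bar>)"
      using *(2)[OF z(1)] *(4)[OF z(1)] z(2) by simp
    also have "\<dots> \<le> \<bar>c\<bar> * exp (- \<alpha> * \<bar>Re z\<bar>) + \<bar>c'\<bar> * exp (- \<beta> * \<bar>Re z\<bar>)"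
      by (intro add_mono mult_right_mono) auto
    also have "\<dots> \<le> \<bar>c\<bar> * exp (- min \<alpha> \<beta> * \<bar>Re z\<bar>) + \<bar>c'\<bar> * exp (- min \<alpha> \<beta> * \<bar>Re z\<bar>)"
      by (intro add_mono mult_left_mono m) auto
    finally show "cmod (f z - g z) \<le> (\<bar>c\<bar> + \<bar>c'\<bar>) * exp (- min \<alpha> \<beta> * \<bar>Re z\<bar>)" by (simp add: distrib_right)
  qed (use * in auto)
qed

text \<open>Cauchy's integral over the boundary of the strip
  \<open>\<bar>Im z\<bar> < \<theta>\<close>, taken counterclockwise: the lower line from left to
  right and the upper one back. Under \<open>exp\<close> this is the orientation of the path in
  \<open>SFC\<close>.\<close>

definition Jl :: "real \<Rightarrow> (complex \<Rightarrow> complex) \<Rightarrow> complex" where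
  "Jl \<theta> h = (LI (- \<theta>) h - LI \<theta> h) / (2 * pi * \<i>)"

lemma Jl_zero: "h holomorphic_on strip (- b) b \<Longrightarrow> decay (strip (- b) b) h \<Longrightarrow> 0 \<le> \<theta> \<Longrightarrow> \<theta> < b \<Longrightarrow> Jl \<theta> h = 0"
  unfolding Jl_def using decay_shift[of h "- b" b "- \<theta>" \<theta>] by simp

lemma Jl_shift:
  assumes "h holomorphic_on strip a b \<union> strip (- b) (- a)" "decay (strip a b \<union> strip (- b) (- a)) h"
    and "a < y1" "y1 < b" "a < y2" "y2 < b"
  shows "Jl y1 h = Jl y2 h"
proof -
  have "LI y1 h = LI y2 h"
    by (rule decay_shift[where a=a and b=b]) (use assms in \<open>auto intro: holomorphic_on_subset decay_subset\<close>)
  moreover have "LI (- y1) h = LI (- y2) h"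
    by (rule decay_shift[where a="-b" and b="-a"]) (use assms in \<open>auto intro: holomorphic_on_subset decay_subset\<close>)
  ultimately show ?thesis by (simp add: Jl_def)
qed

lemma LI_cong: "(\<And>x. f (Complex x y) = g (Complex x y)) \<Longrightarrow> LI y f = LI y g"
  by (simp add: LI_def)

lemma LI_diff: "integrable lborel (\<lambda>x. f (Complex x y)) \<Longrightarrow> integrable lborel (\<lambda>x. g (Complex x y)) \<Longrightarrow>
    LI y (\<lambda>z. f z - g z) = LI y f - LI y g"
  by (simp add: LI_def)

lemma LI_cmult: "LI y (\<lambda>z. c * f z) = c * LI y f"
  by (simp add: LI_def)

lemma sinh_lower: assumes "\<bar>Re z\<bar> \<ge> 1" shows "exp \<bar>Re z\<bar> / 4 \<le> cmod (sinh z)"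
proof -
  have *: "exp t / 4 \<le> (exp t - exp (- t)) / 2" if "t \<ge> 1" for t :: real
  proof -
    have "2 * exp (- t) \<le> exp t"
    proof -
      have "2 \<le> exp (2 * t)" using exp_ge_add_one_self[of "2 * t"] that by linarith
      then show ?thesis by (simp add: exp_minus field_simps flip: exp_add)
    qed
    then show ?thesis by simp
  qed
  have "\<bar>cmod (exp z) - cmod (exp (- z))\<bar> \<le> cmod (exp z - exp (- z))" by (rule norm_triangle_ineq3)
  then have "\<bar>exp (Re z) - exp (- Re z)\<bar> / 2 \<le> cmod (sinh z)"
    by (simp add: sinh_def scaleR_conv_of_real norm_mult)
  moreover have "exp \<bar>Re z\<bar> / 4 \<le> \<bar>exp (Re z) - exp (- Re z)\<bar> / 2"
    using *[of "\<bar>Re z\<bar>"] assms by (cases "Re z \<ge> 0") auto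
  ultimately show ?thesis by linarith
qed

lemma sinh_zero_strip: assumes "sinh z = 0" "\<bar>Im z\<bar> < pi" shows "z = (0::complex)"
proof -
  have "exp z = exp (- z)" using assms(1) by (simp add: sinh_def)
  then show ?thesis using exp_eq_strip[of z "- z"] assms(2) by simp
qed

lemma decay_inverse_sinh: "decay S (\<lambda>z. 1 / sinh (z - \<zeta>))"
  unfolding decay_def
proof (intro exI conjI ballI impI)
  fix z :: complex assume z: "1 + \<bar>Re \<zeta>\<bar> \<le> \<bar>Re z\<bar>"
  then have "exp \<bar>Re (z - \<zeta>)\<bar> / 4 \<le> cmod (sinh (z - \<zeta>))" by (intro sinh_lower) auto
  moreover have "exp (\<bar>Re z\<bar> - \<bar>Re \<zeta>\<bar>) \<le> exp \<bar>Re (z - \<zeta>)\<bar>" by simp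
  ultimately have "exp (\<bar>Re z\<bar> - \<bar>Re \<zeta>\<bar>) / 4 \<le> cmod (sinh (z - \<zeta>))" by linarith
  then have "1 / cmod (sinh (z - \<zeta>)) \<le> 1 / (exp (\<bar>Re z\<bar> - \<bar>Re \<zeta>\<bar>) / 4)" by (intro frac_le) auto
  then show "cmod (1 / sinh (z - \<zeta>)) \<le> (4 * exp \<bar>Re \<zeta>\<bar>) * exp (- 1 * \<bar>Re z\<bar>)"
    by (simp add: norm_divide exp_diff exp_minus field_simps)
qed simp

lemma holomorphic_inverse_sinh: "(\<And>z. z \<in> S \<Longrightarrow> sinh (z - \<zeta>) \<noteq> 0) \<Longrightarrow> (\<lambda>z. 1 / sinh (z - \<zeta>)) holomorphic_on S"
  unfolding sinh_def by (intro holomorphic_intros) (auto simp: sinh_def)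

lemma sinh_shift_half_pi:
  "sinh (of_real t + \<i> * of_real (pi / 2)) = \<i> * of_real (cosh t)"
  "sinh (of_real t - \<i> * of_real (pi / 2)) = - \<i> * of_real (cosh t)"
proof -
  have "exp (of_real t + \<i> * of_real (pi / 2)) = \<i> * of_real (exp t)"
    "exp (- (of_real t + \<i> * of_real (pi / 2))) = - \<i> * of_real (exp (- t))"
    "exp (of_real t - \<i> * of_real (pi / 2)) = - \<i> * of_real (exp t)"
    "exp (- (of_real t - \<i> * of_real (pi / 2))) = \<i> * of_real (exp (- t))"
    by (simp_all add: complex_eq_iff Re_exp Im_exp del: exp_of_real)
  then show "sinh (of_real t + \<i> * of_real (pi / 2)) = \<i> * of_real (cosh t)"
    "sinh (of_real t - \<i> * of_real (pi / 2)) = - \<i> * of_real (cosh t)"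
    unfolding sinh_def cosh_def by (simp_all only: complex_eq_iff) (simp_all add: field_simps)
qed

text \<open>This is the model case of Cauchy's formula. Between the lines in question the integrand
  has only the pole \<open>\<zeta>\<close>, so the lines can be moved, without crossing it, to the
  heights \<open>Im \<zeta> + pi / 2\<close> and \<open>Im \<zeta> - pi / 2\<close>. There the
  integrand is a multiple of \<open>1 / cosh\<close>, and \<open>integral_sech\<close> gives the
  value.\<close>

lemma Jl_inverse_sinh:
  assumes "\<bar>Im \<zeta>\<bar> < \<theta>" "\<theta> < pi / 2"
  shows "Jl \<theta> (\<lambda>z. 1 / sinh (z - \<zeta>)) = 1"
proof -
  have nz: "sinh (z - \<zeta>) \<noteq> 0" if "z \<in> strip (Im \<zeta>) (Im \<zeta> + pi) \<or> z \<in> strip (Im \<zeta> - pi) (Im \<zeta>)" for z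
  proof
    assume "sinh (z - \<zeta>) = 0"
    moreover have "\<bar>Im (z - \<zeta>)\<bar> < pi" "Im z \<noteq> Im \<zeta>" using that by (auto simp: strip_def)
    ultimately show False using sinh_zero_strip[of "z - \<zeta>"] by simp
  qed
  have "LI \<theta> (\<lambda>z. 1 / sinh (z - \<zeta>)) = LI (Im \<zeta> + pi / 2) (\<lambda>z. 1 / sinh (z - \<zeta>))"
    by (rule decay_shift[where a="Im \<zeta>" and b="Im \<zeta> + pi"])
      (use assms in \<open>auto intro!: holomorphic_inverse_sinh decay_inverse_sinh nz\<close>)
  also have "\<dots> = (LBINT x. - \<i> * (1 / of_real (cosh (x - Re \<zeta>))))"
    unfolding LI_def
  proof (rule Bochner_Integration.integral_cong[OF refl])
    fix x
    have "Complex x (Im \<zeta> + pi / 2) - \<zeta> = of_real (x - Re \<zeta>) + \<i> * of_real (pi / 2)" by (simp add: complex_eq_iff)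
    then have "sinh (Complex x (Im \<zeta> + pi / 2) - \<zeta>) = \<i> * of_real (cosh (x - Re \<zeta>))"
      by (simp only: sinh_shift_half_pi)
    then show "1 / sinh (Complex x (Im \<zeta> + pi / 2) - \<zeta>) = - \<i> * (1 / of_real (cosh (x - Re \<zeta>)))"
      by (simp add: field_simps)
  qed
  also have "\<dots> = - \<i> * of_real pi"
  proof -
    have "(LBINT x. 1 / cosh (x - Re \<zeta>)) = pi"
      using lborel_integral_real_affine[of 1 "\<lambda>x. 1 / cosh x" "- Re \<zeta>"] integral_sech(2) by simp
    then have "(LBINT x. complex_of_real (1 / cosh (x - Re \<zeta>))) = of_real pi" by (metis integral_complex_of_real)
    then have "(LBINT x. 1 / complex_of_real (cosh (x - Re \<zeta>))) = of_real pi" by simp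
    then show ?thesis by (simp only: integral_mult_right_zero)
  qed
  finally have 1: "LI \<theta> (\<lambda>z. 1 / sinh (z - \<zeta>)) = - \<i> * of_real pi" .
  have "LI (- \<theta>) (\<lambda>z. 1 / sinh (z - \<zeta>)) = LI (Im \<zeta> - pi / 2) (\<lambda>z. 1 / sinh (z - \<zeta>))"
    by (rule decay_shift[where a="Im \<zeta> - pi" and b="Im \<zeta>"])
      (use assms in \<open>auto intro!: holomorphic_inverse_sinh decay_inverse_sinh nz\<close>)
  also have "\<dots> = (LBINT x. \<i> * (1 / of_real (cosh (x - Re \<zeta>))))"
    unfolding LI_def
  proof (rule Bochner_Integration.integral_cong[OF refl])
    fix x
    have "Complex x (Im \<zeta> - pi / 2) - \<zeta> = of_real (x - Re \<zeta>) - \<i> * of_real (pi / 2)" by (simp add: complex_eq_iff)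
    then have "sinh (Complex x (Im \<zeta> - pi / 2) - \<zeta>) = - \<i> * of_real (cosh (x - Re \<zeta>))"
      by (simp only: sinh_shift_half_pi)
    then show "1 / sinh (Complex x (Im \<zeta> - pi / 2) - \<zeta>) = \<i> * (1 / of_real (cosh (x - Re \<zeta>)))"
      by (simp add: field_simps)
  qed
  also have "\<dots> = \<i> * of_real pi"
  proof -
    have "(LBINT x. 1 / cosh (x - Re \<zeta>)) = pi"
      using lborel_integral_real_affine[of 1 "\<lambda>x. 1 / cosh x" "- Re \<zeta>"] integral_sech(2) by simp
    then have "(LBINT x. complex_of_real (1 / cosh (x - Re \<zeta>))) = of_real pi" by (metis integral_complex_of_real)
    then have "(LBINT x. 1 / complex_of_real (cosh (x - Re \<zeta>))) = of_real pi" by simp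
    then show ?thesis by (simp only: integral_mult_right_zero)
  qed
  finally show ?thesis using 1 by (simp add: Jl_def)
qed

text \<open>The function \<open>f \<zeta> / sinh (z - \<zeta>)\<close> has the same principal part
  at \<open>\<zeta>\<close> as the integrand, so the difference extends holomorphically to the whole
  strip and integrates to 0. The rest is \<open>Jl_inverse_sinh\<close>. The strip is at most pi
  wide, which makes \<open>exp\<close> injective and leaves \<open>sinh (z - \<zeta>)\<close> with a
  single zero.\<close>

lemma Jl_cauchy:
  assumes f: "f holomorphic_on strip (- \<mu>) \<mu>" and d: "decay (strip (- \<mu>) \<mu>) f"
    and z: "\<bar>Im \<zeta>\<bar> < \<theta>" "\<theta> < \<mu>" "\<mu> \<le> pi / 2"
  shows "Jl \<theta> (\<lambda>z. f z * (exp z / (exp z - exp \<zeta>))) = f \<zeta>"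
proof -
  let ?S = "strip (- \<mu>) \<mu>"
  define E where "E z = (if z = \<zeta> then deriv exp \<zeta> else (exp z - exp \<zeta>) / (z - \<zeta>))" for z
  define G where "G z = (if z = \<zeta> then deriv (\<lambda>z. sinh (z - \<zeta>)) \<zeta> else (sinh (z - \<zeta>) - sinh (\<zeta> - \<zeta>)) / (z - \<zeta>))"
      for z
  have E: "E holomorphic_on ?S" unfolding E_def by (rule pole_lemma_open)
      (auto intro!: holomorphic_intros open_strip)
  have G: "G holomorphic_on ?S" unfolding G_def
    by (rule pole_lemma_open) (auto intro!: holomorphic_intros open_strip simp: sinh_def)
  have dE: "deriv exp \<zeta> = exp \<zeta>" by (rule DERIV_imp_deriv) (rule DERIV_exp)
  have dG: "deriv (\<lambda>z. sinh (z - \<zeta>)) \<zeta> = 1"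
    by (rule DERIV_imp_deriv) (auto intro!: derivative_eq_intros simp: sinh_def scaleR_conv_of_real)
  have nzE: "exp z \<noteq> exp \<zeta>" and nzG: "sinh (z - \<zeta>) \<noteq> 0" if "z \<in> ?S" "z \<noteq> \<zeta>" for z
  proof -
    have "- (pi / 2) < Im z" "Im z < pi / 2" "- (pi / 2) < Im \<zeta>" "Im \<zeta> < pi / 2"
      using that(1) z by (auto simp: strip_def)
    then have "\<bar>Im z - Im \<zeta>\<bar> < pi" by linarith
    then show "exp z \<noteq> exp \<zeta>" "sinh (z - \<zeta>) \<noteq> 0"
      using that(2) exp_eq_strip[of z \<zeta>] sinh_zero_strip[of "z - \<zeta>"] pi_gt_zero by auto
  qed
  have E0: "E z \<noteq> 0" and G0: "G z \<noteq> 0" if "z \<in> ?S" for z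
    using nzE[OF that] nzG[OF that] by (auto simp: E_def G_def dE dG)
  \<comment> \<open>\<open>E\<close> and \<open>G\<close> are the difference quotients of
    \<open>exp\<close> and \<open>sinh\<close> with the removable singularity filled in, and neither
    has a zero. The two terms of \<open>q\<close> agree at \<open>\<zeta>\<close>, so dividing
    \<open>q\<close> by \<open>z - \<zeta>\<close> creates no pole; off \<open>\<zeta>\<close> the
    quotient is the difference of the two kernels.\<close>
  define q where "q z = f z * exp z / E z - f \<zeta> / G z" for z
  have q: "q holomorphic_on ?S" unfolding q_def using E0 G0 by (intro holomorphic_intros f E G) auto
  have q0: "q \<zeta> = 0" by (simp add: q_def E_def G_def dE dG)
  define H where "H z = (if z = \<zeta> then deriv q \<zeta> else (q z - q \<zeta>) / (z - \<zeta>))" for z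
  have H: "H holomorphic_on ?S" unfolding H_def by (rule pole_lemma_open[OF q open_strip])
  let ?k = "\<lambda>z. f z * (exp z / (exp z - exp \<zeta>))" and ?s = "\<lambda>z. f \<zeta> * (1 / sinh (z - \<zeta>))"
  have Heq: "H z = ?k z - ?s z" if "z \<noteq> \<zeta>" for z
  proof -
    have *: "(a / (d / w) - b / (s / w)) / w = a / d - b / s" if "w \<noteq> 0" for a b d s w :: complex
      using that by (simp add: diff_divide_distrib)
    show ?thesis using that *[of "z - \<zeta>" "f z * exp z" "exp z - exp \<zeta>" "f \<zeta>" "sinh (z - \<zeta>)"]
      by (simp add: H_def q0) (simp add: q_def E_def G_def)
  qed
  have dk: "decay ?S ?k"
  proof (rule decay_bound[OF d])
    fix w assume "w \<in> ?S" "1 + \<bar>Re \<zeta>\<bar> \<le> \<bar>Re w\<bar>"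
    then have "cmod (1 / (1 - exp (\<zeta> - w))) \<le> 2" by (intro exp_kernel_far) auto
    then show "cmod (?k w) \<le> 2 * cmod (f w)"
      unfolding exp_kernel_eq norm_mult by (metis mult.commute mult_left_mono norm_ge_zero)
  qed
  have ds: "decay ?S ?s"
    by (rule decay_bound[OF decay_inverse_sinh, where M="cmod (f \<zeta>)" and r=0 and \<zeta>1=\<zeta>])
      (simp add: norm_mult norm_divide)
  have dH: "decay ?S H"
  proof (rule decay_bound[OF decay_diff[OF dk ds], where M=1 and r="1 + \<bar>Re \<zeta>\<bar>"])
    fix w assume "w \<in> ?S" "1 + \<bar>Re \<zeta>\<bar> \<le> \<bar>Re w\<bar>"
    then have "w \<noteq> \<zeta>" by auto
    from Heq[OF this] show "cmod (H w) \<le> 1 * cmod (?k w - ?s w)" by simp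
  qed
  let ?L = "?S - {z. Im z = Im \<zeta>}"
  have cf: "continuous_on ?L f"
    by (rule continuous_on_subset[OF holomorphic_on_imp_continuous_on[OF f]]) auto
  have ck: "continuous_on ?L ?k" using nzE by (intro continuous_intros cf) auto
  have cs: "continuous_on ?L ?s" using nzG
    by (intro continuous_intros holomorphic_on_imp_continuous_on holomorphic_inverse_sinh) auto
  have ik: "integrable lborel (\<lambda>x. ?k (Complex x y))" and si: "integrable lborel (\<lambda>x. ?s (Complex x y))"
      if "y = \<theta> \<or> y = - \<theta>" for y
  proof -
    have "0 < \<theta>" "Im \<zeta> < \<theta>" "- \<theta> < Im \<zeta>" using z(1) by auto
    then have "Complex x y \<in> ?L" for x using that z(2) by (auto simp: strip_def)
    then show "integrable lborel (\<lambda>x. ?k (Complex x y))" "integrable lborel (\<lambda>x. ?s (Complex x y))"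
      using decay_integrable[OF ck decay_subset[OF dk], of y] decay_integrable[OF cs decay_subset[OF ds], of y]
          by blast+
  qed
  have sp: "LI y H = LI y ?k - f \<zeta> * LI y (\<lambda>z. 1 / sinh (z - \<zeta>))" if "y = \<theta> \<or> y = - \<theta>" for y
  proof -
    have "LI y H = LI y (\<lambda>z. ?k z - ?s z)" by (rule LI_cong, rule Heq) (use that z in \<open>auto simp: complex_eq_iff\<close>)
    also have "\<dots> = LI y ?k - LI y ?s" by (rule LI_diff[OF ik si]) (use that in auto)
    finally show ?thesis by (simp only: LI_cmult)
  qed
  have "Jl \<theta> H = 0" by (rule Jl_zero[OF H dH]) (use z in auto)
  then have "Jl \<theta> ?k = f \<zeta> * Jl \<theta> (\<lambda>z. 1 / sinh (z - \<zeta>))"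
    unfolding Jl_def sp[of \<theta>, simplified] sp[of "- \<theta>", simplified] by (simp add: field_simps)
  then show ?thesis using Jl_inverse_sinh[of \<zeta> \<theta>] z by simp
qed

text \<open>The point \<open>z\<close> lies above or below the contour, so the integrand is
  holomorphic on the strip of half width \<open>min \<mu> \<bar>Im z\<bar>\<close>, which contains
  both lines. The bounded kernel far out leaves the decay of \<open>g\<close> intact.\<close>

lemma Jl_cauchy_out:
  assumes g: "g holomorphic_on strip (- \<mu>) \<mu>" and d: "decay (strip (- \<mu>) \<mu>) g"
    and z: "0 \<le> \<theta>" "\<theta> < \<mu>" "\<theta> < \<bar>Im z\<bar>" "\<bar>Im z\<bar> \<le> pi / 2"
  shows "Jl \<theta> (\<lambda>w. g w * (exp w / (exp z - exp w))) = 0"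
proof (rule Jl_zero)
  let ?b = "min \<mu> \<bar>Im z\<bar>"
  have sub: "strip (- ?b) ?b \<subseteq> strip (- \<mu>) \<mu>" by (auto simp: strip_def)
  have "exp z \<noteq> exp w" if "w \<in> strip (- ?b) ?b" for w
  proof
    assume "exp z = exp w"
    then have "z = w" by (rule exp_eq_strip) (use that z in \<open>auto simp: strip_def\<close>)
    then show False using that by (auto simp: strip_def)
  qed
  then show "(\<lambda>w. g w * (exp w / (exp z - exp w))) holomorphic_on strip (- ?b) ?b"
    by (intro holomorphic_intros holomorphic_on_subset[OF g sub]) auto
  show "decay (strip (- ?b) ?b) (\<lambda>w. g w * (exp w / (exp z - exp w)))"
  proof (rule decay_bound[OF decay_subset[OF d sub]])
    fix w assume "1 + \<bar>Re z\<bar> \<le> \<bar>Re w\<bar>"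
    then have "cmod (1 / (1 - exp (z - w))) \<le> 2" by (intro exp_kernel_far) auto
    then show "cmod (g w * (exp w / (exp z - exp w))) \<le> 2 * cmod (g w)"
      unfolding exp_kernel_eq' norm_mult norm_minus_cancel by (metis mult.commute mult_left_mono norm_ge_zero)
  qed
qed (use z in auto)

section \<open>Interchange of integrals, translations and correlations\<close>

lemma Fubini_kernel:
  fixes p q :: "real \<Rightarrow> complex" and k :: "real \<Rightarrow> real \<Rightarrow> complex"
  assumes p: "integrable lborel p" and q: "integrable lborel q"
    and k: "case_prod k \<in> borel_measurable (lborel \<Otimes>\<^sub>M lborel)" and b: "\<And>x y. cmod (k x y) \<le> B"
  shows "(LBINT x. p x * (LBINT y. q y * k x y)) = (LBINT y. q y * (LBINT x. p x * k x y))"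
    and "integrable lborel (\<lambda>x. p x * (LBINT y. q y * k x y))"
        and "integrable lborel (\<lambda>y. q y * (LBINT x. p x * k x y))"
    and "integrable lborel (\<lambda>x. p x * k x y0)" and "integrable lborel (\<lambda>y. q y * k x0 y)"
proof -
  have [measurable]: "p \<in> borel_measurable lborel" "q \<in> borel_measurable lborel" using p q by auto
  have B: "0 \<le> B" using b[of 0 0] norm_ge_zero order_trans by blast
  have kx[measurable]: "(\<lambda>y. k x y) \<in> borel_measurable lborel" for x
  proof -
    have "(\<lambda>y. case_prod k (x, y)) \<in> borel_measurable lborel" by (rule measurable_compose[OF _ k]) simp
    then show ?thesis by simp
  qed
  have ky[measurable]: "(\<lambda>x. k x y) \<in> borel_measurable lborel" for y
  proof -
    have "(\<lambda>x. case_prod k (x, y)) \<in> borel_measurable lborel" by (rule measurable_compose[OF _ k]) simp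
    then show ?thesis by simp
  qed
  have qk: "integrable lborel (\<lambda>y. q y * k x y)" for x
  proof (rule Bochner_Integration.integrable_bound[OF integrable_mult_right[OF integrable_norm[OF q], of B]])
    show "AE y in lborel. cmod (q y * k x y) \<le> norm (B * cmod (q y))"
      using b B by (intro AE_I2) (simp add: norm_mult mult.commute[of B] mult_left_mono)
  qed measurable
  have pk: "integrable lborel (\<lambda>x. p x * k x y)" for y
  proof (rule Bochner_Integration.integrable_bound[OF integrable_mult_right[OF integrable_norm[OF p], of B]])
    show "AE x in lborel. cmod (p x * k x y) \<le> norm (B * cmod (p x))"
      using b B by (intro AE_I2) (simp add: norm_mult mult.commute[of B] mult_left_mono)
  qed measurable
  have int: "integrable (lborel \<Otimes>\<^sub>M lborel) (\<lambda>(x, y). p x * q y * k x y)"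
  proof (rule lborel_pair.Fubini_integrable)
    show "(\<lambda>(x, y). p x * q y * k x y) \<in> borel_measurable (lborel \<Otimes>\<^sub>M lborel)" using k by measurable
    have "AE x in lborel. integrable lborel (\<lambda>y. p x * (q y * k x y))" using qk by simp
    then show "AE x in lborel. integrable lborel (\<lambda>y. case (x, y) of (x, y) \<Rightarrow> p x * q y * k x y)"
        by (simp add: mult.assoc)
    have m: "(\<lambda>x. LBINT y. cmod (p x * q y * k x y)) \<in> borel_measurable lborel" using k by measurable
    have "(LBINT y. cmod (p x * q y * k x y)) \<le> cmod (p x) * (B * (LBINT y. cmod (q y)))" for x
    proof -
      have "(LBINT y. cmod (p x * q y * k x y)) = (LBINT y. cmod (p x) * cmod (q y * k x y))"
        by (simp add: norm_mult mult.assoc)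
      also have "\<dots> = cmod (p x) * (LBINT y. cmod (q y * k x y))" by simp
      also have "(LBINT y. cmod (q y * k x y)) \<le> (LBINT y. B * cmod (q y))"
      proof (rule integral_mono)
        show "integrable lborel (\<lambda>y. cmod (q y * k x y))" by (rule integrable_norm[OF qk])
        show "integrable lborel (\<lambda>y. B * cmod (q y))" by (rule integrable_mult_right[OF integrable_norm[OF q]])
        show "cmod (q y * k x y) \<le> B * cmod (q y)" for y
          using b by (simp add: norm_mult mult.commute[of B] mult_left_mono)
      qed
      finally show ?thesis by (simp add: mult_left_mono)
    qed
    then show "integrable lborel (\<lambda>x. LBINT y. cmod (case (x, y) of (x, y) \<Rightarrow> p x * q y * k x y))"
      by (intro Bochner_Integration.integrable_bound[OF integrable_mult_left[OF integrable_norm[OF p], of "B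
        * (LBINT y. cmod (q y))"]])
        (use m B in \<open>auto intro!: AE_I2\<close>)
  qed
  have e1: "(LBINT y. p x * q y * k x y) = p x * (LBINT y. q y * k x y)" for x by (simp add: mult.assoc)
  have e2: "(LBINT x. p x * q y * k x y) = q y * (LBINT x. p x * k x y)" for y
    by (simp add: ac_simps flip: integral_mult_right_zero)
  show "(LBINT x. p x * (LBINT y. q y * k x y)) = (LBINT y. q y * (LBINT x. p x * k x y))"
    using lborel_pair.Fubini_integral[OF int] by (simp add: e1 e2)
  show "integrable lborel (\<lambda>x. p x * (LBINT y. q y * k x y))"
    using lborel_pair.integrable_fst[OF int] by (simp add: e1)
  show "integrable lborel (\<lambda>y. q y * (LBINT x. p x * k x y))"
    using lborel_pair.integrable_snd[OF int] by (simp add: e2)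
  show "integrable lborel (\<lambda>x. p x * k x y0)" "integrable lborel (\<lambda>y. q y * k x0 y)" by (fact pk, fact qk)
qed

text \<open>The scalar core of multiplicativity: the inner contour integral is evaluated by Cauchy's formula
  after interchanging the order of integration.\<close>

lemma Jl_Jl_kernel:
  assumes f: "f holomorphic_on strip (- \<mu>) \<mu>" and df: "decay (strip (- \<mu>) \<mu>) f"
    and th: "0 < \<theta>'" "\<theta>' < \<theta>" "\<theta> < \<mu>" "\<mu> \<le> pi / 2"
    and h: "\<And>y. y = \<theta>' \<or> y = - \<theta>' \<Longrightarrow> integrable lborel (\<lambda>x. h (Complex x y))"
  shows "Jl \<theta> (\<lambda>z. f z * Jl \<theta>' (\<lambda>w. h w * (exp z / (exp z - exp w)))) = Jl \<theta>' (\<lambda>w. f w * h w)"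
proof -
  let ?c = "2 * pi * \<i>" and ?k = "\<lambda>y y' x x'. exp (Complex x y) / (exp (Complex x y) - exp (Complex x' y'))"
  have fi: "integrable lborel (\<lambda>x. f (Complex x y))" if "y = \<theta> \<or> y = - \<theta>" for y
    by (rule decay_integrable[OF holomorphic_on_imp_continuous_on[OF f] df])
      (use that th in \<open>auto simp: strip_def\<close>)
  \<comment> \<open>Lines of the inner and the outer contour never meet, and their heights differ by
    less than pi; hence the kernel is bounded and Fubini applies to all four pairs of lines.\<close>
  have sn: "sin (y' - y) \<noteq> 0" if "y = \<theta> \<or> y = - \<theta>" "y' = \<theta>' \<or> y' = - \<theta>'" for y y'
  proof -
    have "0 < \<bar>y' - y\<bar>" "\<bar>y' - y\<bar> < pi" using that th by auto
    then have "0 < sin \<bar>y' - y\<bar>" by (rule sin_gt_zero)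
    then show ?thesis using sin_minus[of "y' - y"] by (auto simp: abs_if split: if_splits)
  qed
  have kb: "cmod (?k y y' x x') \<le> 1 / \<bar>sin (y' - y)\<bar>" if "y = \<theta> \<or> y = - \<theta>" "y' = \<theta>' \<or> y' = - \<theta>'" for y y' x x'
    unfolding exp_kernel_eq using exp_kernel_bound[of "Complex x' y' - Complex x y"] sn[OF that] by simp
  have km: "case_prod (?k y y') \<in> borel_measurable (lborel \<Otimes>\<^sub>M lborel)" for y y'
  proof -
    have [measurable]: "(\<lambda>x. exp (Complex x y)) \<in> borel_measurable lborel" for y
      using borel_measurable_continuous_onI[OF continuous_on_exp[OF continuous_on_Complex_line]] by simp
    show ?thesis by measurable
  qed
  note Fu = Fubini_kernel[OF fi h km kb]
  let ?A = "\<lambda>y y'. LBINT x. f (Complex x y) * (LBINT x'. h (Complex x' y') * ?k y y' x x')"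
  let ?B = "\<lambda>y y'. LBINT x'. h (Complex x' y') * (LBINT x. f (Complex x y) * ?k y y' x x')"
  have AB: "?A y y' = ?B y y'" if "y = \<theta> \<or> y = - \<theta>" "y' = \<theta>' \<or> y' = - \<theta>'" for y y'
    by (rule Fu(1)) (use that in auto)
  have L: "LI y (\<lambda>z. f z * Jl \<theta>' (\<lambda>w. h w * (exp z / (exp z - exp w)))) = (?A y (- \<theta>') - ?A y \<theta>') / ?c"
      if y: "y = \<theta> \<or> y = - \<theta>" for y
  proof -
    have "LI y (\<lambda>z. f z * Jl \<theta>' (\<lambda>w. h w * (exp z / (exp z - exp w)))) =
      (LBINT x. (f (Complex x y) * (LBINT x'. h (Complex x' (- \<theta>')) * ?k y (- \<theta>') x x') - f (Complex x y) *
          (LBINT x'. h (Complex x' \<theta>') * ?k y \<theta>' x x')) / ?c)"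
      unfolding LI_def Jl_def by (simp add: right_diff_distrib)
    also have "\<dots> = (?A y (- \<theta>') - ?A y \<theta>') / ?c"
      unfolding Bochner_Integration.integral_divide_zero
      by (subst Bochner_Integration.integral_diff) (use Fu(2) y in auto)
    finally show ?thesis .
  qed
  have R: "LI y' (\<lambda>w. h w * Jl \<theta> (\<lambda>z. f z * (exp z / (exp z - exp w)))) = (?B (- \<theta>) y' - ?B \<theta> y') / ?c"
      if y: "y' = \<theta>' \<or> y' = - \<theta>'" for y'
  proof -
    have "LI y' (\<lambda>w. h w * Jl \<theta> (\<lambda>z. f z * (exp z / (exp z - exp w)))) =
      (LBINT x'. (h (Complex x' y') * (LBINT x. f (Complex x (- \<theta>)) * ?k (- \<theta>) y' x x') - h (Complex x' y') *
          (LBINT x. f (Complex x \<theta>) * ?k \<theta> y' x x')) / ?c)"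
      unfolding LI_def Jl_def by (simp add: right_diff_distrib)
    also have "\<dots> = (?B (- \<theta>) y' - ?B \<theta> y') / ?c"
      unfolding Bochner_Integration.integral_divide_zero
      by (subst Bochner_Integration.integral_diff) (use Fu(3) y in auto)
    finally show ?thesis .
  qed
  have "Jl \<theta> (\<lambda>z. f z * Jl \<theta>' (\<lambda>w. h w * (exp z / (exp z - exp w))))
      = Jl \<theta>' (\<lambda>w. h w * Jl \<theta> (\<lambda>z. f z * (exp z / (exp z - exp w))))"
    (is "Jl \<theta> ?P = Jl \<theta>' ?Q")
  proof -
    have "Jl \<theta> ?P = ((?A (- \<theta>) (- \<theta>') - ?A (- \<theta>) \<theta>') / ?c - (?A \<theta> (- \<theta>') - ?A \<theta> \<theta>') / ?c) / ?c"
      by (simp only: Jl_def[of \<theta> ?P] L[OF disjI1[OF refl]] L[OF disjI2[OF refl]])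
    moreover have "Jl \<theta>' ?Q = ((?B (- \<theta>) (- \<theta>') - ?B \<theta> (- \<theta>')) / ?c - (?B (- \<theta>) \<theta>' - ?B \<theta> \<theta>') / ?c) / ?c"
      by (simp only: Jl_def[of \<theta>' ?Q] R[OF disjI1[OF refl]] R[OF disjI2[OF refl]])
    moreover have "?A (- \<theta>) (- \<theta>') = ?B (- \<theta>) (- \<theta>')" "?A (- \<theta>) \<theta>' = ?B (- \<theta>) \<theta>'"
      "?A \<theta> (- \<theta>') = ?B \<theta> (- \<theta>')" "?A \<theta> \<theta>' = ?B \<theta> \<theta>'" by (rule AB; simp)+
    ultimately show ?thesis by (simp only:) (simp only: diff_divide_distrib algebra_simps)
  qed
  also have "\<dots> = Jl \<theta>' (\<lambda>w. f w * h w)"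
  proof -
    have "LI y (\<lambda>w. h w * Jl \<theta> (\<lambda>z. f z * (exp z / (exp z - exp w)))) = LI y (\<lambda>w. f w * h w)"
        if "y = \<theta>' \<or> y = - \<theta>'" for y
      by (rule LI_cong) (subst Jl_cauchy[OF f df], use that th in auto)
    then show ?thesis by (simp add: Jl_def)
  qed
  finally show ?thesis .
qed

lemma lborel_translate:
  fixes q :: "real \<Rightarrow> 'a::{banach,second_countable_topology}"
  shows "(LBINT x. q (x + t)) = (LBINT x. q x)" "integrable lborel q \<Longrightarrow> integrable lborel (\<lambda>x. q (x + t))"
  using lborel_integral_real_affine[of 1 q t] lborel_integrable_real_affine[of q 1 t]
      by (simp_all add: add.commute)

lemma integral_correlation:
  fixes p q :: "real \<Rightarrow> complex"
  assumes p: "integrable lborel p" and q: "integrable lborel q"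
  shows "(LBINT t. LBINT x. p x * q (x + t)) = (LBINT x. p x) * (LBINT x. q x)"
    and "integrable lborel (\<lambda>t. LBINT x. p x * q (x + t))"
proof -
  have [measurable]: "p \<in> borel_measurable borel" "q \<in> borel_measurable borel" using p q by auto
  have q': "(LBINT t. q (x + t)) = (LBINT t. q t)" "(LBINT t. cmod (q (x + t))) = (LBINT t. cmod (q t))"
    "integrable lborel (\<lambda>t. q (x + t))" for x
    using lborel_translate(1)[of q x] lborel_translate(1)[of "\<lambda>x. cmod (q x)" x] lborel_translate(2)[OF q, of x]
    by (simp_all add: add.commute)
  have int: "integrable (lborel \<Otimes>\<^sub>M lborel) (\<lambda>(x, t). p x * q (x + t))"
  proof (rule lborel_pair.Fubini_integrable)
    show "(\<lambda>(x, t). p x * q (x + t)) \<in> borel_measurable (lborel \<Otimes>\<^sub>M lborel)" by measurable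
    show "AE x in lborel. integrable lborel (\<lambda>y. case (x, y) of (x, t) \<Rightarrow> p x * q (x + t))" using q'(3) by simp
    have "(LBINT t. cmod (p x * q (x + t))) = cmod (p x) * (LBINT t. cmod (q t))" for x
      by (simp add: norm_mult q'(2))
    then show "integrable lborel (\<lambda>x. LBINT y. cmod (case (x, y) of (x, t) \<Rightarrow> p x * q (x + t)))"
      using p by simp
  qed
  show "(LBINT t. LBINT x. p x * q (x + t)) = (LBINT x. p x) * (LBINT x. q x)"
    using lborel_pair.Fubini_integral[OF int] by (simp add: q'(1))
  show "integrable lborel (\<lambda>t. LBINT x. p x * q (x + t))"
    using lborel_pair.integrable_snd[OF int] by simp
qed

text \<open>For \<open>z\<close> on one of the lines the integral of
  \<open>H (z + of_real t)\<close> over \<open>t\<close> is the integral of \<open>H\<close> along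
  that line, and a contour shift moves it to the real axis. The same constant therefore factors out
  on both lines. This is the reproducing formula in logarithmic form.\<close>

lemma Jl_correlation:
  assumes h: "\<And>y. y = \<theta> \<or> y = - \<theta> \<Longrightarrow> integrable lborel (\<lambda>x. h (Complex x y))"
    and H: "H holomorphic_on strip (- \<mu>) \<mu>" "decay (strip (- \<mu>) \<mu>) H" and th: "0 < \<theta>" "\<theta> < \<mu>"
  shows "(LBINT t. Jl \<theta> (\<lambda>z. h z * H (z + of_real t))) = LI 0 H * Jl \<theta> h"
    and "integrable lborel (\<lambda>t. Jl \<theta> (\<lambda>z. h z * H (z + of_real t)))"
proof -
  have Hi: "integrable lborel (\<lambda>x. H (Complex x y))" if "y = \<theta> \<or> y = - \<theta>" for y
    by (rule decay_integrable[OF holomorphic_on_imp_continuous_on[OF H(1)] H(2)])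
      (use that th in \<open>auto simp: strip_def\<close>)
  have HL: "(LBINT x. H (Complex x y)) = LI 0 H" if "y = \<theta> \<or> y = - \<theta>" for y
    using decay_shift[OF H, of y 0] that th by (auto simp: LI_def)
  have eq: "LI y (\<lambda>z. h z * H (z + of_real t)) = (LBINT x. h (Complex x y) * H (Complex (x + t) y))" for y t
  proof -
    have "Complex x y + of_real t = Complex (x + t) y" for x by (simp add: complex_eq_iff)
    then show ?thesis by (simp add: LI_def)
  qed
  note C = integral_correlation[OF h Hi]
  have I: "integrable lborel (\<lambda>t. LI y (\<lambda>z. h z * H (z + of_real t)))"
    "(LBINT t. LI y (\<lambda>z. h z * H (z + of_real t))) = LI y h * LI 0 H" if "y = \<theta> \<or> y = - \<theta>" for y
    unfolding eq using C(2)[OF that that] C(1)[OF that that] HL[OF that] by (simp_all add: LI_def)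
  show "integrable lborel (\<lambda>t. Jl \<theta> (\<lambda>z. h z * H (z + of_real t)))"
    unfolding Jl_def by (intro integrable_divide Bochner_Integration.integrable_diff I) auto
  have "(LBINT t. Jl \<theta> (\<lambda>z. h z * H (z + of_real t))) = (LI (- \<theta>) h * LI 0 H - LI \<theta> h * LI 0 H) / (2 * pi * \<i>)"
    unfolding Jl_def Bochner_Integration.integral_divide_zero
    by (subst Bochner_Integration.integral_diff) (use I in auto)
  then show "(LBINT t. Jl \<theta> (\<lambda>z. h z * H (z + of_real t))) = LI 0 H * Jl \<theta> h"
    by (simp add: Jl_def algebra_simps)
qed

lemma translation_L1_continuous:
  fixes q :: "real \<Rightarrow> complex"
  assumes q: "continuous_on UNIV q" and a: "a > 0" and b: "\<And>x. cmod (q x) \<le> c * exp (- a * \<bar>x\<bar>)"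
  shows "((\<lambda>t. LBINT x. cmod (q (x + t) - q (x + t0))) \<longlongrightarrow> 0) (at t0)"
  unfolding tendsto_at_iff_sequentially comp_def
proof (intro allI impI)
  fix X :: "nat \<Rightarrow> real" assume X: "X \<longlonglongrightarrow> t0"
  have c: "0 \<le> c" using b[of 0] by
      (metis abs_zero exp_zero mult.right_neutral mult_zero_right norm_ge_zero order_trans)
  obtain n0 where n0: "\<And>n. n \<ge> n0 \<Longrightarrow> \<bar>X n - t0\<bar> < 1"
    using X unfolding LIMSEQ_iff by (metis real_norm_def zero_less_one)
  have qm[measurable]: "q \<in> borel_measurable borel" by (rule borel_measurable_continuous_onI[OF q])
  \<comment> \<open>All translates by less than 1 from \<open>t0\<close> have this common majorant,
    which makes dominated convergence available.\<close>
  have dom: "cmod (q (x + t)) \<le> c * exp (a * (\<bar>t0\<bar> + 1)) * exp (- a * \<bar>x\<bar>)" if "\<bar>t - t0\<bar> < 1" for x t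
  proof -
    have "- a * \<bar>x + t\<bar> \<le> a * (\<bar>t0\<bar> + 1) + - a * \<bar>x\<bar>"
    proof -
      have "\<bar>x\<bar> - (\<bar>t0\<bar> + 1) \<le> \<bar>x + t\<bar>" using that by linarith
      then have "a * (\<bar>x\<bar> - (\<bar>t0\<bar> + 1)) \<le> a * \<bar>x + t\<bar>" using a by (simp add: mult_left_mono)
      then show ?thesis by (simp add: algebra_simps)
    qed
    then have "exp (- a * \<bar>x + t\<bar>) \<le> exp (a * (\<bar>t0\<bar> + 1)) * exp (- a * \<bar>x\<bar>)" by (simp flip: exp_add)
    then have "c * exp (- a * \<bar>x + t\<bar>) \<le> c * (exp (a * (\<bar>t0\<bar> + 1)) * exp (- a * \<bar>x\<bar>))" using c
        by (rule mult_left_mono)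
    then show ?thesis using b[of "x + t"] by (simp add: mult.assoc)
  qed
  have "(\<lambda>n. LBINT x. cmod (q (x + X (n + n0)) - q (x + t0))) \<longlonglongrightarrow> (LBINT x::real. 0::real)"
  proof (rule integral_dominated_convergence[where w="\<lambda>x. 2 * (c * exp (a * (\<bar>t0\<bar> + 1)) * exp (- a * \<bar>x\<bar>))"])
    show "integrable lborel (\<lambda>x. 2 * (c * exp (a * (\<bar>t0\<bar> + 1)) * exp (- a * \<bar>x\<bar>)))"
      by (intro integrable_mult_right integrable_exp_decay[OF a])
    show "AE x in lborel. (\<lambda>n. cmod (q (x + X (n + n0)) - q (x + t0))) \<longlonglongrightarrow> 0"
    proof (intro AE_I2)
      fix x
      have "(\<lambda>n. q (x + X (n + n0))) \<longlonglongrightarrow> q (x + t0)"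
        by (rule continuous_on_tendsto_compose[OF q]) (auto intro!: tendsto_intros LIMSEQ_ignore_initial_segment X)
      then show "(\<lambda>n. cmod (q (x + X (n + n0)) - q (x + t0))) \<longlonglongrightarrow> 0"
        using tendsto_norm_zero[OF LIM_zero] by blast
    qed
    show "AE x in lborel. norm (cmod (q (x + X (n + n0)) - q (x + t0))) \<le> 2
        * (c * exp (a * (\<bar>t0\<bar> + 1)) * exp (- a * \<bar>x\<bar>))" for n
    proof (intro AE_I2)
      fix x
      have "cmod (q (x + X (n + n0)) - q (x + t0)) \<le> cmod (q (x + X (n + n0))) + cmod (q (x + t0))"
          by (rule norm_triangle_ineq4)
      then show "norm (cmod (q (x + X (n + n0)) - q (x + t0))) \<le> 2 * (c * exp (a * (\<bar>t0\<bar> + 1)) * exp (- a * \<bar>x\<bar>))"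
        using dom[of "X (n + n0)" x] dom[of t0 x] n0[of "n + n0"] by simp
    qed
  qed auto
  then show "(\<lambda>n. LBINT x. cmod (q (x + X n) - q (x + t0))) \<longlonglongrightarrow> 0"
    by (simp add: LIMSEQ_offset[of _ n0])
qed

section \<open>Integrals over the half line\<close>

text \<open>The Banach space lemmas of the library need the class \<^class>\<open>banach\<close>, which is not implied by the
  sort of the theorem although it has no further axioms. A copy of the type is of class \<^class>\<open>banach\<close>.\<close>

typedef (overloaded) 'a bcopy = "UNIV :: 'a::{real_normed_vector,complete_space} set"
  morphisms of_bcopy to_bcopy ..

lemma of_to_bcopy [simp]: "of_bcopy (to_bcopy x) = x" by (simp add: to_bcopy_inverse)

instantiation bcopy :: ("{real_normed_vector,complete_space}") real_vector
begin
definition zero_bcopy :: "'a bcopy" where "zero_bcopy = to_bcopy 0"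
definition plus_bcopy :: "'a bcopy \<Rightarrow> 'a bcopy \<Rightarrow> 'a bcopy" where
    "plus_bcopy x y = to_bcopy (of_bcopy x + of_bcopy y)"
definition minus_bcopy :: "'a bcopy \<Rightarrow> 'a bcopy \<Rightarrow> 'a bcopy" where
    "minus_bcopy x y = to_bcopy (of_bcopy x - of_bcopy y)"
definition uminus_bcopy :: "'a bcopy \<Rightarrow> 'a bcopy" where "uminus_bcopy x = to_bcopy (- of_bcopy x)"
definition scaleR_bcopy :: "real \<Rightarrow> 'a bcopy \<Rightarrow> 'a bcopy" where "scaleR_bcopy r x = to_bcopy (r *\<^sub>R of_bcopy x)"
instance
  by standard (simp_all add: zero_bcopy_def plus_bcopy_def minus_bcopy_def uminus_bcopy_def scaleR_bcopy_def
      of_bcopy_inverse algebra_simps)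
end

instantiation bcopy :: ("{real_normed_vector,complete_space}") real_normed_vector
begin
definition norm_bcopy :: "'a bcopy \<Rightarrow> real" where "norm_bcopy x = norm (of_bcopy x)"
definition sgn_bcopy :: "'a bcopy \<Rightarrow> 'a bcopy" where "sgn_bcopy x = x /\<^sub>R norm x"
definition dist_bcopy :: "'a bcopy \<Rightarrow> 'a bcopy \<Rightarrow> real" where "dist_bcopy x y = norm (x - y)"
definition uniformity_bcopy :: "('a bcopy \<times> 'a bcopy) filter" where
  "uniformity_bcopy = (INF e\<in>{0 <..}. principal {(x, y). dist x y < e})"
definition open_bcopy :: "'a bcopy set \<Rightarrow> bool" where
  "open_bcopy U \<longleftrightarrow> (\<forall>x\<in>U. eventually (\<lambda>(x', y). x' = x \<longrightarrow> y \<in> U) uniformity)"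
instance
proof
  fix x y :: "'a bcopy" and a :: real
  show "(norm x = 0) = (x = 0)" by (simp add: norm_bcopy_def zero_bcopy_def of_bcopy_inject[symmetric])
qed (simp_all add: norm_bcopy_def sgn_bcopy_def dist_bcopy_def uniformity_bcopy_def open_bcopy_def
      plus_bcopy_def scaleR_bcopy_def norm_triangle_ineq)
end

lemma of_bcopy_simps: "of_bcopy 0 = 0" "of_bcopy (x + y) = of_bcopy x + of_bcopy y"
    "of_bcopy (x - y) = of_bcopy x - of_bcopy y"
  "of_bcopy (r *\<^sub>R x) = r *\<^sub>R of_bcopy x"
  by (simp_all add: zero_bcopy_def plus_bcopy_def minus_bcopy_def scaleR_bcopy_def)

lemma bounded_linear_of_bcopy: "bounded_linear of_bcopy"
  by (rule bounded_linear_intro[where K=1]) (simp_all add: of_bcopy_simps norm_bcopy_def)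

lemma bounded_linear_to_bcopy: "bounded_linear to_bcopy"
  by (rule bounded_linear_intro[where K=1]) (simp_all add: plus_bcopy_def scaleR_bcopy_def norm_bcopy_def)

instance bcopy :: ("{real_normed_vector,complete_space}") banach
proof
  fix X :: "nat \<Rightarrow> 'a bcopy" assume X: "Cauchy X"
  have "Cauchy (\<lambda>n. of_bcopy (X n))" by (rule bounded_linear.Cauchy[OF bounded_linear_of_bcopy X])
  then obtain l where "(\<lambda>n. of_bcopy (X n)) \<longlonglongrightarrow> l" by (auto simp: Cauchy_convergent_iff convergent_def)
  from bounded_linear.tendsto[OF bounded_linear_to_bcopy this] show "convergent X"
    by (auto simp: convergent_def of_bcopy_inverse)
qed

text \<open>Uniform convergence relative to an integrable weight \<open>g\<close> is enough for
  gauge integrability: the integrals of \<open>h n\<close> form a Cauchy sequence, and the Riemann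
  sums of \<open>f\<close> and \<open>h n\<close> differ by at most \<open>e n\<close> times a
  Riemann sum of \<open>g\<close>. This admits integrands that are unbounded near an
  endpoint.\<close>

lemma integrable_weighted_limit:
  fixes f :: "real \<Rightarrow> 'b::banach" and g :: "real \<Rightarrow> real"
  assumes g: "g integrable_on cbox a b" and h: "\<And>n. h n integrable_on cbox a b" and e: "e \<longlonglongrightarrow> 0"
    and fh: "\<And>n x. x \<in> cbox a b \<Longrightarrow> norm (f x - h n x) \<le> e n * g x"
  shows "f integrable_on cbox a b"
proof -
  define I where "I n = integral (cbox a b) (h n)" for n :: nat
  define G where "G = integral (cbox a b) g"
  have I: "(h n has_integral I n) (cbox a b)" for n using h by (simp add: I_def integrable_integral)
  have G: "(g has_integral G) (cbox a b)" using g by (simp add: G_def integrable_integral)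
  have diff: "norm (I m - I n) \<le> \<bar>e m + e n\<bar> * \<bar>G\<bar>" for m n
  proof -
    have "norm (I m - I n) \<le> (e m + e n) * G"
      unfolding I_def G_def integral_diff[OF h h, symmetric] integral_mult_right[symmetric]
    proof (rule integral_norm_bound_integral)
      show "(\<lambda>x. h m x - h n x) integrable_on cbox a b" by (intro integrable_diff h)
      show "(\<lambda>x. (e m + e n) * g x) integrable_on cbox a b" using g by (rule integrable_on_mult_right)
      fix x assume x: "x \<in> cbox a b"
      have "norm (h m x - h n x) = norm ((f x - h n x) - (f x - h m x))" by simp
      also have "\<dots> \<le> norm (f x - h n x) + norm (f x - h m x)" by (rule norm_triangle_ineq4)
      finally show "norm (h m x - h n x) \<le> (e m + e n) * g x" using fh[OF x, of m] fh[OF x, of n]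
          by (simp add: algebra_simps)
    qed
    also have "\<dots> \<le> \<bar>e m + e n\<bar> * \<bar>G\<bar>" by (metis abs_ge_self abs_mult)
    finally show ?thesis .
  qed
  have "Cauchy I"
  proof (rule CauchyI)
    fix d :: real assume d: "d > 0"
    have "eventually (\<lambda>n. \<bar>e n\<bar> < d / (2 * (\<bar>G\<bar> + 1))) sequentially"
      using e d order_tendstoD(2)[OF tendsto_rabs_zero[OF e]] by (simp add: add_nonneg_pos)
    then obtain M where M: "\<And>n. n \<ge> M \<Longrightarrow> \<bar>e n\<bar> < d / (2 * (\<bar>G\<bar> + 1))" by (auto simp: eventually_sequentially)
    show "\<exists>M. \<forall>m\<ge>M. \<forall>n\<ge>M. norm (I m - I n) < d"
    proof (intro exI allI impI)
      fix m n assume "M \<le> m" "M \<le> n"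
      then have "\<bar>e m + e n\<bar> < d / (\<bar>G\<bar> + 1)" 
      proof -
        have "\<bar>e m + e n\<bar> \<le> \<bar>e m\<bar> + \<bar>e n\<bar>" by (rule abs_triangle_ineq)
        also have "\<dots> < d / (2 * (\<bar>G\<bar> + 1)) + d / (2 * (\<bar>G\<bar> + 1))" using M[OF \<open>M \<le> m\<close>] M[OF \<open>M \<le> n\<close>]
            by (rule add_strict_mono)
        also have "\<dots> = d / (\<bar>G\<bar> + 1)"
        proof -
          have "d / (2 * x) + d / (2 * x) = d / x" for x :: real by (cases "x = 0") (auto simp: field_simps)
          then show ?thesis .
        qed
        finally show ?thesis .
      qed
      then have "\<bar>e m + e n\<bar> * (\<bar>G\<bar> + 1) < d" by (simp add: field_simps)
      moreover have "\<bar>e m + e n\<bar> * \<bar>G\<bar> \<le> \<bar>e m + e n\<bar> * (\<bar>G\<bar> + 1)" by (intro mult_left_mono) auto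
      ultimately show "norm (I m - I n) < d" using diff[of m n] by linarith
    qed
  qed
  then obtain y where y: "I \<longlonglongrightarrow> y" using Cauchy_convergent_iff convergent_def by blast
  have "(f has_integral y) (cbox a b)"
    unfolding has_integral
  proof (intro allI impI)
    fix d :: real assume d: "d > 0"
    have "eventually (\<lambda>n. \<bar>e n\<bar> < d / (3 * (\<bar>G\<bar> + 1))) sequentially"
      using e d order_tendstoD(2)[OF tendsto_rabs_zero[OF e]] by (simp add: add_nonneg_pos)
    moreover have "eventually (\<lambda>n. norm (I n - y) < d / 3) sequentially"
      using tendstoD[OF y, of "d / 3"] d by (simp add: dist_norm)
    ultimately have "eventually (\<lambda>n. \<bar>e n\<bar> < d / (3 * (\<bar>G\<bar> + 1)) \<and> norm (I n - y) < d / 3) sequentially"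
        by eventually_elim simp
    then obtain n where n: "\<bar>e n\<bar> < d / (3 * (\<bar>G\<bar> + 1))" "norm (I n - y) < d / 3"
      by (auto simp: eventually_sequentially)
    obtain \<gamma> where \<gamma>: "gauge \<gamma>" "\<And>D. D tagged_division_of cbox a b \<Longrightarrow> \<gamma> fine D
        \<Longrightarrow> norm ((\<Sum>(x, K)\<in>D. measure lborel K *\<^sub>R h n x) - I n) < d / 3"
      using I[of n] d unfolding has_integral by (metis divide_pos_pos zero_less_numeral)
    \<comment> \<open>Tolerance 1 suffices here: it bounds the Riemann sums of \<open>g\<close> by
      \<open>\<bar>G\<bar> + 1\<close>, and the smallness comes from \<open>e n\<close>.\<close>
    obtain \<delta> where \<delta>: "gauge \<delta>" "\<And>D. D tagged_division_of cbox a b \<Longrightarrow> \<delta> fine D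
        \<Longrightarrow> norm ((\<Sum>(x, K)\<in>D. measure lborel K *\<^sub>R g x) - G) < 1"
      using G unfolding has_integral by (metis zero_less_one)
    show "\<exists>\<gamma>. gauge \<gamma> \<and> (\<forall>D. D tagged_division_of cbox a b \<and> \<gamma> fine D
        \<longrightarrow> norm ((\<Sum>(x, K)\<in>D. measure lborel K *\<^sub>R f x) - y) < d)"
    proof (intro exI conjI allI impI)
      show "gauge (\<lambda>x. \<gamma> x \<inter> \<delta> x)" using \<gamma>(1) \<delta>(1) by (rule gauge_Int)
      fix D assume D: "D tagged_division_of cbox a b \<and> (\<lambda>x. \<gamma> x \<inter> \<delta> x) fine D"
      then have fine: "\<gamma> fine D" "\<delta> fine D" using fine_Int by blast+
      have fin: "finite D" using D by auto
      have "norm ((\<Sum>(x, K)\<in>D. measure lborel K *\<^sub>R f x) - (\<Sum>(x, K)\<in>D. measure lborel K *\<^sub>R h n x))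
          = norm (\<Sum>(x, K)\<in>D. measure lborel K *\<^sub>R (f x - h n x))"
        by (simp add: sum_subtractf[symmetric] case_prod_unfold scaleR_diff_right)
      also have "\<dots> \<le> (\<Sum>(x, K)\<in>D. measure lborel K * (e n * g x))"
        unfolding case_prod_unfold
      proof (rule sum_norm_le)
        fix xK assume xK: "xK \<in> D"
        then have "fst xK \<in> cbox a b" using D tag_in_interval[of D "cbox a b" "fst xK" "snd xK"] by auto
        then show "norm (measure lborel (snd xK) *\<^sub>R (f (fst xK) - h n (fst xK))) \<le> measure lborel (snd xK)
            * (e n * g (fst xK))"
          using fh[of "fst xK" n] by (simp add: mult_left_mono)
      qed
      also have "\<dots> = e n * (\<Sum>(x, K)\<in>D. measure lborel K *\<^sub>R g x)"
        by (simp add: sum_distrib_left case_prod_unfold mult_ac)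
      also have "\<dots> \<le> \<bar>e n\<bar> * (\<bar>G\<bar> + 1)"
      proof -
        have "\<bar>\<Sum>(x, K)\<in>D. measure lborel K *\<^sub>R g x\<bar> \<le> \<bar>G\<bar> + 1" using \<delta>(2)[of D] D fine by auto
        then have "\<bar>e n * (\<Sum>(x, K)\<in>D. measure lborel K *\<^sub>R g x)\<bar> \<le> \<bar>e n\<bar> * (\<bar>G\<bar> + 1)"
          unfolding abs_mult by (intro mult_left_mono) auto
        then show ?thesis by linarith
      qed
      also have "\<dots> < d / 3"
      proof -
        have "\<bar>e n\<bar> * (3 * (\<bar>G\<bar> + 1)) < d" using n(1) by (subst (asm) pos_less_divide_eq) auto
        then show ?thesis by (simp add: algebra_simps)
      qed
      finally have 1: "norm ((\<Sum>(x, K)\<in>D. measure lborel K *\<^sub>R f x) - (\<Sum>(x, K)\<in>D. measure lborel K *\<^sub>R h n x)) < d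
          / 3" .
      have 2: "norm ((\<Sum>(x, K)\<in>D. measure lborel K *\<^sub>R h n x) - I n) < d / 3" using \<gamma>(2)[of D] D fine by auto
      have "norm (A - y) < d" if "norm (A - B) < d / 3" "norm (B - C) < d / 3" "norm (C - y) < d / 3" for A B C
        using that norm_triangle_ineq[of "A - B" "(B - C) + (C - y)"] norm_triangle_ineq[of "B - C" "C - y"]
            by simp
      from this[OF 1 2 n(2)] show "norm ((\<Sum>(x, K)\<in>D. measure lborel K *\<^sub>R f x) - y) < d" .
    qed
  qed
  then show ?thesis by blast
qed

text \<open>The integrand is at most \<open>c * r powr (a - 1)\<close> near 0 and
  \<open>c * r powr (- a - 1)\<close> near infinity. The comparison bound settles the unbounded
  domain once integrability on compact intervals is known, and there the possible singularity at 0
  is handled by cutting it off.\<close>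

lemma integrable_on_log_decay_banach:
  fixes f :: "real \<Rightarrow> 'b::banach"
  assumes f: "continuous_on UNIV f" and a: "a > 0" and b: "\<And>x. norm (f x) \<le> c * exp (- a * \<bar>x\<bar>)"
  shows "(\<lambda>r. (1 / r) *\<^sub>R f (ln r)) integrable_on {0<..}"
proof (rule integrable_on_all_intervals_integrable_bound)
  have c: "0 \<le> c" using b[of 0] by
      (metis abs_zero exp_zero mult.right_neutral mult_zero_right norm_ge_zero order_trans)
  let ?F = "\<lambda>r. (1 / r) *\<^sub>R f (ln r)"
  let ?g = "\<lambda>r. if r \<le> 1 then c * r powr (a - 1) else c * r powr (- a - 1)"
  have e: "exp (- a * \<bar>ln r\<bar>) / r = (if r \<le> 1 then r powr (a - 1) else r powr (- a - 1))" if "r > 0" for r :: real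
    using that by (auto simp: powr_def exp_diff field_simps abs_if)
  have Fb: "norm (?F r) \<le> ?g r" if "r > 0" for r
  proof -
    have "norm (?F r) = norm (f (ln r)) / r" using that by simp
    also have "\<dots> \<le> c * exp (- a * \<bar>ln r\<bar>) / r" using b[of "ln r"] that by (simp add: divide_right_mono)
    also have "\<dots> = c * (exp (- a * \<bar>ln r\<bar>) / r)" by simp
    also have "\<dots> = ?g r" unfolding e[OF that] by simp
    finally show ?thesis .
  qed
  show "norm (?F r) \<le> ?g r" if "r \<in> {0<..}" for r using Fb that by simp
  show "?g integrable_on {0<..}"
  proof -
    have 1: "?g integrable_on {0<..1}"
      by (rule integrable_eq[OF integrable_on_mult_right[OF integrable_on_powr_from_0'[of "a - 1" 1], of c]])
        (use a in auto)
    have "?g integrable_on {1..}"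
    proof (rule integrable_spike[OF integrable_on_mult_right[of "\<lambda>r. r powr (- a - 1)" _ c] negligible_sing[of 1]])
      show "(\<lambda>r. r powr (- a - 1)) integrable_on {1..}" using has_integral_powr_to_inf[of "- a - 1" 1] a
          unfolding integrable_on_def by auto
    qed auto
    then have "?g integrable_on ({0<..1} \<union> {1..})"
      by (intro integrable_Un 1) (auto intro: negligible_subset[OF negligible_sing[of 1]])
    moreover have "{0<..1} \<union> {1..} = {0::real<..}" by auto
    ultimately show ?thesis by simp
  qed
  fix u v :: real
  show "(\<lambda>r. if r \<in> {0<..} then ?F r else 0) integrable_on cbox u v"
  proof (rule integrable_weighted_limit)
    let ?h = "\<lambda>n r. if r \<ge> 1 / real (Suc n) then ?F r else 0"
    \<comment> \<open>The exponent is split in half: one factor \<open>r powr (a / 2)\<close> is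
      small on the removed piece, and the other leaves the still integrable weight
      \<open>r powr (a / 2 - 1)\<close>.\<close>
    let ?w = "\<lambda>r. if r \<in> {0<..1} then c * r powr (a / 2 - 1) else 0"
    have "?w integrable_on UNIV"
      by (subst integrable_restrict_UNIV)
        (intro integrable_on_mult_right integrable_on_powr_from_0', use a in auto)
    then show "?w integrable_on cbox u v" by (rule integrable_on_subcbox) auto
    show "(\<lambda>n. (1 / real (Suc n)) powr (a / 2)) \<longlonglongrightarrow> 0" using a by real_asymp
    show "?h n integrable_on cbox u v" for n
    proof -
      have "?F integrable_on ({1 / real (Suc n)..} \<inter> {u..v})"
      proof -
        have "{1 / real (Suc n)..} \<inter> {u..v} = {max (1 / real (Suc n)) u..v}" by auto
        moreover have "r > 0" if "r \<in> {max (1 / real (Suc n)) u..v}" for r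
        proof -
          have "0 < 1 / real (Suc n)" by simp
          also have "\<dots> \<le> r" using that by simp
          finally show ?thesis .
        qed
        then have "continuous_on {max (1 / real (Suc n)) u..v} ?F"
          by (intro continuous_intros continuous_on_compose2[OF f]) (auto simp: less_imp_neq[symmetric])
        ultimately show ?thesis by (simp add: integrable_continuous_interval)
      qed
      then have "(\<lambda>r. if r \<in> {1 / real (Suc n)..} then ?F r else 0) integrable_on {u..v}"
        by (simp only: integrable_restrict_Int)
      then show ?thesis by (simp add: cbox_interval)
    qed
    fix n and r :: real
    let ?e = "1 / real (Suc n)"
    show "norm ((if r \<in> {0<..} then ?F r else 0) - ?h n r) \<le> ?e powr (a / 2) * ?w r"
    proof (cases "0 < r \<and> r < ?e")
      case True
      moreover have "?e \<le> 1" by simp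
      ultimately have r: "0 < r" "r < ?e" "r \<le> 1" by linarith+
      have "r powr (a - 1) = r powr (a / 2) * r powr (a / 2 - 1)" using r by (simp flip: powr_add)
      also have "\<dots> \<le> ?e powr (a / 2) * r powr (a / 2 - 1)" using r a by (intro mult_right_mono powr_mono2) auto
      finally have "c * r powr (a - 1) \<le> c * (?e powr (a / 2) * r powr (a / 2 - 1))" using c
          by (rule mult_left_mono)
      then show ?thesis using Fb[OF r(1)] r by (simp add: mult_ac)
    next
      case False
      moreover have "0 < ?e" by simp
      ultimately have "0 < r \<longleftrightarrow> ?e \<le> r" by linarith
      then have "norm ((if r \<in> {0<..} then ?F r else 0) - ?h n r) = 0" by (simp del: of_nat_Suc)
      moreover have "0 \<le> ?e powr (a / 2) * ?w r" using c by simp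
      ultimately show ?thesis by linarith
    qed
  qed
qed

lemma integrable_on_log_decay:
  fixes f :: "real \<Rightarrow> 'h::{real_normed_vector,complete_space}"
  assumes f: "continuous_on UNIV f" and a: "a > 0" and b: "\<And>x. norm (f x) \<le> c * exp (- a * \<bar>x\<bar>)"
  shows "(\<lambda>r. (1 / r) *\<^sub>R f (ln r)) integrable_on {0<..}"
proof -
  have "(\<lambda>r. (1 / r) *\<^sub>R to_bcopy (f (ln r))) integrable_on {0<..}"
  proof (rule integrable_on_log_decay_banach[OF _ a])
    show "continuous_on UNIV (\<lambda>x. to_bcopy (f x))"
        by (rule bounded_linear.continuous_on[OF bounded_linear_to_bcopy f])
    show "norm (to_bcopy (f x)) \<le> c * exp (- a * \<bar>x\<bar>)" for x using b by (simp add: norm_bcopy_def)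
  qed
  from integrable_linear[OF this bounded_linear_of_bcopy] show ?thesis
    by (simp add: o_def of_bcopy_simps)
qed

lemma integral_log_substitution:
  fixes f :: "real \<Rightarrow> complex"
  assumes f: "integrable lborel f"
  shows "integral {0<..} (\<lambda>r. (1 / r) *\<^sub>R f (ln r)) = (LBINT x. f x)"
proof -
  have "set_integrable lborel UNIV f" using f by (simp add: set_integrable_def)
  then have 1: "f absolutely_integrable_on UNIV" "integral UNIV f = (LBINT x. f x)"
    using set_borel_integral_eq_integral(2)[of UNIV f]
    by (auto simp: set_lebesgue_integral_def set_integrable_def integrable_completion)
  have s: "range exp = {0::real<..}" by (auto simp: image_iff intro: exp_ln[symmetric])
  let ?F = "\<lambda>r. (1 / r) *\<^sub>R f (ln r)"
  have "?F absolutely_integrable_on (range exp) \<and> integral (range exp) ?F = (LBINT x. f x)"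
  proof (rule has_absolute_integral_change_of_variables_real[THEN iffD1])
    show "(exp has_field_derivative exp x) (at x within UNIV)" for x :: real by (auto intro!: derivative_eq_intros)
    show "(\<lambda>x. \<bar>exp x\<bar> *\<^sub>R ?F (exp x)) absolutely_integrable_on UNIV \<and> integral UNIV (\<lambda>x. \<bar>exp x\<bar> *\<^sub>R ?F (exp x))
        = (LBINT x. f x)"
      using 1 by simp
  qed (auto simp: inj_on_def)
  then show ?thesis by (simp add: s)
qed

section \<open>The resolvent of an operator of type \<open>\<omega>\<close>\<close>

lemma Lq_cnj: "Lq T (Defs.cnj s) = Lq T s"
  by (simp add: fun_eq_iff Lq_def)

lemma Qs_cnj: "Qs rm D T (Defs.cnj s) = Qs rm D T s"
  by (simp add: Qs_def is_Qinv_def Lq_cnj)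

text \<open>The bound \<open>\<mu> < pi / 2\<close> comes from \<open>regularizable_angle\<close>.
  It keeps the contours of the calculus strictly inside the lines at height pi/2 in absolute value,
  which \<open>exp\<close> maps to the rays through the units i and -i.\<close>

locale sect_op = qhilb rm ip N for rm :: "'h::{real_normed_vector,complete_space} \<Rightarrow> quat \<Rightarrow> 'h" and ip N +
  fixes D :: "'h set" and T :: "'h \<Rightarrow> 'h" and \<omega> \<mu> :: real
  assumes angles: "0 \<le> \<omega>" "\<omega> < \<mu>" "\<mu> < pi / 2"
    and rlin: "rlin rm D T"
    and spec: "sigmaS rm D T \<subseteq> qsector \<omega>"
    and SL: "\<And>\<theta>. \<omega> < \<theta> \<Longrightarrow> \<theta> \<le> pi \<Longrightarrow> \<exists>C>0. \<forall>s. s \<noteq> 0 \<and> s \<notin> qsector \<theta> \<longrightarrow>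
        (\<forall>u. norm (SLinv rm ip N D T s u) \<le> C / norm s * norm u)"
begin

lemma D0: "0 \<in> D" and D_lin: "x \<in> D \<Longrightarrow> y \<in> D \<Longrightarrow> rm x a + rm y b \<in> D"
  and T_lin: "x \<in> D \<Longrightarrow> y \<in> D \<Longrightarrow> T (rm x a + rm y b) = rm (T x) a + rm (T y) b"
  using rlin unfolding rlin_def by auto

lemma D_rm: "x \<in> D \<Longrightarrow> rm x a \<in> D" and T_rm: "x \<in> D \<Longrightarrow> T (rm x a) = rm (T x) a"
  using D_lin[of x 0 a 0] T_lin[of x 0 a 0] D0 by auto
lemma D_add: "x \<in> D \<Longrightarrow> y \<in> D \<Longrightarrow> x + y \<in> D" and T_add: "x \<in> D \<Longrightarrow> y \<in> D \<Longrightarrow> T (x + y) = T x + T y"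
  using D_lin[of x y 1 1] T_lin[of x y 1 1] by auto
lemma D_diff: "x \<in> D \<Longrightarrow> y \<in> D \<Longrightarrow> x - y \<in> D" and T_diff: "x \<in> D \<Longrightarrow> y \<in> D \<Longrightarrow> T (x - y) = T x - T y"
  using D_lin[of x y 1 "-1"] T_lin[of x y 1 "-1"] by (auto simp: rm_minus_right)
lemma D_sc: "x \<in> D \<Longrightarrow> csc c x \<in> D" and T_sc: "x \<in> D \<Longrightarrow> T (csc c x) = csc c (T x)"
  by (simp_all add: sc_def D_rm T_rm)
lemma D_scaleR: "x \<in> D \<Longrightarrow> r *\<^sub>R x \<in> D" and T_scaleR: "x \<in> D \<Longrightarrow> T (r *\<^sub>R x) = r *\<^sub>R T x"
  using D_rm[of x "of_real r"] T_rm[of x "of_real r"] by (simp_all add: rm_of_real)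

text \<open>For the complex structure \<open>csc\<close> the operator \<open>R z\<close> is the resolvent \<open>(z - T)\<^sup>-\<^sup>1\<close>; the
  factor \<open>exp \<zeta>\<close> in \<open>K\<close> comes from \<open>ds = exp \<zeta> d\<zeta>\<close>.\<close>

definition Q :: "complex \<Rightarrow> 'h \<Rightarrow> 'h" where "Q z = Qs rm D T (emb z)"
definition R :: "complex \<Rightarrow> 'h \<Rightarrow> 'h" where "R z u = csc (cnj z) (Q z u) - T (Q z u)"
definition K :: "complex \<Rightarrow> 'h \<Rightarrow> 'h" where "K \<zeta> u = csc (exp \<zeta>) (R (exp \<zeta>) u)"

lemma is_Qinv_Qs: assumes "s \<notin> qsector \<omega>" shows "is_Qinv rm D T s (Qs rm D T s)"
proof -
  from assms spec obtain Q' where Q': "is_Qinv rm D T s Q'" by (auto simp: sigmaS_def rhoS_def)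
  have "Q'' = Q'" if "is_Qinv rm D T s Q''" for Q''
  proof
    fix y
    have "Q' y \<in> dom2 D T" "Lq T s (Q' y) = y" using Q' unfolding is_Qinv_def by auto
    then show "Q'' y = Q' y" using that unfolding is_Qinv_def by metis
  qed
  with Q' show ?thesis unfolding Qs_def by (metis theI)
qed

lemma Q_cnj: "Q (cnj z) = Q z" by (simp add: Q_def emb_cnj Qs_cnj)

context
  fixes z assumes z: "emb z \<notin> qsector \<omega>"
begin

lemma Q_D: "Q z u \<in> D" "T (Q z u) \<in> D"
  and Q_right: "T (T (Q z u)) - (2 * Re z) *\<^sub>R T (Q z u) + (cmod z)\<^sup>2 *\<^sub>R Q z u = u"
  and Q_left: "x \<in> D \<Longrightarrow> T x \<in> D \<Longrightarrow> Q z (T (T x) - (2 * Re z) *\<^sub>R T x + (cmod z)\<^sup>2 *\<^sub>R x) = x"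
  and Q_rm: "Q z (rm x a) = rm (Q z x) a" and Q_add: "Q z (x + y) = Q z x + Q z y"
proof -
  have i: "is_Qinv rm D T (emb z) (Q z)" unfolding Q_def by (rule is_Qinv_Qs[OF z])
  then show "Q z u \<in> D" "T (Q z u) \<in> D" "T (T (Q z u)) - (2 * Re z) *\<^sub>R T (Q z u) + (cmod z)\<^sup>2 *\<^sub>R Q z u = u"
    "x \<in> D \<Longrightarrow> T x \<in> D \<Longrightarrow> Q z (T (T x) - (2 * Re z) *\<^sub>R T x + (cmod z)\<^sup>2 *\<^sub>R x) = x"
    unfolding is_Qinv_def dom2_def Lq_def by auto
  have "rlin rm UNIV (Q z)" using i unfolding is_Qinv_def bop_def by auto
  then have l: "Q z (rm x a + rm y b) = rm (Q z x) a + rm (Q z y) b" for x y a b unfolding rlin_def by auto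
  show "Q z (rm x a) = rm (Q z x) a" using l[of x a 0 0] by simp
  show "Q z (x + y) = Q z x + Q z y" using l[of x 1 y 1] by simp
qed

lemma Q_scaleR: "Q z (r *\<^sub>R x) = r *\<^sub>R Q z x" using Q_rm[of x "of_real r"] by (simp add: rm_of_real)
lemma Q_diff: "Q z (x - y) = Q z x - Q z y" using Q_add[of "x - y" y] by simp

lemma R_D: "R z u \<in> D" by (simp add: R_def D_diff D_sc Q_D)

text \<open>Scalars acting from the right commute with \<open>T\<close>, so the product of
  \<open>z - T\<close> and \<open>cnj z - T\<close> is the quadratic polynomial inverted by
  \<open>Q z\<close>.\<close>

lemma R_right: "csc z (R z u) - T (R z u) = u"
proof -
  have 1: "csc z (csc (cnj z) (Q z u)) = (cmod z)\<^sup>2 *\<^sub>R Q z u"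
    by (simp add: sc_sc complex_norm_square[symmetric] sc_of_real del: of_real_power)
  have 2: "csc z (T (Q z u)) + csc (cnj z) (T (Q z u)) = (2 * Re z) *\<^sub>R T (Q z u)"
    by (simp add: sc_add_left[symmetric] complex_add_cnj sc_of_real del: of_real_mult)
  have "csc z (R z u) - T (R z u) = (cmod z)\<^sup>2 *\<^sub>R Q z u - csc z (T (Q z u))
      - (csc (cnj z) (T (Q z u)) - T (T (Q z u)))"
    unfolding R_def by (simp add: sc_diff 1 T_diff T_sc D_sc Q_D)
  also have "\<dots> = T (T (Q z u)) - (csc z (T (Q z u)) + csc (cnj z) (T (Q z u))) + (cmod z)\<^sup>2 *\<^sub>R Q z u" by simp
  also have "\<dots> = u" unfolding 2 by (rule Q_right)
  finally show ?thesis .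
qed

text \<open>The difference of two solutions is an eigenvector of \<open>T\<close> for
  \<open>z\<close>, hence lies in the domain of the square. The quadratic polynomial has the root
  \<open>z\<close> and kills it, and \<open>Q z\<close> recovers it from 0.\<close>

lemma R_unique: assumes x: "x \<in> D" and u: "csc z x - T x = u" shows "x = R z u"
proof -
  let ?d = "x - R z u"
  have d: "?d \<in> D" by (simp add: D_diff x R_D)
  have "csc z ?d - T ?d = (csc z x - T x) - (csc z (R z u) - T (R z u))" by (simp add: sc_diff T_diff x R_D)
  also have "\<dots> = 0" unfolding R_right u by simp
  finally have Td: "T ?d = csc z ?d" by simp
  then have "T ?d \<in> D" using d D_sc by simp
  then have "Q z (T (T ?d) - (2 * Re z) *\<^sub>R T ?d + (cmod z)\<^sup>2 *\<^sub>R ?d) = ?d" using d by (rule Q_left[rotated])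
  moreover have "T (T ?d) - (2 * Re z) *\<^sub>R T ?d + (cmod z)\<^sup>2 *\<^sub>R ?d
      = csc (z * z - of_real (2 * Re z) * z + of_real ((cmod z)\<^sup>2)) ?d"
    unfolding Td T_sc[OF d] by (simp add: Td sc_add_left sc_diff_left sc_of_real flip: sc_sc del: of_real_mult
        of_real_power)
  moreover have "z * z - of_real (2 * Re z) * z + of_real ((cmod z)\<^sup>2) = 0"
  proof -
    have "z * z - (z + cnj z) * z + z * cnj z = 0" by (simp add: algebra_simps)
    then show ?thesis by (simp only: complex_norm_square complex_add_cnj)
  qed
  ultimately have "?d = Q z 0" by simp
  also have "Q z 0 = 0" using Q_add[of 0 0] by simp
  finally show ?thesis by simp
qed

lemma R_add: "R z (x + y) = R z x + R z y"
proof -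
  have "R z x + R z y = R z (x + y)"
  proof (rule R_unique)
    have "csc z (R z x + R z y) - T (R z x + R z y) = (csc z (R z x) - T (R z x)) + (csc z (R z y) - T (R z y))"
      by (simp add: sc_add T_add R_D)
    then show "csc z (R z x + R z y) - T (R z x + R z y) = x + y" by (simp only: R_right)
  qed (simp add: D_add R_D)
  then show ?thesis ..
qed

lemma R_sc: "R z (csc c x) = csc c (R z x)"
proof -
  have "csc c (R z x) = R z (csc c x)"
  proof (rule R_unique)
    have "csc z (csc c (R z x)) - T (csc c (R z x)) = csc c (csc z (R z x) - T (R z x))"
      by (simp add: sc_diff T_sc R_D sc_sc mult.commute)
    then show "csc z (csc c (R z x)) - T (csc c (R z x)) = csc c x" by (simp only: R_right)
  qed (simp add: D_sc R_D)
  then show ?thesis ..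
qed

lemma R_scaleR: "R z (r *\<^sub>R x) = r *\<^sub>R R z x" using R_sc[of "of_real r" x] by (simp add: sc_of_real)
lemma R_diff: "R z (x - y) = R z x - R z y" using R_add[of "x - y" y] by simp

lemma R_T: assumes "x \<in> D" shows "R z (T x) = T (R z x)"
proof -
  have "T (R z x) = csc z (R z x) - x" using R_right[of x] by (simp add: algebra_simps)
  then have TD: "T (R z x) \<in> D" using assms by (simp add: D_diff D_sc R_D)
  have "T (R z x) = R z (T x)"
  proof (rule R_unique[OF TD])
    have "csc z (T (R z x)) - T (T (R z x)) = T (csc z (R z x) - T (R z x))"
      by (simp add: T_diff T_sc D_sc R_D TD)
    then show "csc z (T (R z x)) - T (T (R z x)) = T x" by (simp only: R_right)
  qed
  then show ?thesis ..
qed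

end

lemma R_resolvent:
  assumes z: "emb z \<notin> qsector \<omega>" and w: "emb w \<notin> qsector \<omega>"
  shows "R w u - R z u = csc (z - w) (R z (R w u))"
proof -
  have "R w u - R z u = R z (csc (z - w) (R w u))"
  proof (rule R_unique[OF z])
    show "R w u - R z u \<in> D" by (simp add: D_diff R_D z w)
    have "csc z (R w u - R z u) - T (R w u - R z u) = (csc (z - w) (R w u) + (csc w (R w u) - T (R w u)))
        - (csc z (R z u) - T (R z u))"
      by (simp add: sc_diff T_diff R_D z w sc_diff_left)
    then show "csc z (R w u - R z u) - T (R w u - R z u) = csc (z - w) (R w u)"
        by (simp only: R_right[OF z] R_right[OF w]) simp
  qed
  then show ?thesis by (simp add: R_sc z)
qed

lemma R_commute:
  assumes z: "emb z \<notin> qsector \<omega>" and w: "emb w \<notin> qsector \<omega>"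
  shows "R z (R w u) = R w (R z u)"
proof (rule R_unique[OF w])
  show "R z (R w u) \<in> D" by (rule R_D[OF z])
  have "csc w (R z (R w u)) - T (R z (R w u)) = R z (csc w (R w u) - T (R w u))"
    by (simp add: R_diff R_sc R_T R_D z w)
  then show "csc w (R z (R w u)) - T (R z (R w u)) = R z u" by (simp only: R_right[OF w])
qed

text \<open>Three angles between \<open>\<omega>\<close> and \<open>\<mu>\<close> are kept apart:
  \<open>\<theta>\<close> carries the contour of \<open>SFC\<close>, \<open>\<theta>1\<close> a
  narrower contour for the inner factor of a product, and above \<open>\<theta>0\<close> the
  resolvent bounds are uniform.\<close>

definition \<theta> where "\<theta> = (\<omega> + \<mu>) / 2"
definition \<theta>1 where "\<theta>1 = \<omega> + (\<mu> - \<omega>) / 4"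
definition \<theta>0 where "\<theta>0 = \<omega> + (\<mu> - \<omega>) / 8"

lemma theta: "\<omega> < \<theta>0" "\<theta>0 < \<theta>1" "\<theta>1 < \<theta>" "\<theta> < \<mu>" "\<mu> < pi / 2" "0 < \<theta>0" "0 < \<theta>1" "0 < \<theta>" "0 < \<mu>" "0 \<le> \<omega>"
  using angles by (auto simp: \<theta>_def \<theta>1_def \<theta>0_def field_simps)

text \<open>The height pi/2 is included because \<open>A\<close> is expressed by \<open>K\<close> at
  the logarithms of i and -i. Up to this height \<open>sin \<bar>Im \<zeta>\<bar>\<close> stays
  above \<open>sin \<theta>0\<close>.\<close>

definition reg :: "complex set" where "reg = {\<zeta>. \<theta>0 < \<bar>Im \<zeta>\<bar> \<and> \<bar>Im \<zeta>\<bar> \<le> pi / 2}"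

lemma reg_off: "\<zeta> \<in> reg \<Longrightarrow> emb (exp \<zeta>) \<notin> qsector \<omega>" and reg_off0: "\<zeta> \<in> reg \<Longrightarrow> emb (exp \<zeta>) \<notin> qsector \<theta>0"
  using theta by (simp_all add: reg_def emb_exp_not_sector)

lemma reg_cnj: "\<zeta> \<in> reg \<Longrightarrow> cnj \<zeta> \<in> reg" by (simp add: reg_def)

lemma SLinv_emb: "SLinv rm ip N D T (emb z) u = Q z (lm (emb (cnj z)) u) - T (Q z u)"
  by (simp add: SLinv_def Q_def emb_cnj)

text \<open>The hypothesis bounds only the combination \<open>SLinv\<close>, not its two terms.
  Since \<open>Q\<close> is unchanged under conjugation, subtracting \<open>SLinv\<close> at
  \<open>z\<close> from \<open>SLinv\<close> at \<open>cnj z\<close> cancels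
  \<open>T (Q z u)\<close> and leaves \<open>Q z\<close> applied to a left multiple of
  \<open>u\<close> by \<open>z - cnj z\<close>. Off the sector this factor is comparable to the
  modulus of \<open>z\<close>, which bounds \<open>Q\<close> and then
  \<open>T (Q z u)\<close>.\<close>

lemma QT_bound: "\<exists>C>0. \<forall>\<zeta>\<in>reg. \<forall>u. norm (Q (exp \<zeta>) u) \<le> C / (cmod (exp \<zeta>))\<^sup>2 * norm u \<and> norm (T (Q (exp \<zeta>) u)) \<le> C
    / cmod (exp \<zeta>) * norm u"
proof -
  obtain C where C: "C > 0" "\<And>s u. s \<noteq> 0 \<Longrightarrow> s \<notin> qsector \<theta>0 \<Longrightarrow> norm (SLinv rm ip N D T s u) \<le> C / norm s * norm u"
    using SL[of \<theta>0] theta by fastforce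
  define S where "S = sin \<theta>0"
  have S: "0 < S" "S \<le> 1" unfolding S_def using theta by (auto intro!: sin_gt_zero)
  have q: "norm (Q (exp \<zeta>) v) \<le> (C / S) / (cmod (exp \<zeta>))\<^sup>2 * norm v" if \<zeta>: "\<zeta> \<in> reg" for \<zeta> v
  proof -
    let ?z = "exp \<zeta>"
    have z0: "cmod ?z > 0" by simp
    have im: "\<bar>Im ?z\<bar> \<ge> cmod ?z * S"
    proof -
      have "S \<le> sin \<bar>Im \<zeta>\<bar>" unfolding S_def using \<zeta> theta by (intro sin_monotone_2pi_le) (auto simp: reg_def)
      also have "\<dots> \<le> \<bar>sin (Im \<zeta>)\<bar>" by (cases "Im \<zeta> \<ge> 0") auto
      finally show ?thesis by (simp add: Im_exp abs_mult)
    qed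
    then have im0: "\<bar>Im ?z\<bar> > 0" using z0 S by (smt (verit) mult_pos_pos)
    then have im1: "Im ?z \<noteq> 0" by auto
    \<comment> \<open>This is the inverse of \<open>z - cnj z\<close>, so feeding in
      \<open>lm (emb c) v\<close> produces exactly \<open>Q z v\<close>.\<close>
    define c where "c = 1 / (2 * \<i> * of_real (Im ?z))"
    let ?u = "lm (emb c) v"
    have nu: "norm ?u = norm v / (2 * \<bar>Im ?z\<bar>)" by (simp add: norm_lmul c_def norm_divide norm_mult)
    have o: "emb ?z \<notin> qsector \<omega>" "emb ?z \<notin> qsector \<theta>0" "emb (cnj ?z) \<notin> qsector \<theta>0"
      using reg_off[OF \<zeta>] reg_off0[OF \<zeta>] reg_off0[OF reg_cnj[OF \<zeta>]] by (auto simp: exp_cnj)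
    have "SLinv rm ip N D T (emb (cnj ?z)) ?u - SLinv rm ip N D T (emb ?z) ?u = Q ?z (lm (emb ?z) ?u)
        - Q ?z (lm (emb (cnj ?z)) ?u)"
      by (simp add: SLinv_emb Q_cnj)
    also have "\<dots> = Q ?z (lm (emb (?z - cnj ?z)) ?u)" by (simp add: Q_diff[OF o(1)] emb_diff lmul_diff_left)
    also have "lm (emb (?z - cnj ?z)) ?u = lm (emb ((?z - cnj ?z) * c)) v" by (simp add: lmul_lmul emb_mult)
    also have "(?z - cnj ?z) * c = 1" using im1 by (simp add: c_def complex_diff_cnj)
    finally have "norm (Q ?z v) = norm (SLinv rm ip N D T (emb (cnj ?z)) ?u - SLinv rm ip N D T (emb ?z) ?u)"
        by simp
    also have "\<dots> \<le> norm (SLinv rm ip N D T (emb (cnj ?z)) ?u) + norm (SLinv rm ip N D T (emb ?z) ?u)"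
        by (rule norm_triangle_ineq4)
    also have "\<dots> \<le> C / cmod ?z * norm ?u + C / cmod ?z * norm ?u"
      using C(2)[of "emb (cnj ?z)" ?u] C(2)[of "emb ?z" ?u] o by (intro add_mono) auto
    also have "\<dots> = C / cmod ?z * norm v / \<bar>Im ?z\<bar>" unfolding nu by simp
    also have "\<dots> \<le> C / cmod ?z * norm v / (cmod ?z * S)"
      using C(1) z0 S im im0 by (intro divide_left_mono) auto
    finally show ?thesis by (simp add: power2_eq_square field_simps)
  qed
  have t: "norm (T (Q (exp \<zeta>) v)) \<le> (C + C / S) / cmod (exp \<zeta>) * norm v" if \<zeta>: "\<zeta> \<in> reg" for \<zeta> v
  proof -
    let ?z = "exp \<zeta>"
    have "T (Q ?z v) = Q ?z (lm (emb (cnj ?z)) v) - SLinv rm ip N D T (emb ?z) v" by (simp add: SLinv_emb)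
    then have "norm (T (Q ?z v)) \<le> norm (Q ?z (lm (emb (cnj ?z)) v)) + norm (SLinv rm ip N D T (emb ?z) v)"
      by (metis norm_triangle_ineq4)
    also have "\<dots> \<le> (C / S) / (cmod ?z)\<^sup>2 * (cmod ?z * norm v) + C / cmod ?z * norm v"
      using q[OF \<zeta>, of "lm (emb (cnj ?z)) v"] C(2)[of "emb ?z" v] reg_off0[OF \<zeta>]
          by (intro add_mono) (auto simp: norm_lmul)
    also have "\<dots> = (C + C / S) / cmod ?z * norm v" by (simp add: power2_eq_square field_simps del: norm_exp_eq_Re)
    finally show ?thesis .
  qed
  have "C / S \<le> C + C / S" "0 < C + C / S" using C S by (auto intro: add_pos_pos)
  note CS = this
  have "norm (Q (exp \<zeta>) v) \<le> (C + C / S) / (cmod (exp \<zeta>))\<^sup>2 * norm v" if "\<zeta> \<in> reg" for \<zeta> v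
    by (rule order_trans[OF q[OF that]]) (intro mult_right_mono divide_right_mono CS(1); simp)
  then show ?thesis using t CS(2) by blast
qed

text \<open>The factor \<open>exp \<zeta>\<close> in \<open>K\<close> cancels the decay of the
  resolvent, so one constant serves on all of \<open>reg\<close>; existence is shown in the lemma of
  the same name.\<close>

definition CK :: real where "CK = (SOME C. C > 0 \<and> (\<forall>\<zeta>\<in>reg. \<forall>u. norm (K \<zeta> u) \<le> C * norm u))"

lemma CK: "CK > 0" "\<zeta> \<in> reg \<Longrightarrow> norm (K \<zeta> u) \<le> CK * norm u"
proof -
  obtain C where C: "C > 0" "\<And>\<zeta> u. \<zeta> \<in> reg \<Longrightarrow> norm (Q (exp \<zeta>) u) \<le> C / (cmod (exp \<zeta>))\<^sup>2 * norm u"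
    "\<And>\<zeta> u. \<zeta> \<in> reg \<Longrightarrow> norm (T (Q (exp \<zeta>) u)) \<le> C / cmod (exp \<zeta>) * norm u"
    using QT_bound by auto
  have "norm (K \<zeta> u) \<le> 2 * C * norm u" if "\<zeta> \<in> reg" for \<zeta> u
  proof -
    let ?r = "cmod (exp \<zeta>)"
    have r: "?r > 0" by simp
    have "norm (R (exp \<zeta>) u) \<le> ?r * norm (Q (exp \<zeta>) u) + norm (T (Q (exp \<zeta>) u))"
      unfolding R_def by (rule order_trans[OF norm_triangle_ineq4]) (simp add: norm_sc)
    also have "\<dots> \<le> ?r * (C / ?r\<^sup>2 * norm u) + C / ?r * norm u"
      using C(2,3)[OF that, of u] r by (intro add_mono mult_left_mono) auto
    also have "\<dots> = 2 * C * norm u / ?r" using r by (simp add: power2_eq_square field_simps del: norm_exp_eq_Re)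
    finally have "?r * norm (R (exp \<zeta>) u) \<le> ?r * (2 * C * norm u / ?r)" using r by (intro mult_left_mono) auto
    then show ?thesis using r by (simp add: K_def norm_sc del: norm_exp_eq_Re)
  qed
  then have "\<exists>C. C > 0 \<and> (\<forall>\<zeta>\<in>reg. \<forall>u. norm (K \<zeta> u) \<le> C * norm u)" using C(1) by (intro exI[of _ "2 * C"]) auto
  from someI_ex[OF this] show "CK > 0" "\<zeta> \<in> reg \<Longrightarrow> norm (K \<zeta> u) \<le> CK * norm u" unfolding CK_def by blast+
qed

lemma K_add: "\<zeta> \<in> reg \<Longrightarrow> K \<zeta> (x + y) = K \<zeta> x + K \<zeta> y" and K_sc: "\<zeta> \<in> reg \<Longrightarrow> K \<zeta> (csc c x) = csc c (K \<zeta> x)"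
  and K_scaleR: "\<zeta> \<in> reg \<Longrightarrow> K \<zeta> (r *\<^sub>R x) = r *\<^sub>R K \<zeta> x"
  and K_commute: "\<zeta> \<in> reg \<Longrightarrow> w \<in> reg \<Longrightarrow> K \<zeta> (K w x) = K w (K \<zeta> x)"
  by (simp_all add: K_def R_add R_sc R_scaleR sc_add sc_sc sc_scaleR mult.commute reg_off R_commute[of "exp \<zeta>" "exp
    w"])

lemma clf_K: assumes "l \<in> clf" "\<zeta> \<in> reg" shows "(\<lambda>x. l (K \<zeta> x)) \<in> clf"
proof -
  interpret l: bounded_linear l using assms by (simp add: clf_def)
  have "bounded_linear (K \<zeta>)"
    using assms CK by (intro bounded_linear_intro[where K=CK]) (auto simp: K_add K_scaleR mult.commute)
  then show ?thesis using assms bounded_linear_compose[OF l.bounded_linear_axioms]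
    by (auto simp: clf_def K_sc)
qed

text \<open>The resolvent identity multiplied by \<open>exp z * exp w\<close>. It separates the
  product of two resolvents into single resolvents with the scalar kernels of
  \<open>Jl_Jl_kernel\<close> and \<open>Jl_cauchy_out\<close>.\<close>

lemma K_K: assumes "z \<in> reg" "w \<in> reg" "exp z \<noteq> exp w" and l: "l \<in> clf"
  shows "l (K z (K w u)) = l (K w u) * (exp z / (exp z - exp w)) - l (K z u) * (exp w / (exp z - exp w))"
proof -
  interpret l: bounded_linear l using l by (simp add: clf_def)
  let ?a = "exp z" and ?b = "exp w"
  have "R ?b u - R ?a u = csc (?a - ?b) (R ?a (R ?b u))" using assms by (intro R_resolvent reg_off)
  then have "l (R ?b u) - l (R ?a u) = (?a - ?b) * l (R ?a (R ?b u))" by (metis l.diff clfD(2)[OF l])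
  then have "l (R ?a (R ?b u)) = (l (R ?b u) - l (R ?a u)) / (?a - ?b)" using assms(3) by (simp add: field_simps)
  then have "?a * ?b * l (R ?a (R ?b u)) = ?a * ?b * ((l (R ?b u) - l (R ?a u)) / (?a - ?b))" by simp
  then show ?thesis unfolding K_def R_sc[OF reg_off[OF assms(1)]] clfD(2)[OF l]
    by (simp add: diff_divide_distrib algebra_simps)
qed

lemma R_continuous: "continuous_on reg (\<lambda>\<zeta>. R (exp \<zeta>) u)"
  unfolding continuous_on_def
proof
  fix w assume w: "w \<in> reg"
  show "((\<lambda>\<zeta>. R (exp \<zeta>) u) \<longlongrightarrow> R (exp w) u) (at w within reg)"
  proof -
    have "((\<lambda>\<zeta>. R (exp w) u - R (exp \<zeta>) u) \<longlongrightarrow> 0) (at w within reg)"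
    proof (rule Lim_null_comparison)
    show "\<forall>\<^sub>F \<zeta> in at w within reg. norm (R (exp w) u - R (exp \<zeta>) u) \<le> cmod (exp \<zeta> - exp w)
        * (CK / cmod (exp \<zeta>) * norm (R (exp w) u))"
      unfolding eventually_at_filter
    proof (rule always_eventually, intro allI impI)
      fix \<zeta> assume \<zeta>: "\<zeta> \<in> reg"
      have "norm (R (exp w) u - R (exp \<zeta>) u) = cmod (exp \<zeta> - exp w) * norm (R (exp \<zeta>) (R (exp w) u))"
        by (subst R_resolvent[OF reg_off[OF \<zeta>] reg_off[OF w]]) (rule norm_sc)
      moreover have "norm (R (exp \<zeta>) (R (exp w) u)) \<le> CK / cmod (exp \<zeta>) * norm (R (exp w) u)"
        using CK(2)[OF \<zeta>, of "R (exp w) u"] unfolding K_def norm_sc by (simp add: field_simps)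
      ultimately show "norm (R (exp w) u - R (exp \<zeta>) u) \<le> cmod (exp \<zeta> - exp w)
          * (CK / cmod (exp \<zeta>) * norm (R (exp w) u))"
        by (simp only: mult_left_mono norm_ge_zero)
    qed
    have "((\<lambda>\<zeta>. cmod (exp \<zeta> - exp w) * (CK / cmod (exp \<zeta>) * norm (R (exp w) u))) \<longlongrightarrow> cmod (exp w - exp w)
        * (CK / cmod (exp w) * norm (R (exp w) u))) (at w within reg)"
      by (intro tendsto_intros) auto
    then show "((\<lambda>\<zeta>. cmod (exp \<zeta> - exp w) * (CK / cmod (exp \<zeta>) * norm (R (exp w) u))) \<longlongrightarrow> 0) (at w within reg)"
        by simp
    qed
    from tendsto_diff[OF tendsto_const[of "R (exp w) u"] this] show ?thesis by simp
  qed
qed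

lemma K_continuous: "continuous_on reg (\<lambda>\<zeta>. K \<zeta> u)"
  unfolding K_def by (intro bounded_bilinear.continuous_on[OF bounded_bilinear_sc] R_continuous continuous_intros)

lemma lK_holomorphic: assumes l: "l \<in> clf" and S: "open S" "S \<subseteq> reg" shows "(\<lambda>\<zeta>. l (K \<zeta> u)) holomorphic_on S"
proof -
  interpret l: bounded_linear l using l by (simp add: clf_def)
  have "(\<lambda>\<zeta>. l (R (exp \<zeta>) u)) holomorphic_on S"
    unfolding holomorphic_on_open[OF S(1)]
  proof
    fix w assume "w \<in> S"
    then have w: "w \<in> reg" using S(2) by (rule subsetD[rotated])
    have wS: "at w within S = at w" by (rule at_within_open[OF \<open>w \<in> S\<close> S(1)])
    have c: "((\<lambda>\<zeta>. l (R (exp \<zeta>) (R (exp w) u))) \<longlongrightarrow> l (R (exp w) (R (exp w) u))) (at w)"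
    proof -
      have "continuous_on S (\<lambda>\<zeta>. l (R (exp \<zeta>) (R (exp w) u)))"
        by (rule l.continuous_on[OF continuous_on_subset[OF R_continuous S(2)]])
      then have "((\<lambda>\<zeta>. l (R (exp \<zeta>) (R (exp w) u))) \<longlongrightarrow> l (R (exp w) (R (exp w) u))) (at w within S)"
        using \<open>w \<in> S\<close> unfolding continuous_on_def by (rule bspec)
      then show ?thesis by (simp only: wS)
    qed
    have e: "((\<lambda>\<zeta>. (exp \<zeta> - exp w) / (\<zeta> - w)) \<longlongrightarrow> exp w) (at w)"
      using DERIV_exp[of w] unfolding has_field_derivative_iff .
    have "((\<lambda>\<zeta>. - ((exp \<zeta> - exp w) / (\<zeta> - w)) * l (R (exp \<zeta>) (R (exp w) u))) \<longlongrightarrow> - exp w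
        * l (R (exp w) (R (exp w) u))) (at w)"
      by (rule tendsto_mult[OF tendsto_minus[OF e] c])
    then have "((\<lambda>\<zeta>. (l (R (exp \<zeta>) u) - l (R (exp w) u)) / (\<zeta> - w)) \<longlongrightarrow> - exp w * l (R (exp w) (R (exp w) u)))
        (at w)"
    proof (rule Lim_transform_eventually)
      have "\<forall>\<^sub>F \<zeta> in at w. \<zeta> \<in> S" by (rule eventually_at_in_open'[OF S(1) \<open>w \<in> S\<close>])
      then show "\<forall>\<^sub>F \<zeta> in at w. - ((exp \<zeta> - exp w) / (\<zeta> - w)) * l (R (exp \<zeta>) (R (exp w) u))
          = (l (R (exp \<zeta>) u) - l (R (exp w) u)) / (\<zeta> - w)"
      proof eventually_elim
        case (elim \<zeta>)
        then have "R (exp w) u - R (exp \<zeta>) u = csc (exp \<zeta> - exp w) (R (exp \<zeta>) (R (exp w) u))" using S w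
            by (intro R_resolvent reg_off) auto
        then have "l (R (exp w) u) - l (R (exp \<zeta>) u) = (exp \<zeta> - exp w) * l (R (exp \<zeta>) (R (exp w) u))"
            by (metis l.diff clfD(2)[OF l])
        then have "l (R (exp \<zeta>) u) - l (R (exp w) u) = - ((exp \<zeta> - exp w) * l (R (exp \<zeta>) (R (exp w) u)))"
            by (simp add: algebra_simps)
        then show ?case by simp
      qed
    qed
    then show "\<exists>f'. ((\<lambda>\<zeta>. l (R (exp \<zeta>) u)) has_field_derivative f') (at w)" unfolding has_field_derivative_iff
        by blast
  qed
  then show ?thesis unfolding K_def clfD(2)[OF l] by (intro holomorphic_intros)
qed

end

section \<open>The scalar functional calculus\<close>

text \<open>The functions of class Psi in the coordinate \<open>s = exp z\<close>: the bound by
  powers of the modulus of \<open>s\<close> becomes exponential decay in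
  \<open>\<bar>Re z\<bar>\<close>. Unlike in \<open>decay\<close>, the bound holds on the whole
  strip and so includes boundedness.\<close>

definition symb :: "real \<Rightarrow> (complex \<Rightarrow> complex) \<Rightarrow> bool" where
  "symb \<mu> g \<longleftrightarrow> g holomorphic_on strip (- \<mu>) \<mu> \<and>
     (\<exists>c \<alpha>. \<alpha> > 0 \<and> (\<forall>z\<in>strip (- \<mu>) \<mu>. cmod (g z) \<le> c * exp (- \<alpha> * \<bar>Re z\<bar>)))"

lemma symb_holomorphic: "symb \<mu> g \<Longrightarrow> g holomorphic_on strip (- \<mu>) \<mu>" by (simp add: symb_def)

lemma symb_decay: "symb \<mu> g \<Longrightarrow> decay (strip (- \<mu>) \<mu>) g" unfolding symb_def decay_def by blast

lemma symb_bounded: assumes "symb \<mu> g" obtains M where "0 \<le> M" "\<And>z. z \<in> strip (- \<mu>) \<mu> \<Longrightarrow> cmod (g z) \<le> M"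
proof -
  from assms obtain c \<alpha> where *: "\<alpha> > 0" "\<And>z. z \<in> strip (- \<mu>) \<mu> \<Longrightarrow> cmod (g z) \<le> c * exp (- \<alpha> * \<bar>Re z\<bar>)"
    unfolding symb_def by auto
  have "cmod (g z) \<le> \<bar>c\<bar>" if "z \<in> strip (- \<mu>) \<mu>" for z
  proof -
    have "cmod (g z) \<le> c * exp (- \<alpha> * \<bar>Re z\<bar>)" by (rule *(2)[OF that])
    also have "\<dots> \<le> \<bar>c\<bar> * exp (- \<alpha> * \<bar>Re z\<bar>)" by (intro mult_right_mono) auto
    also have "\<dots> \<le> \<bar>c\<bar> * 1" using *(1) by (intro mult_left_mono) auto
    finally show ?thesis by simp
  qed
  then show ?thesis by (intro that[of "\<bar>c\<bar>"]) auto
qed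

lemma symb_mult_bounded:
  assumes g: "symb \<mu> g" and F: "F holomorphic_on strip (- \<mu>) \<mu>" "\<And>z. z \<in> strip (- \<mu>) \<mu> \<Longrightarrow> cmod (F z) \<le> M"
  shows "symb \<mu> (\<lambda>z. F z * g z)"
proof -
  from g obtain c \<alpha> where *: "\<alpha> > 0" "\<And>z. z \<in> strip (- \<mu>) \<mu> \<Longrightarrow> cmod (g z) \<le> c * exp (- \<alpha> * \<bar>Re z\<bar>)"
    unfolding symb_def by auto
  show ?thesis unfolding symb_def
  proof (intro conjI exI ballI)
    show "(\<lambda>z. F z * g z) holomorphic_on strip (- \<mu>) \<mu>" by (intro holomorphic_intros F symb_holomorphic g)
    fix z assume z: "z \<in> strip (- \<mu>) \<mu>"
    have "cmod (F z * g z) \<le> \<bar>M\<bar> * cmod (g z)"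
      using F(2)[OF z] by (simp add: norm_mult mult_right_mono)
    also have "\<dots> \<le> \<bar>M\<bar> * (c * exp (- \<alpha> * \<bar>Re z\<bar>))" by (rule mult_left_mono[OF *(2)[OF z]]) simp
    finally show "cmod (F z * g z) \<le> (\<bar>M\<bar> * c) * exp (- \<alpha> * \<bar>Re z\<bar>)" by (simp add: mult.assoc)
  qed (use * in auto)
qed

lemma symb_mult: assumes "symb \<mu> f" "symb \<mu> g" shows "symb \<mu> (\<lambda>z. f z * g z)"
  using assms by (metis symb_bounded symb_mult_bounded symb_holomorphic)

lemma symb_translate: assumes g: "symb \<mu> g" shows "symb \<mu> (\<lambda>z. g (z + of_real t))"
proof -
  from g obtain c \<alpha> where *: "\<alpha> > 0" "\<And>z. z \<in> strip (- \<mu>) \<mu> \<Longrightarrow> cmod (g z) \<le> c * exp (- \<alpha> * \<bar>Re z\<bar>)"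
    unfolding symb_def by auto
  have m: "z + of_real t \<in> strip (- \<mu>) \<mu>" if "z \<in> strip (- \<mu>) \<mu>" for z using that by (simp add: strip_def)
  show ?thesis unfolding symb_def
  proof (intro conjI exI ballI)
    show "(\<lambda>z. g (z + of_real t)) holomorphic_on strip (- \<mu>) \<mu>"
    proof -
      have "(g \<circ> (\<lambda>z. z + of_real t)) holomorphic_on strip (- \<mu>) \<mu>"
        by (rule holomorphic_on_compose_gen[OF _ symb_holomorphic[OF g]])
          (use m in \<open>auto intro!: holomorphic_intros\<close>)
      then show ?thesis by (simp add: o_def)
    qed
    fix z assume z: "z \<in> strip (- \<mu>) \<mu>"
    have "cmod (g (z + of_real t)) \<le> c * exp (- \<alpha> * \<bar>Re z + t\<bar>)" using *(2)[OF m[OF z]] by simp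
    also have "\<dots> \<le> \<bar>c\<bar> * exp (- \<alpha> * \<bar>Re z + t\<bar>)" by (intro mult_right_mono) auto
    also have "\<dots> \<le> \<bar>c\<bar> * exp (\<alpha> * \<bar>t\<bar> + - \<alpha> * \<bar>Re z\<bar>)"
    proof -
      have "\<bar>Re z\<bar> - \<bar>t\<bar> \<le> \<bar>Re z + t\<bar>" by linarith
      then have "\<alpha> * (\<bar>Re z\<bar> - \<bar>t\<bar>) \<le> \<alpha> * \<bar>Re z + t\<bar>" using *(1) by (simp add: mult_left_mono)
      then show ?thesis by (intro mult_left_mono) (auto simp: algebra_simps)
    qed
    finally show "cmod (g (z + of_real t)) \<le> (\<bar>c\<bar> * exp (\<alpha> * \<bar>t\<bar>)) * exp (- \<alpha> * \<bar>Re z\<bar>)"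
        by (simp only: exp_add mult.assoc)
  qed (use * in auto)
qed

lemma symb_integrable: "symb \<mu> g \<Longrightarrow> - \<mu> < y \<Longrightarrow> y < \<mu> \<Longrightarrow> integrable lborel (\<lambda>x. g (Complex x y))"
  by (rule decay_integrable[OF holomorphic_on_imp_continuous_on[OF symb_holomorphic] symb_decay])
    (auto simp: strip_def)

lemma symb_line_continuous: assumes "symb \<mu> g" "- \<mu> < y" "y < \<mu>" shows "continuous_on UNIV (\<lambda>x. g (Complex x y))"
  by (rule continuous_on_compose2[OF holomorphic_on_imp_continuous_on[OF symb_holomorphic[OF assms(1)]]
    continuous_on_Complex_line])
    (use assms in \<open>auto simp: strip_def\<close>)

text \<open>A bounded functional passes through the gauge integral over r, and the substitution r =
  exp x turns the scalar result into a Lebesgue integral over the line. This is the passage from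
  vector integrals to \<open>LI\<close>.\<close>

lemma log_integral_weak:
  fixes f :: "real \<Rightarrow> 'h::{real_normed_vector,complete_space}" and l :: "'h \<Rightarrow> complex"
  assumes f: "continuous_on UNIV f" and a: "a > 0" and b: "\<And>x. norm (f x) \<le> c * exp (- a * \<bar>x\<bar>)"
      and l: "bounded_linear l"
  shows "l (integral {0<..} (\<lambda>r. (1 / r) *\<^sub>R f (ln r))) = (LBINT x. l (f x))" "integrable lborel (\<lambda>x. l (f x))"
proof -
  interpret l: bounded_linear l by fact
  obtain B where B: "\<And>x. cmod (l x) \<le> norm x * B" using l.bounded by blast
  show int: "integrable lborel (\<lambda>x. l (f x))"
  proof (rule integrable_cont_decay[OF _ a, where r=0 and c="c * \<bar>B\<bar>"])
    show "continuous_on UNIV (\<lambda>x. l (f x))" by (rule l.continuous_on[OF f])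
    fix x
    have "cmod (l (f x)) \<le> norm (f x) * \<bar>B\<bar>" by (rule order_trans[OF B]) (simp add: mult_left_mono)
    also have "\<dots> \<le> (c * exp (- a * \<bar>x\<bar>)) * \<bar>B\<bar>" by (rule mult_right_mono[OF b]) simp
    finally show "cmod (l (f x)) \<le> (c * \<bar>B\<bar>) * exp (- a * \<bar>x\<bar>)" by (simp add: mult_ac)
  qed
  have "l (integral {0<..} (\<lambda>r. (1 / r) *\<^sub>R f (ln r))) = integral {0<..} (l \<circ> (\<lambda>r. (1 / r) *\<^sub>R f (ln r)))"
    by (rule integral_linear[OF integrable_on_log_decay[OF f a b] l, symmetric])
  also have "\<dots> = integral {0<..} (\<lambda>r. (1 / r) *\<^sub>R l (f (ln r)))" by (simp add: o_def l.scaleR)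
  also have "\<dots> = (LBINT x. l (f x))" by (rule integral_log_substitution[OF int])
  finally show "l (integral {0<..} (\<lambda>r. (1 / r) *\<^sub>R f (ln r))) = (LBINT x. l (f x))" .
qed

lemma Jl_add:
  assumes "\<And>y. y = t \<or> y = - t \<Longrightarrow> integrable lborel (\<lambda>x. f (Complex x y))"
      "\<And>y. y = t \<or> y = - t \<Longrightarrow> integrable lborel (\<lambda>x. g (Complex x y))"
  shows "Jl t (\<lambda>z. f z + g z) = Jl t f + Jl t g" "Jl t (\<lambda>z. f z - g z) = Jl t f - Jl t g"
  using assms unfolding Jl_def LI_def by (simp_all add: field_simps)

lemma Jl_cmult: "Jl t (\<lambda>z. c * f z) = c * Jl t f"
  by (simp add: Jl_def LI_cmult right_diff_distrib)

lemma Jl_cong: assumes "\<And>x y. y = t \<or> y = - t \<Longrightarrow> f (Complex x y) = g (Complex x y)" shows "Jl t f = Jl t g"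
  using assms by (simp add: Jl_def cong: LI_cong)

context qhil
begin

lemma clf_eqI: assumes "\<And>l. l \<in> clf \<Longrightarrow> l x = l y" shows "x = y"
  by (rule cip_eqI) (use assms cip_clf in auto)

end

definition p0 :: "complex \<Rightarrow> complex" where "p0 z = exp z / (1 + exp z * exp z)"

text \<open>With \<open>a = (cmod s)\<^sup>2\<close> and \<open>c = cos (arg s)\<close> one has
  \<open>(cmod (1 + s\<^sup>2))\<^sup>2 = (1 - a)\<^sup>2 + 4 * a * c\<^sup>2\<close>, which is at
  least \<open>c\<^sup>2 * (1 + a)\<^sup>2\<close>. On the strip \<open>c\<close> is at least
  \<open>cos \<mu>\<close>, and this is positive.\<close>

lemma p0_symb: assumes m: "0 < \<mu>" "\<mu> < pi / 2" shows "symb \<mu> p0"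
proof -
  have cm: "cos \<mu> > 0" using m by (intro cos_gt_zero_pi) auto
  have lb: "cos \<mu> * (1 + (exp (Re z))\<^sup>2) \<le> cmod (1 + exp z * exp z)" if z: "z \<in> strip (- \<mu>) \<mu>" for z
  proof -
    have "cos \<mu> \<le> cos (Im z)"
    proof -
      have "cos \<mu> \<le> cos \<bar>Im z\<bar>" using z m by (intro cos_monotone_0_pi_le) (auto simp: strip_def)
      then show ?thesis by simp
    qed
    then have c2: "(cos \<mu>)\<^sup>2 \<le> (cos (Im z))\<^sup>2" using cm by (intro power_mono) auto
    define a where "a = (exp (Re z))\<^sup>2"
    have a: "a > 0" by (simp add: a_def)
    have e: "exp z * exp z = exp (2 * z)" by (simp add: exp_double power2_eq_square)
    have aE: "exp (2 * Re z) = a" by (simp add: a_def exp_double)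
    define c d t where "c = cos (Im z)" and "d = cos (2 * Im z)" and "t = sin (2 * Im z)"
    have d: "d = 2 * c\<^sup>2 - 1" by (simp add: d_def c_def cos_double_cos)
    have td: "t\<^sup>2 + d\<^sup>2 = 1" by (simp add: t_def d_def)
    have "(cmod (1 + exp z * exp z))\<^sup>2 = (1 + a * d)\<^sup>2 + (a * t)\<^sup>2"
      unfolding e by (simp add: cmod_power2 Re_exp Im_exp aE d_def t_def)
    also have "\<dots> = 1 + 2 * a * d + a\<^sup>2 * (t\<^sup>2 + d\<^sup>2)"
      by (simp add: power2_eq_square algebra_simps)
    also have "\<dots> = 1 + 2 * a * d + a\<^sup>2" by (simp only: td mult_1_right)
    also have "\<dots> = (1 - a)\<^sup>2 + 4 * a * c\<^sup>2"
      unfolding d by (simp add: power2_eq_square algebra_simps)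
    finally have E: "(cmod (1 + exp z * exp z))\<^sup>2 = (1 - a)\<^sup>2 + 4 * a * c\<^sup>2" .
    have "c\<^sup>2 * (1 - a)\<^sup>2 \<le> 1 * (1 - a)\<^sup>2" by (intro mult_right_mono) (auto simp: abs_square_le_1 c_def)
    moreover have "c\<^sup>2 * (1 + a)\<^sup>2 = c\<^sup>2 * (1 - a)\<^sup>2 + 4 * a * c\<^sup>2" by (simp add: power2_eq_square algebra_simps)
    ultimately have "(cos (Im z))\<^sup>2 * (1 + a)\<^sup>2 \<le> (cmod (1 + exp z * exp z))\<^sup>2" unfolding E c_def by linarith
    moreover have "(cos \<mu>)\<^sup>2 * (1 + a)\<^sup>2 \<le> (cos (Im z))\<^sup>2 * (1 + a)\<^sup>2" using c2 by (rule mult_right_mono) simp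
    ultimately have "(cos \<mu> * (1 + a))\<^sup>2 \<le> (cmod (1 + exp z * exp z))\<^sup>2" by (simp add: power_mult_distrib)
    then show ?thesis unfolding a_def by (rule power2_le_imp_le) simp
  qed
  have nz: "1 + exp z * exp z \<noteq> 0" if "z \<in> strip (- \<mu>) \<mu>" for z
  proof
    assume "1 + exp z * exp z = 0"
    then have "cos \<mu> * (1 + (exp (Re z))\<^sup>2) \<le> 0" using lb[OF that] by simp
    moreover have "0 < cos \<mu> * (1 + (exp (Re z))\<^sup>2)" by (rule mult_pos_pos[OF cm]) (simp add: add_pos_nonneg)
    ultimately show False by linarith
  qed
  show ?thesis unfolding symb_def
  proof (intro conjI exI ballI)
    show "p0 holomorphic_on strip (- \<mu>) \<mu>" unfolding p0_def by (intro holomorphic_intros nz)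
    fix z assume z: "z \<in> strip (- \<mu>) \<mu>"
    define x where "x = Re z"
    have "cmod (p0 z) = exp x / cmod (1 + exp z * exp z)" by (simp add: p0_def norm_divide x_def)
    also have "\<dots> \<le> exp x / (cos \<mu> * (1 + (exp x)\<^sup>2))"
      using lb[OF z] cm by (intro divide_left_mono) (auto simp: x_def intro!: mult_pos_pos add_pos_nonneg nz[OF z])
    also have "\<dots> = (1 / cos \<mu>) * (exp x / (1 + (exp x)\<^sup>2))" by simp
    also have "\<dots> \<le> (1 / cos \<mu>) * exp (- 1 * \<bar>x\<bar>)"
    proof (rule mult_left_mono)
      show "exp x / (1 + (exp x)\<^sup>2) \<le> exp (- 1 * \<bar>x\<bar>)"
      proof (cases "x \<ge> 0")
        case True
        have "exp x * exp x \<le> 1 + (exp x)\<^sup>2" by (simp add: power2_eq_square)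
        then show ?thesis using True by (simp add: exp_minus divide_simps add_pos_nonneg)
            (simp add: add_nonneg_eq_0_iff)?
      next
        case False
        then show ?thesis by (simp add: divide_le_eq add_pos_nonneg)
      qed
      show "0 \<le> 1 / cos \<mu>" using cm by simp
    qed
    finally show "cmod (p0 z) \<le> (1 / cos \<mu>) * exp (- 1 * \<bar>Re z\<bar>)" by (simp add: x_def)
  qed simp
qed

context sect_op
begin

lemma line_reg: "y = \<theta> \<or> y = - \<theta> \<or> y = \<theta>1 \<or> y = - \<theta>1 \<Longrightarrow> Complex x y \<in> reg"
  using theta by (auto simp: reg_def)

lemma line_strip: "y = \<theta> \<or> y = - \<theta> \<or> y = \<theta>1 \<or> y = - \<theta>1 \<Longrightarrow> - \<mu> < y \<and> y < \<mu>"
  using theta by auto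

lemma K_line_continuous: "y = \<theta> \<or> y = - \<theta> \<Longrightarrow> continuous_on UNIV (\<lambda>x. K (Complex x y) u)"
  by (rule continuous_on_compose2[OF K_continuous continuous_on_Complex_line]) (auto intro!: line_reg)

text \<open>\<open>PHI g\<close> is \<open>g (ln T)\<close>; it is written over \<open>r = exp x\<close> with the factor \<open>1 / r\<close> to match \<open>SFC\<close>.\<close>

definition Wg :: "(complex \<Rightarrow> complex) \<Rightarrow> 'h \<Rightarrow> real \<Rightarrow> 'h" where
  "Wg g u x = csc (- \<i> * g (Complex x (- \<theta>))) (K (Complex x (- \<theta>)) u)
      + csc (\<i> * g (Complex x \<theta>)) (K (Complex x \<theta>) u)"

definition PHI :: "(complex \<Rightarrow> complex) \<Rightarrow> 'h \<Rightarrow> 'h" where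
  "PHI g u = (1 / (2 * pi)) *\<^sub>R integral {0<..} (\<lambda>r. (1 / r) *\<^sub>R Wg g u (ln r))"

lemma Wg_continuous: assumes "symb \<mu> g" shows "continuous_on UNIV (Wg g u)"
  unfolding Wg_def
  by (intro continuous_on_add bounded_bilinear.continuous_on[OF bounded_bilinear_sc] K_line_continuous
    continuous_on_mult continuous_on_const
    symb_line_continuous[OF assms] conjunct1[OF line_strip] conjunct2[OF line_strip]) auto

lemma Wg_decay: assumes "symb \<mu> g" obtains c \<alpha> where "\<alpha> > 0" "\<And>x. norm (Wg g u x) \<le> c * exp (- \<alpha> * \<bar>x\<bar>)"
proof -
  from assms obtain c \<alpha> where *: "\<alpha> > 0" "\<And>z. z \<in> strip (- \<mu>) \<mu> \<Longrightarrow> cmod (g z) \<le> c * exp (- \<alpha> * \<bar>Re z\<bar>)"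
    unfolding symb_def by auto
  have 1: "norm (csc (w * g (Complex x y)) (K (Complex x y) u)) \<le> (c * exp (- \<alpha> * \<bar>x\<bar>)) * (CK * norm u)"
    if "y = \<theta> \<or> y = - \<theta>" "cmod w = 1" for x y w
    unfolding norm_sc
  proof (rule mult_mono')
    show "cmod (w * g (Complex x y)) \<le> c * exp (- \<alpha> * \<bar>x\<bar>)"
      using *(2)[of "Complex x y"] line_strip[of y] that by (auto simp: norm_mult strip_def)
    show "norm (K (Complex x y) u) \<le> CK * norm u" using that by (intro CK line_reg) auto
  qed auto
  have "norm (Wg g u x) \<le> 2 * c * CK * norm u * exp (- \<alpha> * \<bar>x\<bar>)" for x
    unfolding Wg_def by (rule order_trans[OF norm_triangle_ineq])
        (use 1[of "- \<theta>" "- \<i>" x] 1[of \<theta> \<i> x] in \<open>simp add: mult_ac\<close>)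
  then show ?thesis using *(1) by (rule_tac that) auto
qed

lemma gK_integrable:
  assumes g: "symb \<mu> g" and l: "l \<in> clf" and y: "y = \<theta> \<or> y = - \<theta> \<or> y = \<theta>1 \<or> y = - \<theta>1"
  shows "integrable lborel (\<lambda>x. g (Complex x y) * l (K (Complex x y) u))"
proof -
  interpret l: bounded_linear l using l by (rule clfD)
  obtain B where B: "\<And>x. cmod (l x) \<le> norm x * B" "B > 0" using l.pos_bounded by blast
  have Kb: "cmod (l (K (Complex x y) u)) \<le> CK * norm u * B" for x
    by (rule order_trans[OF B(1)]) (use B CK(2)[OF line_reg[OF y]] in \<open>auto intro!: mult_right_mono\<close>)
  have m: "(\<lambda>x. l (K (Complex x y) u)) \<in> borel_measurable borel"
    by (intro borel_measurable_continuous_onI l.continuous_on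
      continuous_on_compose2[OF K_continuous continuous_on_Complex_line])
      (auto intro!: line_reg[OF y])
  show ?thesis
  proof (rule Bochner_Integration.integrable_bound[OF
      integrable_mult_right[OF integrable_norm[OF symb_integrable[OF g, of y]], of "CK * norm u * B"]])
    show "AE x in lborel. norm (g (Complex x y) * l (K (Complex x y) u))
        \<le> norm (CK * norm u * B * cmod (g (Complex x y)))"
    proof (rule AE_I2)
      fix x
      have "norm (g (Complex x y) * l (K (Complex x y) u)) \<le> cmod (g (Complex x y)) * (CK * norm u * B)"
        unfolding norm_mult by (rule mult_left_mono[OF Kb]) simp
      then show "norm (g (Complex x y) * l (K (Complex x y) u)) \<le> norm (CK * norm u * B * cmod (g (Complex x y)))"
        by (simp add: mult_ac abs_mult) (use B CK in auto)
    qed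
    show "(\<lambda>x. g (Complex x y) * l (K (Complex x y) u)) \<in> borel_measurable lborel"
      using m borel_measurable_integrable[OF symb_integrable[OF g, of y]] line_strip[OF y] by auto
  qed (use line_strip[OF y] in auto)
qed

text \<open>The orientation and the quotient \<open>1 / (2 * pi * \<i>)\<close> of \<open>Jl\<close>
  match the scalars in \<open>Wg\<close>. Together with \<open>PHI_eqI\<close> this characterizes
  \<open>PHI g u\<close>; the algebraic rules of the calculus are derived from it.\<close>

lemma PHI_weak:
  assumes g: "symb \<mu> g" and l: "l \<in> clf"
  shows "l (PHI g u) = Jl \<theta> (\<lambda>z. g z * l (K z u))"
proof -
  interpret l: bounded_linear l using l by (rule clfD)
  obtain c \<alpha> where *: "\<alpha> > 0" "\<And>x. norm (Wg g u x) \<le> c * exp (- \<alpha> * \<bar>x\<bar>)" using Wg_decay[OF g] by blast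
  have "l (PHI g u) = (1 / (2 * pi)) *\<^sub>R (LBINT x. l (Wg g u x))"
    unfolding PHI_def l.scaleR log_integral_weak(1)[OF Wg_continuous[OF g] * l.bounded_linear_axioms] ..
  also have "(LBINT x. l (Wg g u x))
      = (LBINT x. - \<i> * (g (Complex x (- \<theta>)) * l (K (Complex x (- \<theta>)) u)) + \<i> *
      (g (Complex x \<theta>) * l (K (Complex x \<theta>) u)))"
    unfolding Wg_def l.add clfD(2)[OF l] by (simp add: mult.assoc)
  also have "\<dots> = - \<i> * LI (- \<theta>) (\<lambda>z. g z * l (K z u)) + \<i> * LI \<theta> (\<lambda>z. g z * l (K z u))"
    unfolding LI_def by (subst Bochner_Integration.integral_add)
        (auto intro!: integrable_mult_right gK_integrable g l)
  finally have "l (PHI g u) = (1 / (2 * pi)) *\<^sub>R (- \<i> * LI (- \<theta>) (\<lambda>z. g z * l (K z u)) + \<i>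
      * LI \<theta> (\<lambda>z. g z * l (K z u)))" .
  then have "l (PHI g u) * (2 * pi * \<i>) = LI (- \<theta>) (\<lambda>z. g z * l (K z u)) - LI \<theta> (\<lambda>z. g z * l (K z u))"
  proof (rule ssubst)
    have "((1 / (2 * pi)) *\<^sub>R (- \<i> * a + \<i> * b)) * (2 * pi * \<i>) = a - b" for a b
      by (simp add: complex_eq_iff)
    then show "(1 / (2 * pi)) *\<^sub>R (- \<i> * LI (- \<theta>) (\<lambda>z. g z * l (K z u)) + \<i> * LI \<theta> (\<lambda>z. g z * l (K z u)))
        * (2 * pi * \<i>)
      = LI (- \<theta>) (\<lambda>z. g z * l (K z u)) - LI \<theta> (\<lambda>z. g z * l (K z u))" .
  qed
  then show ?thesis unfolding Jl_def by (subst eq_divide_eq) simp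
qed

lemma PHI_eqI: assumes "symb \<mu> g" "\<And>l. l \<in> clf \<Longrightarrow> l v = Jl \<theta> (\<lambda>z. g z * l (K z u))" shows "v = PHI g u"
  by (rule clf_eqI) (simp add: assms PHI_weak)

text \<open>The resolvent is holomorphic and \<open>K\<close> is bounded on both components of
  \<open>\<theta>0 < \<bar>Im z\<bar> < \<mu>\<close>, so each line may be moved within its
  component.\<close>

lemma Jl_gK_shift: assumes g: "symb \<mu> g" and l: "l \<in> clf"
  shows "Jl \<theta> (\<lambda>z. g z * l (K z u)) = Jl \<theta>1 (\<lambda>z. g z * l (K z u))"
proof -
  interpret l: bounded_linear l using l by (rule clfD)
  obtain B where B: "\<And>x. cmod (l x) \<le> norm x * B" "B > 0" using l.pos_bounded by blast
  let ?S = "strip \<theta>0 \<mu> \<union> strip (- \<mu>) (- \<theta>0)"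
  have S: "?S \<subseteq> reg" "?S \<subseteq> strip (- \<mu>) \<mu>" "open ?S" using theta
      by (auto simp: reg_def strip_def open_strip[unfolded strip_def])
  show ?thesis
  proof (rule Jl_shift[where a=\<theta>0 and b=\<mu>])
    show "(\<lambda>z. g z * l (K z u)) holomorphic_on ?S"
      by (intro holomorphic_intros lK_holomorphic l S holomorphic_on_subset[OF symb_holomorphic[OF g]])
    show "decay ?S (\<lambda>z. g z * l (K z u))"
    proof (rule decay_bound[OF decay_subset[OF symb_decay[OF g] S(2)]])
      fix z assume "z \<in> ?S"
      then have "z \<in> reg" using S by auto
      then have "cmod (l (K z u)) \<le> CK * norm u * B"
        by (intro order_trans[OF B(1)] mult_right_mono CK) (use B in auto)
      then show "cmod (g z * l (K z u)) \<le> (CK * norm u * B) * cmod (g z)"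
        unfolding norm_mult by (subst mult.commute) (simp add: mult_right_mono)
    qed
  qed (use theta in auto)
qed

lemma PHI_add: assumes g: "symb \<mu> g" shows "PHI g (u + v) = PHI g u + PHI g v"
proof (rule PHI_eqI[OF g, symmetric])
  fix l assume l: "l \<in> clf"
  interpret l: bounded_linear l using l by (rule clfD)
  have "Jl \<theta> (\<lambda>z. g z * l (K z (u + v))) = Jl \<theta> (\<lambda>z. g z * l (K z u) + g z * l (K z v))"
    by (rule Jl_cong) (auto simp: K_add line_reg l.add distrib_left)
  also have "\<dots> = Jl \<theta> (\<lambda>z. g z * l (K z u)) + Jl \<theta> (\<lambda>z. g z * l (K z v))"
    by (rule Jl_add) (auto intro!: gK_integrable g l)
  finally show "l (PHI g u + PHI g v) = Jl \<theta> (\<lambda>z. g z * l (K z (u + v)))" by (simp add: l.add PHI_weak[OF g l])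
qed

lemma PHI_K: assumes g: "symb \<mu> g" and z: "\<zeta> \<in> reg" shows "PHI g (K \<zeta> u) = K \<zeta> (PHI g u)"
proof (rule PHI_eqI[OF g, symmetric])
  fix l assume l: "l \<in> clf"
  show "l (K \<zeta> (PHI g u)) = Jl \<theta> (\<lambda>z. g z * l (K z (K \<zeta> u)))"
    unfolding PHI_weak[OF g clf_K[OF l z]] by (rule Jl_cong) (subst K_commute[OF z line_reg], auto)
qed

lemma PHI_sc: assumes g: "symb \<mu> g" shows "PHI g (csc c u) = csc c (PHI g u)"
proof (rule PHI_eqI[OF g, symmetric])
  fix l assume l: "l \<in> clf"
  have "Jl \<theta> (\<lambda>z. g z * l (K z (csc c u))) = Jl \<theta> (\<lambda>z. c * (g z * l (K z u)))"
    by (rule Jl_cong) (auto simp: K_sc line_reg clfD[OF l])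
  then show "l (csc c (PHI g u)) = Jl \<theta> (\<lambda>z. g z * l (K z (csc c u)))"
      by (simp add: clfD(2)[OF l] PHI_weak[OF g l] Jl_cmult)
qed

lemma PHI_scaleR: "symb \<mu> g \<Longrightarrow> PHI g (r *\<^sub>R u) = r *\<^sub>R PHI g u" using PHI_sc[of g "of_real r" u]
    by (simp add: sc_of_real)
lemma PHI_zero: "symb \<mu> g \<Longrightarrow> PHI g 0 = 0" using PHI_add[of g 0 0] by simp

text \<open>This L1 norm on the contour is invariant under real translations of \<open>g\<close>, so
  the norm bounds derived from it are uniform over all dilations of the operator.\<close>

definition Lg :: "(complex \<Rightarrow> complex) \<Rightarrow> real" where
  "Lg g = (LBINT x. cmod (g (Complex x (- \<theta>)))) + (LBINT x. cmod (g (Complex x \<theta>)))"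

lemma Jl_gK_bound:
  assumes g: "\<And>y. y = \<theta> \<or> y = - \<theta> \<Longrightarrow> integrable lborel (\<lambda>x. g (Complex x y))"
    and k: "\<And>z. z \<in> reg \<Longrightarrow> cmod (k z) \<le> M"
    and gk: "\<And>y. y = \<theta> \<or> y = - \<theta> \<Longrightarrow> integrable lborel (\<lambda>x. g (Complex x y) * k (Complex x y))"
  shows "cmod (Jl \<theta> (\<lambda>z. g z * k z)) \<le> Lg g * M / (2 * pi)"
proof -
  have 1: "cmod (LI y (\<lambda>z. g z * k z)) \<le> (LBINT x. cmod (g (Complex x y))) * M" if y: "y = \<theta> \<or> y = - \<theta>" for y
  proof -
    have "cmod (LI y (\<lambda>z. g z * k z)) \<le> (LBINT x. cmod (g (Complex x y) * k (Complex x y)))" unfolding LI_def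
        by (rule integral_norm_bound)
    also have "\<dots> \<le> (LBINT x. cmod (g (Complex x y)) * M)"
    proof (rule integral_mono)
      show "integrable lborel (\<lambda>x. cmod (g (Complex x y)) * M)" using g[OF y]
          by (intro integrable_mult_left integrable_norm)
      show "cmod (g (Complex x y) * k (Complex x y)) \<le> cmod (g (Complex x y)) * M" for x
        unfolding norm_mult using k[OF line_reg, of y x] y by (intro mult_left_mono) auto
    qed (rule integrable_norm[OF gk[OF y]])
    finally show ?thesis by simp
  qed
  have "cmod (Jl \<theta> (\<lambda>z. g z * k z)) = cmod (LI (- \<theta>) (\<lambda>z. g z * k z) - LI \<theta> (\<lambda>z. g z * k z)) / (2 * pi)"
    by (simp add: Jl_def norm_divide norm_mult)
  also have "\<dots> \<le> (cmod (LI (- \<theta>) (\<lambda>z. g z * k z)) + cmod (LI \<theta> (\<lambda>z. g z * k z))) / (2 * pi)"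
    by (intro divide_right_mono norm_triangle_ineq4) simp
  also have "\<dots> \<le> Lg g * M / (2 * pi)" using 1[of \<theta>] 1[of "- \<theta>"]
      by (intro divide_right_mono) (simp_all add: Lg_def distrib_right)
  finally show ?thesis .
qed

text \<open>Testing with the inner product against \<open>PHI g u\<close> itself turns the squared
  norm into a scalar contour integral; one factor \<open>norm (PHI g u)\<close> then
  cancels.\<close>

lemma PHI_bound: assumes g: "symb \<mu> g" shows "norm (PHI g u) \<le> Lg g * CK / (2 * pi) * norm u"
proof (cases "PHI g u = 0")
  case True
  have "0 \<le> Lg g" by (simp add: Lg_def)
  then show ?thesis using True CK(1) by simp
next
  case False
  let ?w = "PHI g u"
  have "(norm ?w)\<^sup>2 = cmod (cin ?w ?w)" by (simp add: cip_self norm_power)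
  also have "cin ?w ?w = Jl \<theta> (\<lambda>z. g z * cin (K z u) ?w)" by (rule PHI_weak[OF g cip_clf])
  also have "cmod \<dots> \<le> Lg g * (CK * norm u * norm ?w) / (2 * pi)"
  proof (rule Jl_gK_bound)
    show "integrable lborel (\<lambda>x. g (Complex x y))" if "y = \<theta> \<or> y = - \<theta>" for y
      using that line_strip[of y] by (intro symb_integrable[OF g]) auto
    show "cmod (cin (K z u) ?w) \<le> CK * norm u * norm ?w" if "z \<in> reg" for z
      by (rule order_trans[OF cmod_cip_le]) (intro mult_right_mono CK that; simp)
    show "integrable lborel (\<lambda>x. g (Complex x y) * cin (K (Complex x y) u) ?w)" if "y = \<theta> \<or> y = - \<theta>" for y
      using that by (intro gK_integrable[OF g cip_clf]) auto
  qed
  finally have "norm ?w * norm ?w \<le> (Lg g * CK / (2 * pi) * norm u) * norm ?w"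
      by (simp add: power2_eq_square mult_ac)
  then show ?thesis by (subst (asm) mult_le_cancel_right_pos) (use False in auto)
qed

lemma PHI_cont: assumes g: "symb \<mu> g" shows "bounded_linear (PHI g)"
  by (rule bounded_linear_intro[where K="Lg g * CK / (2 * pi)"])
    (use PHI_bound[OF g] in \<open>auto simp: PHI_add PHI_scaleR g mult.commute\<close>)

text \<open>With the contour moved to height \<open>\<theta>1\<close> the point \<open>z\<close>
  lies outside, and \<open>K_K\<close> splits the integrand. The part containing
  \<open>l (K z u)\<close> is a scalar integral that vanishes by
  \<open>Jl_cauchy_out\<close>.\<close>

lemma K_PHI:
  assumes g: "symb \<mu> g" and l: "l \<in> clf" and z: "z \<in> reg" "\<theta>1 < \<bar>Im z\<bar>"
  shows "l (K z (PHI g u)) = Jl \<theta>1 (\<lambda>w. g w * l (K w u) * (exp z / (exp z - exp w)))"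
proof -
  interpret l: bounded_linear l using l by (rule clfD)
  have ne: "exp z \<noteq> exp (Complex x y)" if "y = \<theta>1 \<or> y = - \<theta>1" for x y
  proof
    assume "exp z = exp (Complex x y)"
    then have "z = Complex x y" by (rule exp_eq_strip) (use that z theta in \<open>auto simp: reg_def\<close>)
    then show False using that z theta by auto
  qed
  have gi: "integrable lborel (\<lambda>x. g (Complex x y) * (exp (Complex x y) / (exp z - exp (Complex x y))))"
      if y: "y = \<theta>1 \<or> y = - \<theta>1" for y
  proof (rule decay_integrable[where S="{w. Im w = y}"])
    have sub: "{w. Im w = y} \<subseteq> strip (- \<mu>) \<mu>" using line_strip[of y] y by (auto simp: strip_def)
    have "exp z \<noteq> exp w" if "Im w = y" for w using ne[OF y, of "Re w"] that by (metis complex.exhaust_sel)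
    then show "continuous_on {w. Im w = y} (\<lambda>w. g w * (exp w / (exp z - exp w)))"
      by (intro continuous_intros continuous_on_subset[OF
        holomorphic_on_imp_continuous_on[OF symb_holomorphic[OF g]] sub]) auto
    show "decay {w. Im w = y} (\<lambda>w. g w * (exp w / (exp z - exp w)))"
    proof (rule decay_bound[OF decay_subset[OF symb_decay[OF g] sub]])
      fix w assume "1 + \<bar>Re z\<bar> \<le> \<bar>Re w\<bar>"
      then have "cmod (1 / (1 - exp (z - w))) \<le> 2" by (intro exp_kernel_far) auto
      then show "cmod (g w * (exp w / (exp z - exp w))) \<le> 2 * cmod (g w)"
        unfolding exp_kernel_eq' norm_mult norm_minus_cancel by (metis mult.commute mult_left_mono norm_ge_zero)
    qed
  qed auto
  have gi': "integrable lborel (\<lambda>x. g (Complex x y) * l (K (Complex x y) u)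
      * (exp z / (exp z - exp (Complex x y))))" if y: "y = \<theta>1 \<or> y = - \<theta>1" for y
  proof -
    have "integrable lborel (\<lambda>x. g (Complex x y) * l (K z (K (Complex x y) u)) + l (K z u)
        * (g (Complex x y) * (exp (Complex x y) / (exp z - exp (Complex x y)))))"
      by (intro Bochner_Integration.integrable_add gK_integrable[OF g clf_K[OF l z(1)]] integrable_mult_right gi y)
        (use y in auto)
    moreover have "g (Complex x y) * l (K z (K (Complex x y) u)) + l (K z u)
        * (g (Complex x y) * (exp (Complex x y) / (exp z - exp (Complex x y))))
      = g (Complex x y) * l (K (Complex x y) u) * (exp z / (exp z - exp (Complex x y)))" for x
      by (subst K_K[OF z(1) line_reg ne l]) (use y in \<open>auto simp: algebra_simps\<close>)
    ultimately show ?thesis by simp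
  qed
  have "l (K z (PHI g u)) = Jl \<theta>1 (\<lambda>w. g w * l (K z (K w u)))"
    unfolding PHI_weak[OF g clf_K[OF l z(1)]] by (rule Jl_gK_shift[OF g clf_K[OF l z(1)]])
  also have "\<dots> = Jl \<theta>1 (\<lambda>w. g w * l (K w u) * (exp z / (exp z - exp w)) - l (K z u)
      * (g w * (exp w / (exp z - exp w))))"
  proof (rule Jl_cong)
    fix x y assume y: "y = \<theta>1 \<or> y = - \<theta>1"
    show "g (Complex x y) * l (K z (K (Complex x y) u)) = g (Complex x y) * l (K (Complex x y) u)
        * (exp z / (exp z - exp (Complex x y)))
      - l (K z u) * (g (Complex x y) * (exp (Complex x y) / (exp z - exp (Complex x y))))"
      by (subst K_K[OF z(1) line_reg ne l]) (use y in \<open>auto simp: algebra_simps\<close>)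
  qed
  also have "\<dots> = Jl \<theta>1 (\<lambda>w. g w * l (K w u) * (exp z / (exp z - exp w))) - l (K z u)
      * Jl \<theta>1 (\<lambda>w. g w * (exp w / (exp z - exp w)))"
    unfolding Jl_cmult[symmetric] by (rule Jl_add(2)) (rule gi' integrable_mult_right[OF gi], assumption)+
  also have "Jl \<theta>1 (\<lambda>w. g w * (exp w / (exp z - exp w))) = 0"
    by (rule Jl_cauchy_out[OF symb_holomorphic[OF g] symb_decay[OF g]]) (use theta z in \<open>auto simp: reg_def\<close>)
  finally show ?thesis by simp
qed

text \<open>The factor \<open>g\<close> is integrated over the narrower contour, so that
  \<open>K_PHI\<close> applies at every point of the contour of \<open>f\<close>. What remains of
  the two resolvents is one resolvent and a scalar kernel, and \<open>Jl_Jl_kernel\<close> evaluates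
  the kernel integral to \<open>f\<close>.\<close>

theorem PHI_mult:
  assumes f: "symb \<mu> f" and g: "symb \<mu> g" shows "PHI f (PHI g u) = PHI (\<lambda>z. f z * g z) u"
proof (rule PHI_eqI[OF symb_mult[OF f g]])
  fix l assume l: "l \<in> clf"
  have "l (PHI f (PHI g u)) = Jl \<theta> (\<lambda>z. f z * l (K z (PHI g u)))" by (rule PHI_weak[OF f l])
  also have "\<dots> = Jl \<theta> (\<lambda>z. f z * Jl \<theta>1 (\<lambda>w. g w * l (K w u) * (exp z / (exp z - exp w))))"
    by (rule Jl_cong, subst K_PHI[OF g l]) (use theta in \<open>auto intro!: line_reg\<close>)
  also have "\<dots> = Jl \<theta>1 (\<lambda>w. f w * (g w * l (K w u)))"
    by (rule Jl_Jl_kernel[OF symb_holomorphic[OF f] symb_decay[OF f]])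
      (use theta in \<open>auto intro!: gK_integrable g l\<close>)
  also have "\<dots> = Jl \<theta> (\<lambda>z. (f z * g z) * l (K z u))"
    unfolding Jl_gK_shift[OF symb_mult[OF f g] l] by (simp add: mult.assoc)
  finally show "l (PHI f (PHI g u)) = Jl \<theta> (\<lambda>z. f z * g z * l (K z u))" .
qed

section \<open>The regularizing operator and its symbol\<close>

definition A :: "'h \<Rightarrow> 'h" where "A u = T (Qs rm D T qii u)"

text \<open>The scalars in front undo the factor \<open>exp \<zeta>\<close> of \<open>K\<close>, so
  the two terms are the resolvents at i and -i. Their \<open>Q\<close> parts cancel because
  \<open>Q\<close> is the same at both points, and \<open>A\<close> is left twice with a minus
  sign.\<close>

lemma A_eq: "A u = (- 1 / 2) *\<^sub>R (csc (- \<i>) (K (\<i> * of_real (pi / 2)) u) + csc \<i> (K (- \<i> * of_real (pi / 2)) u))"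
proof -
  have e: "exp (\<i> * of_real (pi / 2)) = \<i>" "exp (- \<i> * of_real (pi / 2)) = - \<i>"
    by (simp_all add: complex_eq_iff Re_exp Im_exp)
  have q: "Q (- \<i>) = Q \<i>" using Q_cnj[of \<i>] by simp
  have t: "T (Q \<i> u) = A u" by (simp add: A_def Q_def emb_i)
  have 1: "csc (- \<i>) (K (\<i> * of_real (pi / 2)) u) = csc (- \<i>) (Q \<i> u) - A u"
    unfolding K_def e R_def t by (simp add: sc_sc)
  have 2: "csc \<i> (K (- \<i> * of_real (pi / 2)) u) = csc \<i> (Q \<i> u) - A u"
    unfolding K_def e R_def q t by (simp add: sc_sc)
  have "csc (- \<i>) (Q \<i> u) - A u + (csc \<i> (Q \<i> u) - A u) = (- 2) *\<^sub>R A u"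
    by (simp add: sc_minus_left scaleR_2)
  then show ?thesis unfolding 1 2 by simp
qed

lemma half_pi_reg: "\<i> * of_real (pi / 2) \<in> reg" "- \<i> * of_real (pi / 2) \<in> reg"
  using theta by (auto simp: reg_def)

lemma A_bounded_linear: "bounded_linear A"
proof -
  have K: "bounded_linear (K \<zeta>)" if "\<zeta> \<in> reg" for \<zeta>
    using that CK by (intro bounded_linear_intro[where K=CK]) (auto simp: K_add K_scaleR mult.commute)
  have s: "bounded_linear (\<lambda>x. csc c x)" for c
      by (rule bounded_bilinear.bounded_linear_right[OF bounded_bilinear_sc])
  have "bounded_linear (\<lambda>u. (- 1 / 2) *\<^sub>R (csc (- \<i>) (K (\<i> * of_real (pi / 2)) u)
      + csc \<i> (K (- \<i> * of_real (pi / 2)) u)))"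
    by (intro bounded_linear_compose[OF bounded_linear_scaleR_right] bounded_linear_add
      bounded_linear_compose[OF s] K half_pi_reg)
  moreover have "A = (\<lambda>u. (- 1 / 2) *\<^sub>R (csc (- \<i>) (K (\<i> * of_real (pi / 2)) u)
      + csc \<i> (K (- \<i> * of_real (pi / 2)) u)))"
    by (rule ext, rule A_eq)
  ultimately show ?thesis by (simp only:)
qed

lemma PHI_A: assumes g: "symb \<mu> g" shows "PHI g (A u) = A (PHI g u)"
  unfolding A_eq PHI_scaleR[OF g] PHI_add[OF g] PHI_sc[OF g] PHI_K[OF g half_pi_reg(1)] PHI_K[OF g half_pi_reg(2)]
      ..

text \<open>By \<open>A_eq\<close> and \<open>K_PHI\<close>, \<open>A\<close> acts on
  \<open>PHI g u\<close> through the scalar kernels with poles at i and -i; their combination is the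
  partial fraction expansion of \<open>p0\<close>.\<close>

lemma A_PHI: assumes g: "symb \<mu> g" shows "A (PHI g u) = PHI (\<lambda>z. p0 z * g z) u"
proof (rule PHI_eqI)
  show pg: "symb \<mu> (\<lambda>z. p0 z * g z)" using theta by (intro symb_mult p0_symb g) auto
  fix l assume l: "l \<in> clf"
  interpret l: bounded_linear l using l by (rule clfD)
  have e: "exp (\<i> * of_real (pi / 2)) = \<i>" "exp (- \<i> * of_real (pi / 2)) = - \<i>"
    by (simp_all add: complex_eq_iff Re_exp Im_exp)
  let ?z = "\<i> * of_real (pi / 2)" and ?z' = "- \<i> * of_real (pi / 2)"
  have th: "\<theta>1 < \<bar>Im ?z\<bar>" "\<theta>1 < \<bar>Im ?z'\<bar>" using theta by auto
  let ?h = "\<lambda>c w. g w * l (K w u) * (c / (c - exp w))"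
  have ii: "integrable lborel (\<lambda>x. ?h c (Complex x y))" if "c = \<i> \<or> c = - \<i>" "y = \<theta>1 \<or> y = - \<theta>1" for c y
  proof -
    note cy0 = that(1)
    have cy: "cos y > 0" using that theta by (intro cos_gt_zero_pi) auto
    obtain M where M: "\<And>x. cmod (c / (c - exp (Complex x y))) \<le> M"
    proof -
      have "cmod (c / (c - exp (Complex x y))) \<le> 1 / \<bar>cos y\<bar>" for x
      proof -
        \<comment> \<open>Writing i and -i as exponentials of points at height pi/2 in absolute
          value makes \<open>exp_kernel_bound\<close> applicable; the sine of the height difference
          is \<open>cos y\<close> up to sign and nonzero on the contour.\<close>
        obtain d where d: "d = ?z \<or> d = ?z'" "c = exp d" using cy0 e by metis
        have "Im (Complex x y - d) = y - pi / 2 \<or> Im (Complex x y - d) = y + pi / 2"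
          using d(1) by (elim disjE; hypsubst; simp)
        moreover have "sin (y - pi / 2) = - cos y" "sin (y + pi / 2) = cos y" by (simp_all add: sin_diff sin_add)
        ultimately have *: "\<bar>sin (Im (Complex x y - d))\<bar> = \<bar>cos y\<bar>" by (metis abs_minus_cancel)
        have "sin (Im (Complex x y - d)) \<noteq> 0" using * cy by auto
        from exp_kernel_bound[OF this] show ?thesis unfolding d(2) exp_kernel_eq * .
      qed
      then show thesis by (rule that)
    qed
    have m: "(\<lambda>x. exp (Complex x y)) \<in> borel_measurable lborel"
      using borel_measurable_continuous_onI[OF continuous_on_exp[OF continuous_on_Complex_line]] by simp
    have gk: "integrable lborel (\<lambda>x. g (Complex x y) * l (K (Complex x y) u))" using that
        by (intro gK_integrable g l) auto
    show ?thesis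
    proof (rule Bochner_Integration.integrable_bound[OF
        integrable_mult_right[OF integrable_norm[OF gk], of "\<bar>M\<bar>"]])
      show "(\<lambda>x. ?h c (Complex x y)) \<in> borel_measurable lborel" using m borel_measurable_integrable[OF gk]
          by measurable
      show "AE x in lborel. norm (?h c (Complex x y)) \<le> norm
          (\<bar>M\<bar> * norm (g (Complex x y) * l (K (Complex x y) u)))"
      proof (rule AE_I2)
        fix x
        have "norm (?h c (Complex x y)) \<le> norm (g (Complex x y) * l (K (Complex x y) u)) * \<bar>M\<bar>"
          by (subst norm_mult, rule mult_left_mono) (use M[of x] in auto)
        then show "norm (?h c (Complex x y)) \<le> norm (\<bar>M\<bar> * norm (g (Complex x y) * l (K (Complex x y) u)))"
            by (simp add: mult_ac abs_mult)
      qed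
    qed
  qed
  have ne: "\<i> - exp w \<noteq> 0" "- \<i> - exp w \<noteq> 0" "1 + exp w * exp w \<noteq> 0" if "\<bar>Im w\<bar> < pi / 2" for w
  proof -
    have "exp ?z \<noteq> exp w"
    proof
      assume "exp ?z = exp w"
      then have "?z = w" by (rule exp_eq_strip) (use that in auto)
      from arg_cong[OF this, of Im] show False using that by simp
    qed
    then show 1: "\<i> - exp w \<noteq> 0" unfolding e by simp
    have "exp ?z' \<noteq> exp w"
    proof
      assume "exp ?z' = exp w"
      then have "?z' = w" by (rule exp_eq_strip) (use that in auto)
      from arg_cong[OF this, of Im] show False using that by simp
    qed
    then show 2: "- \<i> - exp w \<noteq> 0" unfolding e by simp
    have "1 + exp w * exp w = (\<i> - exp w) * (- \<i> - exp w)" by (simp add: algebra_simps)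
    then show "1 + exp w * exp w \<noteq> 0" using 1 2 by simp
  qed
  have "l (A (PHI g u)) = (- 1 / 2) * (- \<i> * Jl \<theta>1 (?h \<i>) + \<i> * Jl \<theta>1 (?h (- \<i>)))"
    unfolding A_eq l.scaleR l.add clfD(2)[OF l] K_PHI[OF g l half_pi_reg(1) th(1)]
        K_PHI[OF g l half_pi_reg(2) th(2)] e
    by (simp add: scaleR_conv_of_real)
  also have "\<dots> = Jl \<theta>1 (\<lambda>w. (\<i> / 2) * ?h \<i> w - (\<i> / 2) * ?h (- \<i>) w)"
  proof -
    have "Jl \<theta>1 (\<lambda>w. (\<i> / 2) * ?h \<i> w - (\<i> / 2) * ?h (- \<i>) w) = (\<i> / 2) * Jl \<theta>1 (?h \<i>) - (\<i> / 2)
        * Jl \<theta>1 (?h (- \<i>))"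
      unfolding Jl_cmult[symmetric] by (rule Jl_add(2)) (rule integrable_mult_right[OF ii], simp, assumption)+
    moreover have "(- 1 / 2) * (- \<i> * a + \<i> * b) = (\<i> / 2) * a - (\<i> / 2) * b" for a b :: complex
      by (simp add: algebra_simps)
    ultimately show ?thesis by (simp only:)
  qed
  also have "\<dots> = Jl \<theta>1 (\<lambda>w. (p0 w * g w) * l (K w u))"
  proof (rule Jl_cong)
    fix x y assume y: "y = \<theta>1 \<or> y = - \<theta>1"
    let ?w = "Complex x y"
    have w: "\<bar>Im ?w\<bar> < pi / 2" using y theta by auto
    \<comment> \<open>Partial fractions of \<open>a / (1 + a * a)\<close> at its two poles.\<close>
    have id: "(\<i> / 2) * (\<i> / (\<i> - a)) - (\<i> / 2) * (- \<i> / (- \<i> - a)) = a / (1 + a * a)"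
      if "\<i> - a \<noteq> 0" "- \<i> - a \<noteq> 0" "1 + a * a \<noteq> 0" for a
    proof -
      have "1 + a * a = (\<i> - a) * (- \<i> - a)" by (simp add: algebra_simps)
      then show ?thesis using that by (simp add: divide_simps) (simp add: algebra_simps)
    qed
    have "(\<i> / 2) * ?h \<i> ?w - (\<i> / 2) * ?h (- \<i>) ?w = (g ?w * l (K ?w u))
        * ((\<i> / 2) * (\<i> / (\<i> - exp ?w)) - (\<i> / 2) * (- \<i> / (- \<i> - exp ?w)))"
      by (simp only: right_diff_distrib mult_ac)
    then show "(\<i> / 2) * ?h \<i> ?w - (\<i> / 2) * ?h (- \<i>) ?w = (p0 ?w * g ?w) * l (K ?w u)"
      unfolding id[OF ne[OF w]] p0_def by (simp only: mult_ac)
  qed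
  also have "\<dots> = Jl \<theta> (\<lambda>w. (p0 w * g w) * l (K w u))" by (rule Jl_gK_shift[OF pg l, symmetric])
  finally show "l (A (PHI g u)) = Jl \<theta> (\<lambda>z. p0 z * g z * l (K z u))" .
qed

lemma A_pow_PHI: assumes g: "symb \<mu> g" shows "symb \<mu> (\<lambda>z. p0 z ^ k * g z)"
    "(A ^^ k) (PHI g u) = PHI (\<lambda>z. p0 z ^ k * g z) u"
  "PHI g ((A ^^ k) u) = (A ^^ k) (PHI g u)"
proof -
  have "symb \<mu> (\<lambda>z. p0 z ^ k * g z) \<and> (A ^^ k) (PHI g u) = PHI (\<lambda>z. p0 z ^ k * g z) u"
  proof (induction k)
    case (Suc k)
    then show ?case using theta A_PHI[of "\<lambda>z. p0 z ^ k * g z" u] symb_mult[OF p0_symb, of \<mu> "\<lambda>z. p0 z ^ k * g z"]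
        by (simp add: mult.assoc)
  qed (use g in simp)
  then show "symb \<mu> (\<lambda>z. p0 z ^ k * g z)" "(A ^^ k) (PHI g u) = PHI (\<lambda>z. p0 z ^ k * g z) u" by auto
  show "PHI g ((A ^^ k) u) = (A ^^ k) (PHI g u)" by (induction k) (simp_all add: PHI_A[OF g])
qed

end

section \<open>Components of slice hyperholomorphic functions\<close>

text \<open>The symmetrisation in \<open>Fc p f\<close> makes it the \<open>p\<close>-th component in
  \<open>f = f\<^sub>0 + f\<^sub>1 i + f\<^sub>2 j + f\<^sub>3 k\<close> with intrinsic \<open>f\<^sub>p\<close> (see \<open>Fc_decomp\<close> and \<open>Fc_cnj\<close>).\<close>

definition cmpA :: "(quat \<Rightarrow> real) \<Rightarrow> quat \<Rightarrow> complex" where "cmpA p q = Complex (p q) (p (- (qii * q))) / 2"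
definition cmpB :: "(quat \<Rightarrow> real) \<Rightarrow> quat \<Rightarrow> complex" where "cmpB p q = Complex (p q) (p (qii * q)) / 2"
definition Fc :: "(quat \<Rightarrow> real) \<Rightarrow> (quat \<Rightarrow> quat) \<Rightarrow> complex \<Rightarrow> complex" where
  "Fc p f z = cmpA p (f (emb z)) + cmpB p (f (emb (cnj z)))"

abbreviation "qjj \<equiv> Quat 0 0 1 0"
abbreviation "qkk \<equiv> Quat 0 0 0 1"
abbreviation "coords \<equiv> {qRe, qI, qJ, qK}"

lemma coords_linear: "p \<in> coords \<Longrightarrow> bounded_linear p" and coords_le: "p \<in> coords \<Longrightarrow> \<bar>p q\<bar> \<le> norm q"
  using bounded_linear_qRe bounded_linear_qI bounded_linear_qJ bounded_linear_qK abs_qRe_le abs_qI_le abs_qJ_le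
      abs_qK_le by auto

lemma Fc_decomp: "f (emb z) = emb (Fc qRe f z) + emb (Fc qI f z) * qii + emb (Fc qJ f z) * qjj + emb (Fc qK f z)
    * qkk"
  by (simp add: quat_eq_iff Fc_def cmpA_def cmpB_def field_simps)

lemma Fc_cnj: assumes "p \<in> coords" shows "Fc p f (cnj z) = cnj (Fc p f z)"
proof -
  interpret p: bounded_linear p by (rule coords_linear[OF assms])
  have pm: "p (- q) = - p q" for q using p.scaleR[of "- 1" q] by simp
  show ?thesis by (simp add: Fc_def cmpA_def cmpB_def complex_eq_iff pm)
qed

lemma norm_cmp_le: assumes "p \<in> coords" shows "cmod (cmpA p q) \<le> norm q" "cmod (cmpB p q) \<le> norm q"
proof -
  have n: "norm (qii * q) = norm q" by (simp add: norm_mult norm_quat_def[of qii])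
  have 1: "\<bar>p q\<bar> \<le> norm q" "\<bar>p (- (qii * q))\<bar> \<le> norm q" "\<bar>p (qii * q)\<bar> \<le> norm q"
    using coords_le[OF assms, of q] coords_le[OF assms, of "- (qii * q)"] coords_le[OF assms, of "qii * q"] n
        by simp_all
  have "cmod (Complex a b / 2) \<le> norm q" if "\<bar>a\<bar> \<le> norm q" "\<bar>b\<bar> \<le> norm q" for a b
    using cmod_le[of "Complex a b"] that by (simp add: norm_divide)
  then show "cmod (cmpA p q) \<le> norm q" "cmod (cmpB p q) \<le> norm q" using 1 by (simp_all add: cmpA_def cmpB_def)
qed

lemma norm_Fc_le: "p \<in> coords \<Longrightarrow> cmod (Fc p f z) \<le> norm (f (emb z)) + norm (f (emb (cnj z)))"
  unfolding Fc_def by (rule order_trans[OF norm_triangle_ineq]) (intro add_mono norm_cmp_le)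

lemma cmp_linear: assumes "p \<in> coords"
  shows "bounded_linear (cmpA p)" "bounded_linear (cmpB p)" "cmpA p (emb c * q) = c * cmpA p q"
      "cmpB p (emb c * q) = cnj c * cmpB p q"
proof -
  interpret p: bounded_linear p by (rule coords_linear[OF assms])
  have pm: "p (- q) = - p q" for q using p.scaleR[of "- 1" q] by simp
  show "bounded_linear (cmpA p)"
    by (rule bounded_linear_intro[where K=1])
      (use norm_cmp_le[OF assms] in \<open>auto simp: cmpA_def complex_eq_iff p.add p.scaleR pm p.diff distrib_left
          add_divide_distrib\<close>)
  show "bounded_linear (cmpB p)"
    by (rule bounded_linear_intro[where K=1])
      (use norm_cmp_le[OF assms] in \<open>auto simp: cmpB_def complex_eq_iff p.add p.scaleR pm distrib_left
          add_divide_distrib\<close>)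
  have e: "emb c * q = Re c *\<^sub>R q + Im c *\<^sub>R (qii * q)" and qq: "qii * (qii * q) = - q"
    by (simp_all add: quat_eq_iff algebra_simps)
  show "cmpA p (emb c * q) = c * cmpA p q"
    unfolding cmpA_def e by (simp add: complex_eq_iff distrib_left qq p.add p.scaleR pm p.diff)
  show "cmpB p (emb c * q) = cnj c * cmpB p q"
    unfolding cmpB_def e by (simp add: complex_eq_iff distrib_left qq p.add p.scaleR pm p.diff)
qed

lemma Fc_mult: assumes "p \<in> coords" "g (emb z) = emb c" "g (emb (cnj z)) = emb (cnj c)"
  shows "Fc p (\<lambda>s. g s * f s) z = c * Fc p f z"
  by (simp add: Fc_def assms(2,3) cmp_linear(3,4)[OF assms(1)] distrib_left)

text \<open>The slice Cauchy-Riemann equation says that the real derivative \<open>L\<close>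
  satisfies \<open>L qii = qii * L 1\<close>. Real linearity extends this to the whole slice, so
  along the slice \<open>L\<close> is right multiplication of the increment by
  \<open>L 1\<close>.\<close>

lemma slice_derivative:
  assumes f: "left_slice_hol U f" and z: "emb z \<in> U"
  obtains L where "(f has_derivative L) (at (emb z))" "\<And>h. L (emb h) = emb h * L 1"
proof -
  obtain L where L: "(f has_derivative L) (at (emb z))" using f z unfolding left_slice_hol_def differentiable_def
      by blast
  interpret L: bounded_linear L using L by (rule has_derivative_bounded_linear)
  have ez: "emb z = of_real (Re z) + qii * of_real (Im z)" by (simp add: quat_eq_iff)
  then obtain D1 D2 where D: "((\<lambda>t. f (of_real t + qii * of_real (Im z))) has_vector_derivative D1) (at (Re z))"
    "((\<lambda>t. f (of_real (Re z) + qii * of_real t)) has_vector_derivative D2) (at (Im z))"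
        "(1/2) *\<^sub>R (D1 + qii * D2) = 0"
    using f z unfolding left_slice_hol_def by (metis qii_imag_units)
  have o: "bounded_linear (of_real :: real \<Rightarrow> quat)" by (rule bounded_linear_of_real)
  have "((\<lambda>t. of_real t + qii * of_real (Im z)) has_derivative (\<lambda>t. of_real t + 0)) (at (Re z))"
    by (intro has_derivative_add has_derivative_const bounded_linear.has_derivative[OF o] has_derivative_ident)
  from has_derivative_compose[OF this, of f L] L
  have "((\<lambda>t. f (of_real t + qii * of_real (Im z))) has_derivative (\<lambda>t. L (of_real t + 0))) (at (Re z))"
      by (simp add: ez)
  moreover have "(\<lambda>t. L (of_real t + 0)) = (\<lambda>t. t *\<^sub>R L 1)" by (simp add: of_real_def L.scaleR)
  ultimately have "((\<lambda>t. f (of_real t + qii * of_real (Im z))) has_vector_derivative L 1) (at (Re z))"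
      by (simp add: has_vector_derivative_def)
  then have D1: "D1 = L 1" using D(1) vector_derivative_unique_at by blast
  have "((\<lambda>t. of_real (Re z) + qii * of_real t) has_derivative (\<lambda>t. 0 + qii * of_real t)) (at (Im z))"
    by (intro has_derivative_add has_derivative_const has_derivative_mult_right bounded_linear.has_derivative[OF o]
      has_derivative_ident)
  from has_derivative_compose[OF this, of f L] L
  have "((\<lambda>t. f (of_real (Re z) + qii * of_real t)) has_derivative (\<lambda>t. L (0 + qii * of_real t))) (at (Im z))"
      by (simp add: ez)
  moreover have "(\<lambda>t. L (0 + qii * of_real t)) = (\<lambda>t. t *\<^sub>R L qii)" by (simp add: of_real_def L.scaleR)
  ultimately have "((\<lambda>t. f (of_real (Re z) + qii * of_real t)) has_vector_derivative L qii) (at (Im z))"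
      by (simp add: has_vector_derivative_def)
  then have D2: "D2 = L qii" using D(2) vector_derivative_unique_at by blast
  have "L 1 + qii * L qii = 0" using D(3) D1 D2 by simp
  then have "qii * L 1 + qii * (qii * L qii) = 0" by (metis distrib_left mult_zero_right)
  moreover have "qii * (qii * q) = - q" for q by (simp add: quat_eq_iff)
  ultimately have "L qii = qii * L 1" by simp
  moreover have "emb h = Re h *\<^sub>R 1 + Im h *\<^sub>R qii" for h by (simp add: quat_eq_iff)
  ultimately have "L (emb h) = emb h * L 1" for h by (simp add: L.add L.scaleR distrib_right)
  with L show ?thesis by (rule that)
qed

text \<open>\<open>cmpA\<close> is complex linear and \<open>cmpB\<close> conjugate linear for left
  multiplication by the slice. Since the second term is evaluated at \<open>cnj z\<close>, the two
  conjugations cancel and the derivative is multiplication by one complex number.\<close>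

lemma Fc_holomorphic:
  assumes f: "left_slice_hol U f" and z: "emb z \<in> U" "emb (cnj z) \<in> U" and p: "p \<in> coords"
  shows "Fc p f field_differentiable at z"
proof -
  obtain L where L: "(f has_derivative L) (at (emb z))" "\<And>h. L (emb h) = emb h * L 1"
      using slice_derivative[OF f z(1)] by blast
  obtain M where M: "(f has_derivative M) (at (emb (cnj z)))" "\<And>h. M (emb h) = emb h * M 1"
      using slice_derivative[OF f z(2)] by blast
  have "((\<lambda>z. cmpA p (f (emb z))) has_derivative (\<lambda>h. cmpA p (L (emb h)))) (at z)"
    by (intro bounded_linear.has_derivative[OF cmp_linear(1)[OF p]]
      has_derivative_compose[OF bounded_linear_imp_has_derivative[OF bounded_linear_emb]] L)
  moreover have "((\<lambda>z. cmpB p (f (emb (cnj z)))) has_derivative (\<lambda>h. cmpB p (M (emb (cnj h))))) (at z)"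
    by (intro bounded_linear.has_derivative[OF cmp_linear(2)[OF p]]
        has_derivative_compose[OF bounded_linear_imp_has_derivative[OF
            bounded_linear_compose[OF bounded_linear_emb bounded_linear_cnj]]] M)
  ultimately have "(Fc p f has_derivative (\<lambda>h. cmpA p (L (emb h)) + cmpB p (M (emb (cnj h))))) (at z)"
    unfolding Fc_def[abs_def] by (rule has_derivative_add)
  also have "(\<lambda>h. cmpA p (L (emb h)) + cmpB p (M (emb (cnj h)))) = (\<lambda>h. (cmpA p (L 1) + cmpB p (M 1)) * h)"
    by (simp add: L(2) M(2) cmp_linear[OF p] algebra_simps)
  finally show ?thesis unfolding field_differentiable_def has_field_derivative_def by blast
qed

lemma Fc_exp_holomorphic:
  assumes f: "left_slice_hol (qsector0 \<mu>) f" and m: "\<mu> \<le> pi" and p: "p \<in> coords"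
  shows "(\<lambda>\<zeta>. Fc p f (exp \<zeta>)) holomorphic_on strip (- \<mu>) \<mu>"
proof -
  have "(\<lambda>\<zeta>. Fc p f (exp \<zeta>)) field_differentiable at \<zeta>" if "\<zeta> \<in> strip (- \<mu>) \<mu>" for \<zeta>
  proof -
    have "emb (exp \<zeta>) \<in> qsector0 \<mu>" "emb (cnj (exp \<zeta>)) \<in> qsector0 \<mu>"
      using that m emb_exp_sector0[of \<zeta> \<mu>] emb_exp_sector0[of "cnj \<zeta>" \<mu>] by (auto simp: strip_def exp_cnj)
    then have "Fc p f field_differentiable at (exp \<zeta>)" by (rule Fc_holomorphic[OF f _ _ p])
    moreover have "exp field_differentiable at \<zeta>" using DERIV_exp field_differentiable_def by blast
    ultimately have "(Fc p f \<circ> exp) field_differentiable at \<zeta>" by (rule field_differentiable_compose[rotated])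
    then show ?thesis by (simp add: o_def)
  qed
  then show ?thesis by (simp add: holomorphic_on_def field_differentiable_at_within)
qed

context sect_op
begin

section \<open>The S-functional calculus in terms of the scalar calculus\<close>

definition Bq :: "complex \<Rightarrow> complex \<Rightarrow> 'h \<Rightarrow> 'h" where
  "Bq s a v = Q s (lm (emb (cnj s * a)) v) - T (Q s (lm (emb a) v))"

text \<open>One component of the \<open>SFC\<close> integrand on the ray of angle \<open>y\<close>,
  in the variable \<open>x = ln r\<close>; the factor \<open>exp x\<close> is the Jacobian, and
  \<open>Bq s a v\<close> is \<open>SLinv\<close> at \<open>emb s\<close> applied to
  \<open>lm (emb a) v\<close> (see \<open>SLinv_Vc\<close>).\<close>

definition Vc :: "real \<Rightarrow> (complex \<Rightarrow> complex) \<Rightarrow> 'h \<Rightarrow> real \<Rightarrow> 'h" where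
  "Vc y F v x = exp x *\<^sub>R Bq (exp (Complex x y)) (- \<i> * cis y * F (Complex x y)) v"

lemma lmul_emb: "lm (emb c) v = Re c *\<^sub>R v + Im c *\<^sub>R lm qii v"
proof -
  have "emb c = of_real (Re c) + Im c *\<^sub>R qii" by (simp add: quat_eq_iff)
  then show ?thesis by (simp only: lmul_add_left lmul_of_real lmul_scaleR_left)
qed

lemma exp_Complex: "exp (Complex x y) = of_real (exp x) * cis y"
  by (simp add: complex_eq_iff Re_exp Im_exp)

lemma Q_lm_emb: assumes "emb z \<notin> qsector \<omega>" shows "Q z (lm (emb c) v) = Re c *\<^sub>R Q z v + Im c *\<^sub>R Q z (lm qii v)"
  unfolding lmul_emb by (simp add: Q_add Q_scaleR assms)

text \<open>The two resolvents at conjugate points give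
  \<open>R s u - R (cnj s) u = csc (cnj s - s) (Q s u)\<close>. Off the real axis this can be solved
  for \<open>Q\<close>, which inherits continuity from \<open>R\<close>.\<close>

lemma Q_line_continuous: assumes y: "y = \<theta> \<or> y = - \<theta>"
  shows "continuous_on UNIV (\<lambda>x. Q (exp (Complex x y)) v)" "continuous_on UNIV (\<lambda>x. T (Q (exp (Complex x y)) v))"
proof -
  have y': "- y = \<theta> \<or> - y = - \<theta>" using y by auto
  have R: "continuous_on UNIV (\<lambda>x. R (exp (Complex x y)) v)" if "y = \<theta> \<or> y = - \<theta>" for y
    by (rule continuous_on_compose2[OF R_continuous continuous_on_Complex_line])
      (use that in \<open>auto intro!: line_reg\<close>)
  have e: "continuous_on UNIV (\<lambda>x. exp (Complex x y))" for y
      by (rule continuous_on_exp[OF continuous_on_Complex_line])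
  have sy: "sin y \<noteq> 0"
  proof -
    have "sin \<theta> > 0" using theta by (intro sin_gt_zero) auto
    then show ?thesis using y by auto
  qed
  have c: "cnj (exp (Complex x y)) = exp (Complex x (- y))" for x by (simp add: exp_cnj complex_cnj)
  have nz: "exp (Complex x (- y)) - exp (Complex x y) \<noteq> 0" for x
    using sy by (auto simp: complex_eq_iff Im_exp)
  have Qe: "Q (exp (Complex x y)) v = csc (1 / (exp (Complex x (- y)) - exp (Complex x y)))
      (R (exp (Complex x y)) v - R (exp (Complex x (- y))) v)" for x
  proof -
    have "R (exp (Complex x y)) v - R (exp (Complex x (- y))) v
        = csc (exp (Complex x (- y)) - exp (Complex x y)) (Q (exp (Complex x y)) v)"
      unfolding R_def c[symmetric] Q_cnj by (simp add: sc_diff_left)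
    then show ?thesis using nz[of x] by (simp add: sc_sc)
  qed
  have "continuous_on UNIV (\<lambda>x. 1 / (exp (Complex x (- y)) - exp (Complex x y)))"
    using nz by (intro continuous_on_divide continuous_on_diff continuous_on_const e) auto
  then show 1: "continuous_on UNIV (\<lambda>x. Q (exp (Complex x y)) v)"
    unfolding Qe by (rule bounded_bilinear.continuous_on[OF bounded_bilinear_sc _
        continuous_on_diff[OF R[OF y] R[OF y']]])
  have Te: "T (Q (exp (Complex x y)) v) = csc (exp (Complex x (- y))) (Q (exp (Complex x y)) v)
      - R (exp (Complex x y)) v" for x
    unfolding R_def c by simp
  show "continuous_on UNIV (\<lambda>x. T (Q (exp (Complex x y)) v))"
    unfolding Te by (rule continuous_on_diff[OF bounded_bilinear.continuous_on[OF bounded_bilinear_sc e 1]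
        R[OF y]])
qed

lemma line_off: "y = \<theta> \<or> y = - \<theta> \<Longrightarrow> emb (exp (Complex x y)) \<notin> qsector \<omega>"
  by (auto intro!: reg_off line_reg)

lemma Vc_continuous: assumes F: "symb \<mu> F" and y: "y = \<theta> \<or> y = - \<theta>" shows "continuous_on UNIV (Vc y F v)"
proof -
  have Fc: "continuous_on UNIV (\<lambda>x. F (Complex x y))" by (rule symb_line_continuous[OF F])
      (use line_strip[of y] y in auto)
  have e: "continuous_on UNIV (\<lambda>x. exp (Complex x y))" by (rule continuous_on_exp[OF continuous_on_Complex_line])
  let ?a = "\<lambda>x. - \<i> * cis y * F (Complex x y)"
      and ?b = "\<lambda>x. cnj (exp (Complex x y)) * (- \<i> * cis y * F (Complex x y))"
  have a: "continuous_on UNIV ?a" and b: "continuous_on UNIV ?b"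
      by (intro continuous_on_mult continuous_on_const Fc continuous_on_cnj e)+
  have eq: "Vc y F v x = exp x *\<^sub>R
      ((Re (?b x) *\<^sub>R Q (exp (Complex x y)) v + Im (?b x) *\<^sub>R Q (exp (Complex x y)) (lm qii v))
    - (Re (?a x) *\<^sub>R T (Q (exp (Complex x y)) v) + Im (?a x) *\<^sub>R T (Q (exp (Complex x y)) (lm qii v))))" for x
    unfolding Vc_def Bq_def Q_lm_emb[OF line_off[OF y]]
        by (simp only: T_add T_scaleR D_scaleR Q_D[OF line_off[OF y]])
  show ?thesis unfolding eq
    by (intro continuous_on_scaleR continuous_on_exp continuous_on_id continuous_on_diff continuous_on_add
        continuous_on_Re continuous_on_Im a b Q_line_continuous y)
qed

lemma Vc_decay: assumes F: "symb \<mu> F" and y: "y = \<theta> \<or> y = - \<theta>"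
  obtains c \<alpha> where "\<alpha> > 0" "\<And>x. norm (Vc y F v x) \<le> c * exp (- \<alpha> * \<bar>x\<bar>)"
proof -
  from F obtain c \<alpha> where *: "\<alpha> > 0" "\<And>z. z \<in> strip (- \<mu>) \<mu> \<Longrightarrow> cmod (F z) \<le> c * exp (- \<alpha> * \<bar>Re z\<bar>)"
    unfolding symb_def by auto
  obtain C where C: "C > 0" "\<And>\<zeta> u. \<zeta> \<in> reg \<Longrightarrow> norm (Q (exp \<zeta>) u) \<le> C / (cmod (exp \<zeta>))\<^sup>2 * norm u"
    "\<And>\<zeta> u. \<zeta> \<in> reg \<Longrightarrow> norm (T (Q (exp \<zeta>) u)) \<le> C / cmod (exp \<zeta>) * norm u"
    using QT_bound by auto
  have "norm (Vc y F v x) \<le> (2 * C * norm v * c) * exp (- \<alpha> * \<bar>x\<bar>)" for x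
  proof -
    let ?\<zeta> = "Complex x y" and ?a = "- \<i> * cis y * F (Complex x y)"
    have r: "?\<zeta> \<in> reg" using y by (intro line_reg) auto
    have e: "cmod (exp ?\<zeta>) = exp x" by simp
    have a: "cmod ?a = cmod (F ?\<zeta>)" by (simp add: norm_mult)
    have "norm (Vc y F v x) \<le> exp x
        * (norm (Q (exp ?\<zeta>) (lm (emb (cnj (exp ?\<zeta>) * ?a)) v)) + norm (T (Q (exp ?\<zeta>) (lm (emb ?a) v))))"
      unfolding Vc_def Bq_def by (simp add: norm_triangle_ineq4)
    also have "\<dots> \<le> exp x * (C / (exp x)\<^sup>2 * (exp x * cmod (F ?\<zeta>) * norm v) + C / exp x * (cmod (F ?\<zeta>) * norm v))"
      using C(2)[OF r, of "lm (emb (cnj (exp ?\<zeta>) * ?a)) v"] C(3)[OF r, of "lm (emb ?a) v"]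
      unfolding norm_lmul norm_emb norm_mult[of "cnj (exp ?\<zeta>)"] a e complex_mod_cnj
          by (intro mult_left_mono add_mono) auto
    also have "\<dots> = 2 * C * norm v * cmod (F ?\<zeta>)" by (simp add: power2_eq_square field_simps)
    also have "\<dots> \<le> 2 * C * norm v * (c * exp (- \<alpha> * \<bar>x\<bar>))"
      using *(2)[of ?\<zeta>] C(1) line_strip[of y] y by (intro mult_left_mono) (auto simp: strip_def)
    finally show ?thesis by (simp only: mult.assoc)
  qed
  then show ?thesis using *(1) by (rule_tac that) auto
qed

text \<open>Symmetry of \<open>F\<close> makes the coefficients on the two rays conjugate up to
  sign. In the difference the terms with \<open>lm qii v\<close> cancel and real multiples of
  \<open>Q s v\<close> and \<open>T (Q s v)\<close> remain. Such multiples can be reassembled with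
  scalars acting from the right, which gives the integrand of \<open>PHI\<close>.\<close>

lemma Vc_diff: assumes F: "\<And>z. F (cnj z) = cnj (F z)" shows "Vc (- \<theta>) F v x - Vc \<theta> F v x = Wg F v x"
proof -
  let ?s = "exp (Complex x (- \<theta>))" and ?a = "- \<i> * cis (- \<theta>) * F (Complex x (- \<theta>))"
  have c: "cnj (Complex x (- \<theta>)) = Complex x \<theta>" by (simp add: complex_eq_iff)
  have s: "exp (Complex x \<theta>) = cnj ?s" by (simp only: exp_cnj c)
  have a: "- \<i> * cis \<theta> * F (Complex x \<theta>) = - cnj ?a" unfolding F[of "Complex x (- \<theta>)", unfolded c]
      by (simp add: cis_cnj)
  have o: "emb ?s \<notin> qsector \<omega>" by (rule line_off) simp
  have pos: "Re (cnj w + w) = 2 * Re w" "Im (w + cnj w) = 0" for w by simp_all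
  have "Bq ?s ?a v - Bq (cnj ?s) (- cnj ?a) v = (2 * Re (cnj ?s * ?a)) *\<^sub>R Q ?s v - (2 * Re ?a) *\<^sub>R T (Q ?s v)"
  proof -
    have t: "T (r *\<^sub>R Q ?s u + t *\<^sub>R Q ?s w) = r *\<^sub>R T (Q ?s u) + t *\<^sub>R T (Q ?s w)" for r t u w
      by (simp only: T_add T_scaleR D_scaleR Q_D[OF o])
    have i: "Re (cnj (cnj ?s) * - cnj ?a) = - Re (cnj ?s * ?a)" "Im (cnj (cnj ?s) * - cnj ?a) = Im (cnj ?s * ?a)"
    proof -
      have "Re (cnj (cnj w) * - cnj a) = - Re (cnj w * a)" "Im (cnj (cnj w) * - cnj a) = Im (cnj w * a)" for w a
        by simp_all
      then show "Re (cnj (cnj ?s) * - cnj ?a) = - Re (cnj ?s * ?a)"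
          "Im (cnj (cnj ?s) * - cnj ?a) = Im (cnj ?s * ?a)" by blast+
    qed
    have j: "Re (- cnj ?a) = - Re ?a" "Im (- cnj ?a) = Im ?a" by simp_all
    show ?thesis unfolding Bq_def Q_cnj Q_lm_emb[OF o] t i j
      by (simp only: scaleR_minus_left) (simp only: mult_2 scaleR_add_left, simp)
  qed
  also have "\<dots> = csc ?a (R ?s v) + csc (cnj ?a) (R (cnj ?s) v)"
  proof -
    have 1: "csc ?a (csc (cnj ?s) w) + csc (cnj ?a) (csc ?s w) = (2 * Re (cnj ?s * ?a)) *\<^sub>R w" for w
    proof -
      have "?a * cnj ?s + cnj ?a * ?s = of_real (2 * Re (cnj ?s * ?a))"
        using complex_add_cnj[of "cnj ?s * ?a"] by (simp add: mult.commute)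
      then show ?thesis by (simp only: sc_sc sc_add_left[symmetric] sc_of_real)
    qed
    have 2: "csc ?a w + csc (cnj ?a) w = (2 * Re ?a) *\<^sub>R w" for w
      by (simp only: sc_add_left[symmetric] complex_add_cnj sc_of_real)
    have "csc ?a (R ?s v) + csc (cnj ?a) (R (cnj ?s) v)
        = (csc ?a (csc (cnj ?s) (Q ?s v)) + csc (cnj ?a) (csc ?s (Q ?s v))) -
        (csc ?a (T (Q ?s v)) + csc (cnj ?a) (T (Q ?s v)))"
      unfolding R_def Q_cnj by (simp add: sc_diff)
    then show ?thesis unfolding 1 2 ..
  qed
  finally have B: "Bq ?s ?a v - Bq (cnj ?s) (- cnj ?a) v = csc ?a (R ?s v) + csc (cnj ?a) (R (cnj ?s) v)" .
  have "Vc (- \<theta>) F v x - Vc \<theta> F v x = exp x *\<^sub>R (csc ?a (R ?s v) + csc (cnj ?a) (R (cnj ?s) v))"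
    unfolding Vc_def s a B[symmetric] by (simp add: scaleR_diff_right)
  also have "\<dots> = Wg F v x"
  proof -
    have 1: "exp x *\<^sub>R csc ?a w = csc (- \<i> * F (Complex x (- \<theta>))) (csc ?s w)" for w
      by (simp add: sc_sc exp_Complex sc_scaleR_left[symmetric] scaleR_conv_of_real mult_ac)
    have 2: "exp x *\<^sub>R csc (cnj ?a) w = csc (\<i> * F (Complex x \<theta>)) (csc (cnj ?s) w)" for w
      unfolding F[of "Complex x (- \<theta>)", unfolded c]
      by (simp add: sc_sc exp_Complex sc_scaleR_left[symmetric] scaleR_conv_of_real mult_ac cis_cnj)
    show ?thesis unfolding Wg_def K_def s scaleR_add_right 1 2 ..
  qed
  finally show ?thesis .
qed

lemma SLinv_Vc:
  assumes y: "y = \<theta> \<or> y = - \<theta>" 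
  shows "exp x *\<^sub>R SLinv rm ip N D T (emb (exp (Complex x y)))
      (lm ((- qii) * emb (cis y) * f (emb (exp (Complex x y)))) u) =
    Vc y (\<lambda>\<zeta>. Fc qRe f (exp \<zeta>)) u x + Vc y (\<lambda>\<zeta>. Fc qI f (exp \<zeta>)) (lm qii u) x
    + Vc y (\<lambda>\<zeta>. Fc qJ f (exp \<zeta>)) (lm qjj u) x + Vc y (\<lambda>\<zeta>. Fc qK f (exp \<zeta>)) (lm qkk u) x"
proof -
  let ?s = "exp (Complex x y)" and ?b = "- \<i> * cis y"
  note o = line_off[OF y, of x]
  have mi: "- qii = emb (- \<i>)" by (simp add: emb_minus emb_i)
  have l: "lm ((- qii) * emb (cis y) * f (emb ?s)) u =
    lm (emb (?b * Fc qRe f ?s)) u + lm (emb (?b * Fc qI f ?s)) (lm qii u) + lm (emb (?b * Fc qJ f ?s)) (lm qjj u) +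
        lm (emb (?b * Fc qK f ?s)) (lm qkk u)"
    by (subst Fc_decomp) (simp only: mi distrib_left mult.assoc[symmetric] emb_mult lmul_add_left lmul_lmul)
  have B: "SLinv rm ip N D T (emb ?s) (lm (emb a) v) = Bq ?s a v" for a v
    by (simp add: SLinv_emb Bq_def lmul_lmul emb_mult)
  have add: "SLinv rm ip N D T (emb ?s) (v + w) = SLinv rm ip N D T (emb ?s) v + SLinv rm ip N D T (emb ?s) w"
      for v w
    by (simp add: SLinv_emb lmul_add Q_add o T_add Q_D)
  show ?thesis unfolding l add B Vc_def by (simp add: scaleR_add_right)
qed

lemma SFC_PHI:
  assumes sy: "\<And>p. p \<in> coords \<Longrightarrow> symb \<mu> (\<lambda>\<zeta>. Fc p f (exp \<zeta>))"
  shows "SFC rm ip N \<omega> \<mu> D T f u = PHI (\<lambda>\<zeta>. Fc qRe f (exp \<zeta>)) u + PHI (\<lambda>\<zeta>. Fc qI f (exp \<zeta>)) (lm qii u)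
    + PHI (\<lambda>\<zeta>. Fc qJ f (exp \<zeta>)) (lm qjj u) + PHI (\<lambda>\<zeta>. Fc qK f (exp \<zeta>)) (lm qkk u)"
proof (rule clf_eqI)
  fix l assume l: "l \<in> clf"
  interpret l: bounded_linear l using l by (rule clfD)
  define V where "V y x = Vc y (\<lambda>\<zeta>. Fc qRe f (exp \<zeta>)) u x + Vc y (\<lambda>\<zeta>. Fc qI f (exp \<zeta>)) (lm qii u) x
    + Vc y (\<lambda>\<zeta>. Fc qJ f (exp \<zeta>)) (lm qjj u) x + Vc y (\<lambda>\<zeta>. Fc qK f (exp \<zeta>)) (lm qkk u) x" for y x
  note s1 = sy[of qRe, simplified] and s2 = sy[of qI, simplified] and s3 = sy[of qJ, simplified]
      and s4 = sy[of qK, simplified]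
  have w: "continuous_on UNIV (V y)" "\<exists>a>0. \<exists>c. \<forall>x. norm (V y x) \<le> c * exp (- a * \<bar>x\<bar>)" if y: "y = \<theta> \<or> y = - \<theta>"
      for y
  proof -
    show "continuous_on UNIV (V y)" unfolding V_def using y s1 s2 s3 s4
        by (intro continuous_on_add Vc_continuous) auto
    obtain a1 c1 where 1: "a1 > 0" "\<And>x. norm (Vc y (\<lambda>\<zeta>. Fc qRe f (exp \<zeta>)) u x) \<le> c1 * exp (- a1 * \<bar>x\<bar>)"
        using Vc_decay[OF s1 y] by blast
    obtain a2 c2 where 2: "a2 > 0" "\<And>x. norm (Vc y (\<lambda>\<zeta>. Fc qI f (exp \<zeta>)) (lm qii u) x) \<le> c2 * exp (- a2 * \<bar>x\<bar>)"
        using Vc_decay[OF s2 y] by blast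
    obtain a3 c3 where 3: "a3 > 0" "\<And>x. norm (Vc y (\<lambda>\<zeta>. Fc qJ f (exp \<zeta>)) (lm qjj u) x) \<le> c3 * exp (- a3 * \<bar>x\<bar>)"
        using Vc_decay[OF s3 y] by blast
    obtain a4 c4 where 4: "a4 > 0" "\<And>x. norm (Vc y (\<lambda>\<zeta>. Fc qK f (exp \<zeta>)) (lm qkk u) x) \<le> c4 * exp (- a4 * \<bar>x\<bar>)"
        using Vc_decay[OF s4 y] by blast
    \<comment> \<open>The four components decay with different exponents; the smallest one serves
      for their sum.\<close>
    define a where "a = min (min a1 a2) (min a3 a4)"
    have a: "a > 0" "a \<le> a1" "a \<le> a2" "a \<le> a3" "a \<le> a4" using 1 2 3 4 by (auto simp: a_def)
    have m: "c * exp (- b * \<bar>x\<bar>) \<le> \<bar>c\<bar> * exp (- a * \<bar>x\<bar>)" if "a \<le> b" for b c x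
    proof -
      have "c * exp (- b * \<bar>x\<bar>) \<le> \<bar>c\<bar> * exp (- b * \<bar>x\<bar>)" by (intro mult_right_mono) auto
      also have "\<dots> \<le> \<bar>c\<bar> * exp (- a * \<bar>x\<bar>)" using that by (intro mult_left_mono) (auto intro!: mult_right_mono)
      finally show ?thesis .
    qed
    have "norm (V y x) \<le> (\<bar>c1\<bar> + \<bar>c2\<bar> + \<bar>c3\<bar> + \<bar>c4\<bar>) * exp (- a * \<bar>x\<bar>)" for x
    proof -
      have "norm (V y x) \<le> c1 * exp (- a1 * \<bar>x\<bar>) + c2 * exp (- a2 * \<bar>x\<bar>) + c3 * exp (- a3 * \<bar>x\<bar>) + c4
          * exp (- a4 * \<bar>x\<bar>)"
        unfolding V_def by (intro norm_triangle_le add_mono order_trans[OF norm_triangle_ineq] 1 2 3 4)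
      also have "\<dots> \<le> \<bar>c1\<bar> * exp (- a * \<bar>x\<bar>) + \<bar>c2\<bar> * exp (- a * \<bar>x\<bar>) + \<bar>c3\<bar> * exp (- a * \<bar>x\<bar>) + \<bar>c4\<bar>
          * exp (- a * \<bar>x\<bar>)"
        by (intro add_mono m a)
      finally show ?thesis by (simp only: distrib_right)
    qed
    then show "\<exists>a>0. \<exists>c. \<forall>x. norm (V y x) \<le> c * exp (- a * \<bar>x\<bar>)" using a(1) by blast
  qed
  have LV: "l (integral {0<..} (\<lambda>r. (1 / r) *\<^sub>R V y (ln r))) = (LBINT x. l (V y x))"
      "integrable lborel (\<lambda>x. l (V y x))"
    if y: "y = \<theta> \<or> y = - \<theta>" for y
    using w[OF y] log_integral_weak[OF w(1)[OF y] _ _ l.bounded_linear_axioms] by blast+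
  have I: "integral {0<..} (\<lambda>r. SLinv rm ip N D T (of_real r * emb (cis y))
      (lm ((- qii) * emb (cis y) * f (of_real r * emb (cis y))) u))
    = integral {0<..} (\<lambda>r. (1 / r) *\<^sub>R V y (ln r))" if y: "y = \<theta> \<or> y = - \<theta>" for y
  proof (rule integral_cong)
    fix r :: real assume "r \<in> {0<..}"
    then have r: "r > 0" by simp
    have "of_real r * emb (cis y) = emb (exp (Complex (ln r) y))" using r
        by (simp add: exp_Complex emb_mult emb_of_real)
    then show "SLinv rm ip N D T (of_real r * emb (cis y))
        (lm ((- qii) * emb (cis y) * f (of_real r * emb (cis y))) u) = (1 / r) *\<^sub>R V y (ln r)"
      unfolding V_def SLinv_Vc[OF y, symmetric] using r by simp
  qed
  have em: "of_real (cos \<theta>) - qii * of_real (sin \<theta>) = emb (cis (- \<theta>))"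
      "of_real (cos \<theta>) + qii * of_real (sin \<theta>) = emb (cis \<theta>)"
    by (simp_all add: quat_eq_iff)
  have "SFC rm ip N \<omega> \<mu> D T f u = (1 / (2 * pi)) *\<^sub>R (integral {0<..} (\<lambda>r. (1 / r) *\<^sub>R V (- \<theta>) (ln r))
      - integral {0<..} (\<lambda>r. (1 / r) *\<^sub>R V \<theta> (ln r)))"
    unfolding SFC_def Let_def \<theta>_def[symmetric] em by (simp only: I[OF disjI1[OF refl]] I[OF disjI2[OF refl]])
  then have "l (SFC rm ip N \<omega> \<mu> D T f u) = (1 / (2 * pi)) *\<^sub>R ((LBINT x. l (V (- \<theta>) x)) - (LBINT x. l (V \<theta> x)))"
    by (simp add: l.scaleR l.diff LV)
  \<comment> \<open>The integrals over the two rays must be merged before the left multiplications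
    can be eliminated: \<open>Vc_diff\<close> holds for the difference of the integrands, not for
    each ray.\<close>
  also have "(LBINT x. l (V (- \<theta>) x)) - (LBINT x. l (V \<theta> x)) = (LBINT x. l (V (- \<theta>) x) - l (V \<theta> x))"
    by (rule Bochner_Integration.integral_diff[symmetric]) (rule LV(2), simp)+
  also have "\<dots> = (LBINT x. l (Wg (\<lambda>\<zeta>. Fc qRe f (exp \<zeta>)) u x) + l (Wg (\<lambda>\<zeta>. Fc qI f (exp \<zeta>)) (lm qii u) x)
    + l (Wg (\<lambda>\<zeta>. Fc qJ f (exp \<zeta>)) (lm qjj u) x) + l (Wg (\<lambda>\<zeta>. Fc qK f (exp \<zeta>)) (lm qkk u) x))"
  proof (rule Bochner_Integration.integral_cong[OF refl])
    fix x
    have c: "Fc p f (exp (cnj z)) = cnj (Fc p f (exp z))" if "p \<in> coords" for p z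
        by (simp add: exp_cnj[symmetric] Fc_cnj[OF that])
    have "V (- \<theta>) x - V \<theta> x = Wg (\<lambda>\<zeta>. Fc qRe f (exp \<zeta>)) u x + Wg (\<lambda>\<zeta>. Fc qI f (exp \<zeta>)) (lm qii u) x
    + Wg (\<lambda>\<zeta>. Fc qJ f (exp \<zeta>)) (lm qjj u) x + Wg (\<lambda>\<zeta>. Fc qK f (exp \<zeta>)) (lm qkk u) x"
      unfolding V_def using Vc_diff[of "\<lambda>\<zeta>. Fc qRe f (exp \<zeta>)" u x] Vc_diff[of "\<lambda>\<zeta>. Fc qI f (exp \<zeta>)" "lm qii u" x]
        Vc_diff[of "\<lambda>\<zeta>. Fc qJ f (exp \<zeta>)" "lm qjj u" x] Vc_diff[of "\<lambda>\<zeta>. Fc qK f (exp \<zeta>)" "lm qkk u" x] c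
      by (simp add: algebra_simps)
    then show "l (V (- \<theta>) x) - l (V \<theta> x) = l (Wg (\<lambda>\<zeta>. Fc qRe f (exp \<zeta>)) u x)
        + l (Wg (\<lambda>\<zeta>. Fc qI f (exp \<zeta>)) (lm qii u) x)
    + l (Wg (\<lambda>\<zeta>. Fc qJ f (exp \<zeta>)) (lm qjj u) x) + l (Wg (\<lambda>\<zeta>. Fc qK f (exp \<zeta>)) (lm qkk u) x)"
      by (simp add: l.diff[symmetric] l.add)
  qed
  also have "\<dots> = (LBINT x. l (Wg (\<lambda>\<zeta>. Fc qRe f (exp \<zeta>)) u x))
      + (LBINT x. l (Wg (\<lambda>\<zeta>. Fc qI f (exp \<zeta>)) (lm qii u) x))
    + (LBINT x. l (Wg (\<lambda>\<zeta>. Fc qJ f (exp \<zeta>)) (lm qjj u) x)) + (LBINT x. l (Wg (\<lambda>\<zeta>. Fc qK f (exp \<zeta>)) (lm qkk u) x))"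
  proof -
    have "integrable lborel (\<lambda>x. l (Wg g v x))" if g: "symb \<mu> g" for g v
      using Wg_decay[OF g, of v] log_integral_weak(2)[OF Wg_continuous[OF g] _ _ l.bounded_linear_axioms] by metis
    note i = this[OF s1] this[OF s2] this[OF s3] this[OF s4]
    show ?thesis by (simp add: i)
  qed
  also have "(1 / (2 * pi)) *\<^sub>R \<dots> = l (PHI (\<lambda>\<zeta>. Fc qRe f (exp \<zeta>)) u + PHI (\<lambda>\<zeta>. Fc qI f (exp \<zeta>)) (lm qii u)
    + PHI (\<lambda>\<zeta>. Fc qJ f (exp \<zeta>)) (lm qjj u) + PHI (\<lambda>\<zeta>. Fc qK f (exp \<zeta>)) (lm qkk u))"
  proof -
    have "(1 / (2 * pi)) *\<^sub>R (LBINT x. l (Wg g v x)) = l (PHI g v)" if g: "symb \<mu> g" for g v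
      unfolding PHI_def l.scaleR using Wg_decay[OF g, of v]
          log_integral_weak(1)[OF Wg_continuous[OF g] _ _ l.bounded_linear_axioms] by metis
    note i = this[OF s1] this[OF s2] this[OF s3] this[OF s4]
    show ?thesis by (simp only: scaleR_add_right i l.add)
  qed
  finally show "l (SFC rm ip N \<omega> \<mu> D T f u)
      = l (PHI (\<lambda>\<zeta>. Fc qRe f (exp \<zeta>)) u + PHI (\<lambda>\<zeta>. Fc qI f (exp \<zeta>)) (lm qii u)
    + PHI (\<lambda>\<zeta>. Fc qJ f (exp \<zeta>)) (lm qjj u) + PHI (\<lambda>\<zeta>. Fc qK f (exp \<zeta>)) (lm qkk u))" .
qed

end

section \<open>Quadratic estimates\<close>

lemma is_Qinv_unique: assumes "is_Qinv rm D T s Q" "is_Qinv rm D T s Q'" shows "Q = Q'"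
proof
  fix y
  have "Q' y \<in> dom2 D T" "Lq T s (Q' y) = y" using assms(2) unfolding is_Qinv_def by auto
  then show "Q y = Q' y" using assms(1) unfolding is_Qinv_def by metis
qed

lemma Qs_eq: assumes "is_Qinv rm D T s Q" shows "Qs rm D T s = Q"
  unfolding Qs_def using assms is_Qinv_unique by (intro the_equality) blast+

lemma qarg_scaleR: assumes "t > 0" shows "qarg (t *\<^sub>R s) = qarg s"
proof (cases "s = 0")
  case False
  then show ?thesis using assms by (simp add: qarg_eq)
qed simp

lemma qsector_scaleR: "t > 0 \<Longrightarrow> t *\<^sub>R s \<in> qsector \<theta> \<longleftrightarrow> s \<in> qsector \<theta>"
  by (simp add: qsector_def qarg_scaleR)

lemma (in qhilb) sect_op_type_op:
  assumes "type_op rm ip N \<omega> D T" "0 \<le> \<omega>" "\<omega> < \<mu>" "\<mu> < pi / 2"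
  shows "sect_op rm ip N D T \<omega> \<mu>"
proof
  fix \<theta> assume "\<omega> < \<theta>" "\<theta> \<le> pi"
  then have "\<exists>C>0. \<forall>s. s \<noteq> 0 \<and> s \<notin> qsector \<theta> \<longrightarrow>
        (\<forall>u. norm (SLinv rm ip N D T s u) \<le> C / norm s * norm u) \<and>
        (\<forall>u. norm (SRinv rm ip N D T s u) \<le> C / norm s * norm u)"
    using assms unfolding type_op_def by blast
  then show "\<exists>C>0. \<forall>s. s \<noteq> 0 \<and> s \<notin> qsector \<theta> \<longrightarrow> (\<forall>u. norm (SLinv rm ip N D T s u) \<le> C / norm s * norm u)" by blast
qed (use assms in \<open>auto simp: type_op_def\<close>)

context sect_op
begin

context
  fixes t :: real assumes t: "t > 0"
begin

text \<open>The quadratic polynomial of t T at \<open>s\<close> is \<open>t\<^sup>2\<close> times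
  that of \<open>T\<close> at \<open>s\<close> divided by \<open>t\<close>, and sectors are
  invariant under positive dilations.\<close>

lemma scale_Qinv: assumes s: "s \<notin> qsector \<omega>"
  shows "is_Qinv rm D (\<lambda>x. t *\<^sub>R T x) s (\<lambda>u. (1 / t\<^sup>2) *\<^sub>R Qs rm D T ((1 / t) *\<^sub>R s) u)"
proof -
  let ?s = "(1 / t) *\<^sub>R s"
  let ?Q = "Qs rm D T ?s"
  have "?s \<notin> qsector \<omega>" using s qsector_scaleR[of "1 / t" s \<omega>] t by simp
  then have Q: "is_Qinv rm D T ?s ?Q" by (rule is_Qinv_Qs)
  then have QD: "?Q y \<in> D" "T (?Q y) \<in> D" and Qr: "Lq T ?s (?Q y) = y" for y unfolding is_Qinv_def dom2_def by auto
  have Ql: "?Q (Lq T ?s x) = x" if "x \<in> D" "T x \<in> D" for x using Q that unfolding is_Qinv_def dom2_def by auto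
  have QL: "?Q (rm x a + rm y b) = rm (?Q x) a + rm (?Q y) b" for x y a b using Q
      unfolding is_Qinv_def bop_def rlin_def by auto
  have Qsc: "?Q (r *\<^sub>R x) = r *\<^sub>R ?Q x" for r x using QL[of x "of_real r" 0 0] by (simp add: rm_of_real)
  have L: "Lq (\<lambda>x. t *\<^sub>R T x) s x = t\<^sup>2 *\<^sub>R Lq T ?s x" if "x \<in> D" "T x \<in> D" for x
    using t that by (simp add: Lq_def T_scaleR power2_eq_square algebra_simps)
  show ?thesis unfolding is_Qinv_def
  proof (intro conjI allI ballI)
    show "bop rm (\<lambda>u. (1 / t\<^sup>2) *\<^sub>R ?Q u)"
    proof -
      obtain B where "\<And>x. norm (?Q x) \<le> B * norm x" using Q unfolding is_Qinv_def bop_def by auto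
      then have "norm ((1 / t\<^sup>2) *\<^sub>R ?Q x) \<le> (1 / t\<^sup>2 * B) * norm x" for x
        using t by (simp add: divide_right_mono)
      then have "\<exists>K. \<forall>x. norm ((1 / t\<^sup>2) *\<^sub>R ?Q x) \<le> K * norm x" by blast
      moreover have "rlin rm UNIV (\<lambda>u. (1 / t\<^sup>2) *\<^sub>R ?Q u)" unfolding rlin_def
          by (simp add: QL scaleR_add_right rm_scaleR)
      ultimately show ?thesis unfolding bop_def by blast
    qed
    fix y
    show "(1 / t\<^sup>2) *\<^sub>R ?Q y \<in> dom2 D (\<lambda>x. t *\<^sub>R T x)" by (simp add: dom2_def T_scaleR D_scaleR QD)
    have "Lq T ?s ((1 / t\<^sup>2) *\<^sub>R ?Q y) = (1 / t\<^sup>2) *\<^sub>R Lq T ?s (?Q y)"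
      by (simp add: Lq_def T_scaleR D_scaleR QD scaleR_add_right scaleR_diff_right mult_ac)
    then show "Lq (\<lambda>x. t *\<^sub>R T x) s ((1 / t\<^sup>2) *\<^sub>R ?Q y) = y" using t by (simp add: L T_scaleR D_scaleR QD Qr)
  next
    fix x assume "x \<in> dom2 D (\<lambda>x. t *\<^sub>R T x)"
    then have x: "x \<in> D" "T x \<in> D" using D_scaleR[of "t *\<^sub>R T x" "1 / t"] t by (auto simp: dom2_def)
    show "(1 / t\<^sup>2) *\<^sub>R ?Q (Lq (\<lambda>x. t *\<^sub>R T x) s x) = x" using t by (simp add: L x Qsc Ql)
  qed
qed

text \<open>\<open>SLinv\<close> of t T at \<open>s\<close> is 1/t times \<open>SLinv\<close> of
  \<open>T\<close> at the point \<open>s\<close> divided by \<open>t\<close>. The bound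
  \<open>C / norm s\<close> is homogeneous of the matching degree, so the same constant
  \<open>C\<close> remains valid.\<close>

lemma scale_sect_op: "sect_op rm ip N D (\<lambda>x. t *\<^sub>R T x) \<omega> \<mu>"
proof
  show "rlin rm D (\<lambda>x. t *\<^sub>R T x)" using rlin by (auto simp: rlin_def rm_scaleR scaleR_add_right)
  show "sigmaS rm D (\<lambda>x. t *\<^sub>R T x) \<subseteq> qsector \<omega>"
    using scale_Qinv by (auto simp: sigmaS_def rhoS_def)
  fix \<theta> assume th: "\<omega> < \<theta>" "\<theta> \<le> pi"
  then obtain C where C: "C > 0" "\<And>s u. s \<noteq> 0 \<Longrightarrow> s \<notin> qsector \<theta> \<Longrightarrow> norm (SLinv rm ip N D T s u) \<le> C / norm s * norm u"
    using SL by meson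
  have "norm (SLinv rm ip N D (\<lambda>x. t *\<^sub>R T x) s u) \<le> C / norm s * norm u" if s: "s \<noteq> 0" "s \<notin> qsector \<theta>" for s u
  proof -
    let ?s = "(1 / t) *\<^sub>R s"
    have so: "s \<notin> qsector \<omega>" using s th by (auto simp: qsector_def)
    have s': "?s \<noteq> 0" "?s \<notin> qsector \<theta>" "?s \<notin> qsector \<omega>" using s so t qsector_scaleR[of "1 / t" s] by auto
    then have Q: "is_Qinv rm D T ?s (Qs rm D T ?s)" by (intro is_Qinv_Qs)
    then have QD: "Qs rm D T ?s y \<in> D" for y unfolding is_Qinv_def dom2_def by auto
    have QL: "Qs rm D T ?s (rm x a + rm y b) = rm (Qs rm D T ?s x) a + rm (Qs rm D T ?s y) b" for x y a b
      using Q unfolding is_Qinv_def bop_def rlin_def by auto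
    have Qsc: "Qs rm D T ?s (r *\<^sub>R x) = r *\<^sub>R Qs rm D T ?s x" for r x using QL[of x "of_real r" 0 0]
        by (simp add: rm_of_real)
    have "SLinv rm ip N D (\<lambda>x. t *\<^sub>R T x) s u = (1 / t) *\<^sub>R SLinv rm ip N D T ?s u"
      using t unfolding SLinv_def Qs_eq[OF scale_Qinv[OF so]]
      by (simp add: T_scaleR QD lmul_scaleR_left Qsc scaleR_diff_right power2_eq_square)
    then have "norm (SLinv rm ip N D (\<lambda>x. t *\<^sub>R T x) s u) = (1 / t) * norm (SLinv rm ip N D T ?s u)" using t by simp
    also have "\<dots> \<le> (1 / t) * (C / norm ?s * norm u)" using C(2)[OF s'(1,2)] t by (intro mult_left_mono) auto
    also have "\<dots> = C / norm s * norm u" using t by simp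
    finally show ?thesis .
  qed
  then show "\<exists>C>0. \<forall>s. s \<noteq> 0 \<and> s \<notin> qsector \<theta>
      \<longrightarrow> (\<forall>u. norm (SLinv rm ip N D (\<lambda>x. t *\<^sub>R T x) s u) \<le> C / norm s * norm u)"
    using C(1) by blast
qed (use angles in auto)

text \<open>The product of \<open>s\<close> with the inverse of s - t T does not change when both
  \<open>s\<close> and t T are divided by \<open>t\<close>; in the logarithmic coordinate this
  division is the translation by \<open>ln t\<close>.\<close>

lemma scale_K: assumes z: "\<zeta> \<in> reg"
  shows "sect_op.K rm D (\<lambda>x. t *\<^sub>R T x) \<zeta> u = K (\<zeta> - of_real (ln t)) u"
proof -
  interpret t: sect_op rm ip N D "\<lambda>x. t *\<^sub>R T x" \<omega> \<mu> by (rule scale_sect_op)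
  let ?w = "\<zeta> - of_real (ln t)"
  have w: "?w \<in> reg" using z by (simp add: reg_def)
  have e: "exp ?w = exp \<zeta> / of_real t" "exp \<zeta> = of_real t * exp ?w"
    using t by (simp_all add: exp_diff exp_of_real del: of_real_exp)
  have "(1 / t) *\<^sub>R R (exp ?w) u = t.R (exp \<zeta>) u"
  proof (rule t.R_unique)
    show "emb (exp \<zeta>) \<notin> qsector \<omega>" by (rule reg_off[OF z])
    show "(1 / t) *\<^sub>R R (exp ?w) u \<in> D" by (intro D_scaleR R_D reg_off w)
    have "csc (exp \<zeta>) ((1 / t) *\<^sub>R R (exp ?w) u) = csc (exp ?w) (R (exp ?w) u)"
      unfolding e(2) using t by (simp add: sc_sc[symmetric] sc_of_real sc_scaleR)
    moreover have "t *\<^sub>R T ((1 / t) *\<^sub>R R (exp ?w) u) = T (R (exp ?w) u)" using t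
        by (simp add: T_scaleR R_D reg_off w)
    ultimately show "csc (exp \<zeta>) ((1 / t) *\<^sub>R R (exp ?w) u) - t *\<^sub>R T ((1 / t) *\<^sub>R R (exp ?w) u) = u"
      using R_right[OF reg_off[OF w], of u] by simp
  qed
  then have "t.K \<zeta> u = csc (exp \<zeta>) ((1 / t) *\<^sub>R R (exp ?w) u)" by (simp add: t.K_def)
  also have "\<dots> = K ?w u" unfolding K_def e(2) using t by (simp add: sc_sc[symmetric] sc_of_real sc_scaleR)
  finally show ?thesis .
qed

end

lemma LI_translate: "LI y (\<lambda>z. h (z + of_real t)) = LI y h"
proof -
  have "Complex x y + of_real t = Complex (x + t) y" for x by (simp add: complex_eq_iff)
  then show ?thesis unfolding LI_def using lborel_translate(1)[of "\<lambda>x. h (Complex x y)" t] by simp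
qed

lemma Jl_translate: "Jl y (\<lambda>z. h (z + of_real t)) = Jl y h"
  by (simp add: Jl_def LI_translate)

lemma scale_PHI: assumes t: "t > 0" and g: "symb \<mu> g"
  shows "sect_op.PHI rm D (\<lambda>x. t *\<^sub>R T x) \<omega> \<mu> g u = PHI (\<lambda>z. g (z + of_real (ln t))) u"
proof (rule PHI_eqI[OF symb_translate[OF g]])
  interpret t: sect_op rm ip N D "\<lambda>x. t *\<^sub>R T x" \<omega> \<mu> by (rule scale_sect_op[OF t])
  fix l assume l: "l \<in> clf"
  have "l (t.PHI g u) = Jl \<theta> (\<lambda>z. g z * l (t.K z u))" by (rule t.PHI_weak[OF g l])
  also have "\<dots> = Jl \<theta> (\<lambda>z. g z * l (K (z - of_real (ln t)) u))"
    by (rule Jl_cong) (auto simp: scale_K[OF t] line_reg)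
  also have "\<dots> = Jl \<theta> (\<lambda>z. g (z + of_real (ln t)) * l (K z u))"
    using Jl_translate[of \<theta> "\<lambda>z. g z * l (K (z - of_real (ln t)) u)" "ln t"] by simp
  finally show "l (t.PHI g u) = Jl \<theta> (\<lambda>z. g (z + of_real (ln t)) * l (K z u))" .
qed

text \<open>Used for the components \<open>qI\<close>, \<open>qJ\<close>, \<open>qK\<close> of
  intrinsic functions, which are known to be zero on the strip but need not be the zero function on
  the whole plane.\<close>

lemma PHI_vanish: assumes "\<And>z. z \<in> strip (- \<mu>) \<mu> \<Longrightarrow> h z = 0" shows "symb \<mu> h" "PHI h u = 0"
proof -
  show s: "symb \<mu> h" unfolding symb_def
  proof
    show "h holomorphic_on strip (- \<mu>) \<mu>"
      by (rule holomorphic_transform[of "\<lambda>_. 0"]) (auto simp: assms)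
    show "\<exists>c \<alpha>. \<alpha> > 0 \<and> (\<forall>z\<in>strip (- \<mu>) \<mu>. cmod (h z) \<le> c * exp (- \<alpha> * \<bar>Re z\<bar>))"
      by (rule exI[of _ 0], rule exI[of _ 1]) (auto simp: assms)
  qed
  have "0 = PHI h u"
  proof (rule PHI_eqI[OF s])
    fix l assume l: "l \<in> clf"
    have "Jl \<theta> (\<lambda>z. h z * l (K z u)) = Jl \<theta> (\<lambda>z. 0)"
    proof (rule Jl_cong)
      fix x y assume "y = \<theta> \<or> y = - \<theta>"
      then have "Complex x y \<in> strip (- \<mu>) \<mu>" using line_strip[of y] by (auto simp: strip_def)
      then show "h (Complex x y) * l (K (Complex x y) u) = 0" by (simp add: assms)
    qed
    then show "l 0 = Jl \<theta> (\<lambda>z. h z * l (K z u))" using clfD(2)[OF l, of 0 0] by (simp add: Jl_def LI_def)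
  qed
  then show "PHI h u = 0" by simp
qed

lemma SFC_intrinsic:
  assumes g: "symb \<mu> (\<lambda>\<zeta>. Fc qRe f (exp \<zeta>))"
    and v: "\<And>p \<zeta>. p \<in> {qI, qJ, qK} \<Longrightarrow> \<zeta> \<in> strip (- \<mu>) \<mu> \<Longrightarrow> Fc p f (exp \<zeta>) = 0"
  shows "SFC rm ip N \<omega> \<mu> D T f u = PHI (\<lambda>\<zeta>. Fc qRe f (exp \<zeta>)) u"
proof -
  have "symb \<mu> (\<lambda>\<zeta>. Fc p f (exp \<zeta>))" if "p \<in> coords" for p
    using that g PHI_vanish(1)[of "\<lambda>\<zeta>. Fc p f (exp \<zeta>)"] v[of p] by auto
  from SFC_PHI[OF this] show ?thesis
    using PHI_vanish(2)[of "\<lambda>\<zeta>. Fc qI f (exp \<zeta>)"] PHI_vanish(2)[of "\<lambda>\<zeta>. Fc qJ f (exp \<zeta>)"]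
        PHI_vanish(2)[of "\<lambda>\<zeta>. Fc qK f (exp \<zeta>)"] v
    by simp
qed

lemma SFC_scale_intrinsic:
  assumes t: "t > 0" and g: "symb \<mu> (\<lambda>\<zeta>. Fc qRe f (exp \<zeta>))"
    and v: "\<And>p \<zeta>. p \<in> {qI, qJ, qK} \<Longrightarrow> \<zeta> \<in> strip (- \<mu>) \<mu> \<Longrightarrow> Fc p f (exp \<zeta>) = 0"
  shows "SFC rm ip N \<omega> \<mu> D (\<lambda>x. t *\<^sub>R T x) f u = PHI (\<lambda>z. Fc qRe f (exp (z + of_real (ln t)))) u"
proof -
  interpret t: sect_op rm ip N D "\<lambda>x. t *\<^sub>R T x" \<omega> \<mu> by (rule scale_sect_op[OF t])
  have "SFC rm ip N \<omega> \<mu> D (\<lambda>x. t *\<^sub>R T x) f u = t.PHI (\<lambda>\<zeta>. Fc qRe f (exp \<zeta>)) u"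
    by (rule t.SFC_intrinsic[OF g]) (rule v)
  also have "\<dots> = PHI (\<lambda>z. Fc qRe f (exp (z + of_real (ln t)))) u" by (rule scale_PHI[OF t g])
  finally show ?thesis .
qed

text \<open>With \<open>\<tau> = ln t\<close> and \<open>g\<close> the logarithmic form of psi this
  is psi(t T) u (\<open>SFC_scale_intrinsic\<close>), and the measure dt/t becomes Lebesgue measure
  in \<open>\<tau>\<close>.\<close>

definition orb :: "(complex \<Rightarrow> complex) \<Rightarrow> 'h \<Rightarrow> real \<Rightarrow> 'h" where
  "orb g u \<tau> = PHI (\<lambda>z. g (z + of_real \<tau>)) u"

text \<open>The norm of a difference of orbit points is controlled by the L1 distance of two
  translates of \<open>g\<close> on the contour, and translation is continuous in L1. Continuity
  supplies the measurability of the square function.\<close>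

lemma orb_continuous: assumes g: "symb \<mu> g" shows "continuous_on UNIV (orb g u)"
proof (rule continuous_at_imp_continuous_on, intro ballI)
  fix s :: real
  let ?n = "\<lambda>y t. LBINT x. cmod (g (Complex (x + t) y) - g (Complex (x + s) y))"
  have z: "Complex x y + of_real t = Complex (x + t) y" for x y t by (simp add: complex_eq_iff)
  have bound: "norm (orb g u t - orb g u s) \<le> (?n (- \<theta>) t + ?n \<theta> t) * (CK * norm u) / (2 * pi)" for t
  proof (cases "orb g u t = orb g u s")
    case True
    have "0 \<le> ?n (- \<theta>) t + ?n \<theta> t" by simp
    then show ?thesis using True CK(1) by simp
  next
    case False
    let ?d = "orb g u t - orb g u s" and ?h = "\<lambda>z. g (z + of_real t) - g (z + of_real s)"
    note S = symb_translate[OF g, of t] symb_translate[OF g, of s]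
    have gi: "integrable lborel (\<lambda>x. ?h (Complex x y))" if "y = \<theta> \<or> y = - \<theta>" for y
      by (intro Bochner_Integration.integrable_diff symb_integrable[OF S(1)] symb_integrable[OF S(2)])
        (use that line_strip[of y] in auto)
    have gk: "integrable lborel (\<lambda>x. g (Complex x y + of_real r) * cin (K (Complex x y) u) ?d)"
        if "y = \<theta> \<or> y = - \<theta>" for y r
      by (rule gK_integrable[OF symb_translate[OF g] cip_clf]) (use that in auto)
    have "(norm ?d)\<^sup>2 = cmod (cin ?d ?d)" by (simp add: cip_self norm_power)
    also have "cin ?d ?d = Jl \<theta> (\<lambda>z. g (z + of_real t) * cin (K z u) ?d)
        - Jl \<theta> (\<lambda>z. g (z + of_real s) * cin (K z u) ?d)"
    proof -
      have "cin (orb g u r) w = Jl \<theta> (\<lambda>z. g (z + of_real r) * cin (K z u) w)" for r w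
        unfolding orb_def by (rule PHI_weak[OF symb_translate[OF g] cip_clf])
      then show ?thesis by (subst cip_diff) (simp only:)
    qed
    also have "\<dots> = Jl \<theta> (\<lambda>z. ?h z * cin (K z u) ?d)"
      unfolding left_diff_distrib by (rule Jl_add(2)[symmetric]) (use gk in auto)
    also have "cmod \<dots> \<le> Lg ?h * (CK * norm u * norm ?d) / (2 * pi)"
    proof (rule Jl_gK_bound[OF gi])
      show "cmod (cin (K z u) ?d) \<le> CK * norm u * norm ?d" if "z \<in> reg" for z
        by (rule order_trans[OF cmod_cip_le]) (intro mult_right_mono CK that; simp)
      show "integrable lborel (\<lambda>x. ?h (Complex x y) * cin (K (Complex x y) u) ?d)" if "y = \<theta> \<or> y = - \<theta>" for y
        unfolding left_diff_distrib by (intro Bochner_Integration.integrable_diff gk that)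
    qed
    finally have "norm ?d * norm ?d \<le> (Lg ?h * (CK * norm u) / (2 * pi)) * norm ?d"
        by (simp add: power2_eq_square mult_ac)
    then have "norm ?d \<le> Lg ?h * (CK * norm u) / (2 * pi)" by (subst (asm) mult_le_cancel_right_pos)
        (use False in auto)
    then show ?thesis by (simp add: Lg_def z)
  qed
  obtain c \<alpha> where c: "\<alpha> > 0" "\<And>z. z \<in> strip (- \<mu>) \<mu> \<Longrightarrow> cmod (g z) \<le> c * exp (- \<alpha> * \<bar>Re z\<bar>)"
    using g unfolding symb_def by auto
  have lim: "((\<lambda>t. ?n y t) \<longlongrightarrow> 0) (at s)" if y: "y = \<theta> \<or> y = - \<theta>" for y
  proof (rule translation_L1_continuous[where q="\<lambda>x. g (Complex x y)" and a=\<alpha> and c=c])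
    show "continuous_on UNIV (\<lambda>x. g (Complex x y))" by (rule symb_line_continuous[OF g])
        (use line_strip[of y] y in auto)
    show "cmod (g (Complex x y)) \<le> c * exp (- \<alpha> * \<bar>x\<bar>)" for x
      using c(2)[of "Complex x y"] line_strip[of y] y by (auto simp: strip_def)
  qed (rule c)
  have "((\<lambda>t. (?n (- \<theta>) t + ?n \<theta> t) * (CK * norm u) / (2 * pi)) \<longlongrightarrow> (0 + 0) * (CK * norm u) / (2 * pi)) (at s)"
    by (intro tendsto_divide tendsto_mult tendsto_add lim tendsto_const) auto
  then have "((\<lambda>t. (?n (- \<theta>) t + ?n \<theta> t) * (CK * norm u) / (2 * pi)) \<longlongrightarrow> 0) (at s)" by simp
  then have "((\<lambda>t. orb g u t - orb g u s) \<longlongrightarrow> 0) (at s)"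
    by (rule Lim_null_comparison[OF always_eventually[OF allI[OF bound]]])
  then show "isCont (orb g u) s" unfolding isCont_def by (simp add: LIM_zero_iff)
qed

text \<open>The substitution \<open>\<tau> = ln t\<close> turns the nonnegative integral in the
  quadratic estimate into an ordinary Lebesgue integral over the line; its finiteness gives
  integrability.\<close>

lemma orb_quadratic:
  assumes g: "symb \<mu> g" and B: "0 \<le> B"
    and q: "(\<integral>\<^sup>+ t. indicator {0<..} t * ennreal ((norm (orb g u (ln t)))\<^sup>2 / t) \<partial>lborel) \<le> ennreal B"
  shows "integrable lborel (\<lambda>\<tau>. (norm (orb g u \<tau>))\<^sup>2)" "(LBINT \<tau>. (norm (orb g u \<tau>))\<^sup>2) \<le> B"
proof -
  let ?p = "\<lambda>\<tau>. (norm (orb g u \<tau>))\<^sup>2" and ?q = "\<lambda>t. (norm (orb g u (ln t)))\<^sup>2 / t"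
  have "continuous_on {0<..} ?q"
    by (intro continuous_on_divide continuous_on_power continuous_on_norm
      continuous_on_compose2[OF orb_continuous[OF g]] continuous_on_ln continuous_on_id) auto
  then have m[measurable]: "(\<lambda>t. indicator {0<..} t *\<^sub>R ?q t) \<in> borel_measurable lborel"
    using borel_measurable_continuous_on_indicator[of "{0<..}" ?q] by simp
  have nn: "(\<integral>\<^sup>+ t. ennreal (indicator {0<..} t *\<^sub>R ?q t) \<partial>lborel) \<le> ennreal B"
  proof -
    have "ennreal (indicator {0<..} t *\<^sub>R ?q t) = indicator {0<..} t * ennreal (?q t)" for t
        by (simp add: indicator_def)
    then show ?thesis using q by simp
  qed
  have pos: "0 \<le> indicator {0<..} t *\<^sub>R ?q t" for t :: real by (simp add: indicator_def)
  have i: "integrable lborel (\<lambda>t. indicator {0<..} t *\<^sub>R ?q t)"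
    by (rule integrableI_nonneg) (use m pos nn in \<open>auto simp: le_less_trans\<close>)
  have b: "(LBINT t. indicator {0<..} t *\<^sub>R ?q t) \<le> B"
    using nn unfolding nn_integral_eq_integral[OF i AE_I2[OF pos]] by (simp add: B)
  have si: "set_integrable lborel {0<..} ?q" using i by (simp add: set_integrable_def)
  then have "?q absolutely_integrable_on {0<..}" by (auto simp: set_integrable_def integrable_completion)
  moreover have "integral {0<..} ?q \<le> B" using set_borel_integral_eq_integral(2)[OF si] b
      by (simp add: set_lebesgue_integral_def)
  moreover have s: "range exp = {0::real<..}" by (auto simp: image_iff intro: exp_ln[symmetric])
  moreover have "(\<lambda>x. \<bar>exp x\<bar> *\<^sub>R ?q (exp x)) absolutely_integrable_on UNIV
      \<and> integral UNIV (\<lambda>x. \<bar>exp x\<bar> *\<^sub>R ?q (exp x)) = integral {0<..} ?q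
    \<longleftrightarrow> ?q absolutely_integrable_on (range exp) \<and> integral (range exp) ?q = integral {0<..} ?q"
    by (rule has_absolute_integral_change_of_variables_real) (auto intro!: derivative_eq_intros simp: inj_on_def)
  ultimately have *: "?p absolutely_integrable_on UNIV" "integral UNIV ?p \<le> B" by simp_all
  have pm: "?p \<in> borel_measurable borel"
    by (intro borel_measurable_continuous_onI continuous_on_power continuous_on_norm orb_continuous g)
  show pi: "integrable lborel ?p" using *(1) pm by (auto simp: set_integrable_def integrable_completion)
  have "set_integrable lborel UNIV ?p" using pi by (simp add: set_integrable_def)
  from set_borel_integral_eq_integral(2)[OF this] show "(LBINT \<tau>. ?p \<tau>) \<le> B" using *(2)
      by (simp add: set_lebesgue_integral_def)
qed

end

locale adj_pair = sect_op rm ip N D T \<omega> \<mu> + S: sect_op rm ip N D' T' \<omega> \<mu>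
  for rm :: "'h::{real_normed_vector,complete_space} \<Rightarrow> quat \<Rightarrow> 'h" and ip N D T \<omega> \<mu> D' T' +
  assumes adj: "\<And>x y. x \<in> D \<Longrightarrow> y \<in> D' \<Longrightarrow> ip (T x) y = ip x (T' y)"
begin

lemma cip_sc_right: "cin x (csc c y) = cnj c * cin x y"
  by (subst (1 2) cip_cnj) (simp add: cip_sc)

lemma cip_diff_right: "cin x (y - z) = cin x y - cin x z"
  by (subst (1 2 3) cip_cnj) (simp add: cip_diff)

text \<open>The defining relation of the adjoint exchanges \<open>z - T\<close> with
  \<open>cnj z - T'\<close> across the inner product. Inserting the two resolvents as test vectors
  gives the same for the inverses.\<close>

lemma cip_K: assumes "\<zeta> \<in> reg" shows "cin (K \<zeta> y) w = cin y (S.K (cnj \<zeta>) w)"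
proof -
  let ?z = "exp \<zeta>"
  have o: "emb ?z \<notin> qsector \<omega>" "emb (cnj ?z) \<notin> qsector \<omega>"
    using reg_off[OF assms] reg_off[OF reg_cnj[OF assms]] by (simp_all add: exp_cnj)
  let ?a = "R ?z y" and ?b = "S.R (cnj ?z) w"
  have a: "?a \<in> D" "csc ?z ?a - T ?a = y" by (rule R_D[OF o(1)], rule R_right[OF o(1)])
  have b: "?b \<in> D'" "csc (cnj ?z) ?b - T' ?b = w" by (rule S.R_D[OF o(2)], rule S.R_right[OF o(2)])
  have ab: "cin (T ?a) ?b = cin ?a (T' ?b)" using adj[OF a(1) b(1)] by (simp add: cip_def)
  have "cin ?a w = cin ?a (csc (cnj ?z) ?b - T' ?b)" by (simp only: b(2))
  also have "\<dots> = cin (csc ?z ?a - T ?a) ?b" by (simp add: cip_diff_right cip_diff cip_sc cip_sc_right ab)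
  also have "\<dots> = cin y ?b" by (simp only: a(2))
  finally have "cin ?a w = cin y ?b" .
  then show ?thesis unfolding K_def S.K_def by (simp add: cip_sc cip_sc_right exp_cnj[symmetric])
qed

text \<open>Conjugation exchanges the two lines and also changes the sign of
  \<open>2 * pi * \<i>\<close>; the two sign changes cancel.\<close>

lemma cnj_Jl: "cnj (Jl t h) = Jl t (\<lambda>z. cnj (h (cnj z)))"
proof -
  have c: "cnj (LI y h) = LI (- y) (\<lambda>z. cnj (h (cnj z)))" for y
  proof -
    have "cnj (Complex x (- y)) = Complex x y" for x by (simp add: complex_eq_iff)
    then show ?thesis by (simp add: LI_def)
  qed
  show ?thesis unfolding Jl_def by (simp add: c) (simp add: divide_simps)
qed

text \<open>Passing to the adjoint conjugates the point at which the resolvent is taken, and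
  conjugation maps the contour to itself. Because \<open>g\<close> is symmetric, the same symbol
  reappears for the adjoint.\<close>

lemma cip_PHI:
  assumes g: "symb \<mu> g" and sym: "\<And>z. g (cnj z) = cnj (g z)"
  shows "cin (PHI g y) w = cin y (S.PHI g w)"
proof -
  have "cin (PHI g y) w = Jl \<theta> (\<lambda>z. g z * cin (K z y) w)" by (rule PHI_weak[OF g cip_clf])
  also have "\<dots> = Jl \<theta> (\<lambda>z. cnj (g (cnj z) * cin (S.K (cnj z) w) y))"
  proof (rule Jl_cong)
    fix x y' assume "y' = \<theta> \<or> y' = - \<theta>"
    then have "Complex x y' \<in> reg" by (auto intro: line_reg)
    then show "g (Complex x y') * cin (K (Complex x y') y) w
        = cnj (g (cnj (Complex x y')) * cin (S.K (cnj (Complex x y')) w) y)"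
      by (simp only: cip_K complex_cnj_mult sym complex_cnj_cnj cip_cnj[of y])
  qed
  also have "\<dots> = cnj (Jl \<theta> (\<lambda>z. g z * cin (S.K z w) y))" by (rule cnj_Jl[symmetric])
  also have "Jl \<theta> (\<lambda>z. g z * cin (S.K z w) y) = cin (S.PHI g w) y" by (rule S.PHI_weak[OF g cip_clf, symmetric])
  finally show ?thesis by (simp add: cip_cnj[of y])
qed

text \<open>The McIntosh estimate: insert the reproducing formula
  \<open>\<integral> \<psi>(t z)\<^sup>2 \<psi>'(t z) dt/t = const\<close>, let \<open>\<psi>'(t T)\<close> act on the other side of the inner product and use
  the two quadratic estimates.\<close>

lemma PHI_estimate:
  assumes g: "symb \<mu> g" and g': "symb \<mu> g'" and sym: "\<And>z. g' (cnj z) = cnj (g' z)"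
    and pos: "\<And>x. \<exists>r>0. g (of_real x) = of_real r" "\<And>x. \<exists>r>0. g' (of_real x) = of_real r"
    and qT: "\<And>u. integrable lborel (\<lambda>\<tau>. (norm (orb g u \<tau>))\<^sup>2)" "\<And>u. (LBINT \<tau>. (norm (orb g u \<tau>))\<^sup>2) \<le> b * (norm u)\<^sup>2"
    and qS: "\<And>u. integrable lborel (\<lambda>\<tau>. (norm (S.orb g' u \<tau>))\<^sup>2)"
        "\<And>u. (LBINT \<tau>. (norm (S.orb g' u \<tau>))\<^sup>2) \<le> b' * (norm u)\<^sup>2"
    and b: "0 \<le> b" "0 \<le> b'"
  obtains C where "C > 0" "\<And>F M k u. F holomorphic_on strip (- \<mu>) \<mu> \<Longrightarrow> (\<And>z. z \<in> strip (- \<mu>) \<mu> \<Longrightarrow> cmod (F z) \<le> M) \<Longrightarrow>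
    norm (PHI (\<lambda>z. p0 z ^ Suc k * F z) u) \<le> C * M * norm ((A ^^ Suc k) u)"
proof -
  \<comment> \<open>Each factor has its own task: one \<open>g\<close> stays with \<open>F\<close>
    and makes it an operator given by a convergent integral, the other \<open>g\<close> produces the
    orbit of \<open>T\<close>, and \<open>g'\<close> goes to the adjoint.\<close>
  define H where "H z = g z * g z * g' z" for z
  have H: "symb \<mu> H" unfolding H_def by (intro symb_mult g g')
  obtain h where h: "\<And>x. h x > 0" "\<And>x. H (of_real x) = of_real (h x)"
  proof -
    have "\<exists>r>0. H (of_real x) = of_real r" for x
    proof -
      obtain r r' where "r > 0" "r' > 0" "g (of_real x) = of_real r" "g' (of_real x) = of_real r'" using pos
          by metis
      then show ?thesis by (intro exI[of _ "r * r * r'"]) (simp add: H_def)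
    qed
    then show thesis using that by metis
  qed
  have c0: "Complex x 0 = of_real x" for x by (simp add: complex_eq_iff)
  have Hi: "integrable lborel (\<lambda>x. complex_of_real (h x))"
    using symb_integrable[OF H, of 0] theta by (simp add: c0 h)
  then have hi: "integrable lborel h" using integrable_Re by fastforce
  define c where "c = (LBINT x. h x)"
  have cH: "LI 0 H = of_real c" unfolding LI_def c0 h c_def by simp
  have c: "c > 0"
  proof -
    have "0 \<le> c" unfolding c_def using h(1) by (intro Bochner_Integration.integral_nonneg) (simp add: less_imp_le)
    moreover have "c \<noteq> 0"
    proof
      assume "c = 0"
      then have "AE x in lborel. h x = 0" using integral_nonneg_eq_0_iff_AE[OF hi] h(1)
          by (simp add: c_def less_imp_le)
      then have "AE x::real in lborel. False"
      proof (rule AE_mp)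
        have "h x \<noteq> 0" for x using h(1)[of x] by simp
        then show "AE x in lborel. h x = 0 \<longrightarrow> False" by simp
      qed
      then show False by (simp add: eventually_False ae_filter_eq_bot_iff)
    qed
    ultimately show ?thesis by simp
  qed
  \<comment> \<open>The norm of (F g)(t T) is at most \<open>E * M\<close> for every t, because
    \<open>Lg\<close> does not change under translation.\<close>
  define E where "E = Lg g * CK / (2 * pi)"
  have E: "0 \<le> E" using CK(1) by (simp add: E_def Lg_def)
  \<comment> \<open>The summand 1 makes the constant strictly positive even if
    \<open>E * (b + b')\<close> is 0.\<close>
  have "norm (PHI (\<lambda>z. p0 z ^ Suc k * F z) u) \<le> ((E * (b + b') + 1) / c) * M * norm ((A ^^ Suc k) u)"
    if F: "F holomorphic_on strip (- \<mu>) \<mu>" "\<And>z. z \<in> strip (- \<mu>) \<mu> \<Longrightarrow> cmod (F z) \<le> M" for F M k u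
  proof -
    define y where "y = (A ^^ Suc k) u"
    define g0 where "g0 z = p0 z ^ Suc k * F z" for z
    define w where "w = PHI g0 u"
    have M: "0 \<le> M" using F(2)[of 0] theta norm_ge_zero[of "F 0"]
        by (simp add: strip_def order_trans[OF norm_ge_zero])
    have p0: "symb \<mu> p0" using theta by (intro p0_symb) auto
    have pk: "symb \<mu> (\<lambda>z. p0 z ^ Suc k)" using A_pow_PHI(1)[OF p0, of k] by (simp add: mult.commute)
    have g0: "symb \<mu> g0" unfolding g0_def using symb_mult_bounded[OF pk F] by (simp add: mult.commute)
    \<comment> \<open>Inserting the translates of \<open>H\<close> and pairing with \<open>w\<close>
      itself gives a function of \<open>\<tau>\<close> whose integral is
      \<open>c * (norm w)\<^sup>2\<close>; it remains to bound it by the two square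
      functions.\<close>
    define P where "P \<tau> = cin (PHI (\<lambda>z. g0 z * H (z + of_real \<tau>)) u) w" for \<tau>
    have PJ: "P \<tau> = Jl \<theta> (\<lambda>z. (g0 z * cin (K z u) w) * H (z + of_real \<tau>))" for \<tau>
      unfolding P_def PHI_weak[OF symb_mult[OF g0 symb_translate[OF H]] cip_clf] by (simp only: mult_ac)
    have corr: "(LBINT \<tau>. P \<tau>) = of_real c * of_real ((norm w)\<^sup>2)" "integrable lborel P"
    proof -
      have i: "integrable lborel (\<lambda>x. g0 (Complex x y) * cin (K (Complex x y) u) w)" if "y = \<theta> \<or> y = - \<theta>" for y
        by (rule gK_integrable[OF g0 cip_clf]) (use that in auto)
      have J: "Jl \<theta> (\<lambda>z. g0 z * cin (K z u) w) = of_real ((norm w)\<^sup>2)"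
        unfolding PHI_weak[OF g0 cip_clf, symmetric] w_def[symmetric] by (rule cip_self)
      show "(LBINT \<tau>. P \<tau>) = of_real c * of_real ((norm w)\<^sup>2)" "integrable lborel P"
        unfolding PJ[abs_def] using Jl_correlation[OF i symb_holomorphic[OF H] symb_decay[OF H]] theta J cH
            by simp_all
    qed
    have Pb: "cmod (P \<tau>) \<le> (E * M) * (norm (orb g y \<tau>) * norm (S.orb g' w \<tau>))" for \<tau>
    proof -
      let ?g = "\<lambda>z. g (z + of_real \<tau>)" and ?g' = "\<lambda>z. g' (z + of_real \<tau>)"
      have s: "symb \<mu> ?g" "symb \<mu> ?g'" by (rule symb_translate[OF g], rule symb_translate[OF g'])
      have sF: "symb \<mu> (\<lambda>z. F z * ?g z)" by (rule symb_mult_bounded[OF s(1) F])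
      have 1: "PHI (\<lambda>z. p0 z ^ Suc k * ?g z) u = orb g y \<tau>"
        unfolding orb_def y_def A_pow_PHI(3)[OF s(1)] by (rule A_pow_PHI(2)[OF s(1), symmetric])
      have s3: "symb \<mu> (\<lambda>z. p0 z ^ Suc k * ?g z)" by (rule A_pow_PHI(1)[OF s(1)])
      \<comment> \<open>The regularizing power is grouped with the factor \<open>g\<close> that acts
        first. By commutation with \<open>A\<close> this block applied to \<open>u\<close> is the
        orbit of \<open>y\<close>, so the power appears in the estimate only through
        \<open>y\<close>.\<close>
      have "(\<lambda>z. g0 z * H (z + of_real \<tau>)) = (\<lambda>z. ?g' z * ((F z * ?g z) * (p0 z ^ Suc k * ?g z)))"
        by (simp add: g0_def H_def mult_ac)
      then have "PHI (\<lambda>z. g0 z * H (z + of_real \<tau>)) u = PHI ?g' (PHI (\<lambda>z. F z * ?g z) (orb g y \<tau>))"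
        by (simp only: PHI_mult[OF s(2) symb_mult[OF sF s3], symmetric] PHI_mult[OF sF s3, symmetric] 1)
      then have "P \<tau> = cin (PHI (\<lambda>z. F z * ?g z) (orb g y \<tau>)) (S.orb g' w \<tau>)"
        unfolding P_def S.orb_def by (simp only:) (rule cip_PHI[OF s(2)], simp add: sym[symmetric])
      then have "cmod (P \<tau>) \<le> norm (PHI (\<lambda>z. F z * ?g z) (orb g y \<tau>)) * norm (S.orb g' w \<tau>)"
        using cmod_cip_le by simp
      moreover have "norm (PHI (\<lambda>z. F z * ?g z) (orb g y \<tau>)) \<le> (E * M) * norm (orb g y \<tau>)"
      proof -
        have "(LBINT x. cmod (F (Complex x t) * ?g (Complex x t))) \<le> M * (LBINT x. cmod (g (Complex x t)))"
            if t: "t = \<theta> \<or> t = - \<theta>" for t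
        proof -
          have tm: "- \<mu> < t" "t < \<mu>" using line_strip[of t] t by auto
          have "(LBINT x. cmod (F (Complex x t) * ?g (Complex x t))) \<le> (LBINT x. M * cmod (?g (Complex x t)))"
          proof (rule integral_mono)
            show "integrable lborel (\<lambda>x. cmod (F (Complex x t) * ?g (Complex x t)))"
                by (rule integrable_norm[OF symb_integrable[OF sF tm]])
            show "integrable lborel (\<lambda>x. M * cmod (?g (Complex x t)))"
                by (rule integrable_mult_right[OF integrable_norm[OF symb_integrable[OF s(1) tm]]])
            show "cmod (F (Complex x t) * ?g (Complex x t)) \<le> M * cmod (?g (Complex x t))" for x
              unfolding norm_mult by (intro mult_right_mono F(2)) (use tm in \<open>auto simp: strip_def\<close>)
          qed
          also have "\<dots> = M * (LBINT x. cmod (?g (Complex x t)))" by simp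
          also have "(LBINT x. cmod (?g (Complex x t))) = (LBINT x. cmod (g (Complex x t)))"
          proof -
            have "Complex x t + of_real \<tau> = Complex (x + \<tau>) t" for x by (simp add: complex_eq_iff)
            then show ?thesis using lborel_translate(1)[of "\<lambda>x. cmod (g (Complex x t))" \<tau>] by simp
          qed
          finally show ?thesis .
        qed
        from this[of \<theta>] this[of "- \<theta>"] have "Lg (\<lambda>z. F z * ?g z) \<le> M * Lg g" by (simp add: Lg_def distrib_left)
        then have "Lg (\<lambda>z. F z * ?g z) * CK / (2 * pi) \<le> M * Lg g * CK / (2 * pi)"
          using CK(1) by (intro divide_right_mono mult_right_mono) auto
        also have "\<dots> = E * M" by (simp add: E_def mult_ac)
        finally have "Lg (\<lambda>z. F z * ?g z) * CK / (2 * pi) * norm (orb g y \<tau>) \<le> E * M * norm (orb g y \<tau>)"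
            by (rule mult_right_mono) simp
        then show ?thesis using PHI_bound[OF sF, of "orb g y \<tau>"] by linarith
      qed
      then have "norm (PHI (\<lambda>z. F z * ?g z) (orb g y \<tau>)) * norm (S.orb g' w \<tau>) \<le> (E * M) * norm (orb g y \<tau>)
          * norm (S.orb g' w \<tau>)"
        by (rule mult_right_mono) simp
      ultimately show ?thesis by (simp only: mult.assoc)
    qed
    have cw: "c * (norm w)\<^sup>2 \<le> (LBINT \<tau>. cmod (P \<tau>))"
    proof -
      have "c * (norm w)\<^sup>2 = cmod (LBINT \<tau>. P \<tau>)" unfolding corr using c by (simp add: norm_mult norm_power)
      then show ?thesis using integral_norm_bound[of lborel P] by simp
    qed
    have "norm w \<le> ((E * (b + b') + 1) / c) * M * norm y"
    \<comment> \<open>The weight used in the main case needs both norms to be nonzero. If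
      \<open>y\<close> is 0, its orbit vanishes, hence \<open>P\<close> does, and \<open>cw\<close>
      forces \<open>w\<close> to be 0.\<close>
    proof (cases "w = 0 \<or> y = 0")
      case True
      have "w = 0"
      proof (cases "y = 0")
        case True
        then have "orb g y \<tau> = 0" for \<tau> unfolding orb_def using PHI_zero[OF symb_translate[OF g]] by simp
        then have "P \<tau> = 0" for \<tau> using Pb[of \<tau>] by simp
        then have "c * (norm w)\<^sup>2 \<le> 0" using cw by simp
        then show ?thesis using c by (simp add: mult_le_0_iff)
      qed (use True in auto)
      then show ?thesis using E b c M by simp
    next
      case False
      \<comment> \<open>This weight in the inequality between arithmetic and geometric means makes
        both square functions contribute multiples of \<open>norm w * norm y\<close>, so the bound
        becomes linear in \<open>norm y\<close> after cancelling \<open>norm w\<close>.\<close>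
      define r where "r = norm w / norm y"
      have r: "r > 0" using False by (simp add: r_def)
      let ?a = "\<lambda>\<tau>. norm (orb g y \<tau>)" and ?b = "\<lambda>\<tau>. norm (S.orb g' w \<tau>)"
      have am: "a * d \<le> (r / 2) * a\<^sup>2 + (1 / (2 * r)) * d\<^sup>2" for a d :: real
      proof -
        have "0 \<le> (r * a - d)\<^sup>2 / (2 * r)" using r by simp
        also have "\<dots> = (r / 2) * a\<^sup>2 + (1 / (2 * r)) * d\<^sup>2 - a * d" using r
            by (simp add: power2_eq_square field_simps)
        finally show ?thesis by simp
      qed
      have "c * (norm w)\<^sup>2 \<le> (LBINT \<tau>. (E * M) * ((r / 2) * (?a \<tau>)\<^sup>2 + (1 / (2 * r)) * (?b \<tau>)\<^sup>2))"
      proof (rule order_trans[OF cw], rule integral_mono)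
        show "integrable lborel (\<lambda>\<tau>. cmod (P \<tau>))" by (rule integrable_norm[OF corr(2)])
        show "integrable lborel (\<lambda>\<tau>. (E * M) * ((r / 2) * (?a \<tau>)\<^sup>2 + (1 / (2 * r)) * (?b \<tau>)\<^sup>2))"
          by (intro integrable_mult_right Bochner_Integration.integrable_add qT qS)
        show "cmod (P \<tau>) \<le> (E * M) * ((r / 2) * (?a \<tau>)\<^sup>2 + (1 / (2 * r)) * (?b \<tau>)\<^sup>2)" for \<tau>
          by (rule order_trans[OF Pb]) (intro mult_left_mono am mult_nonneg_nonneg E M)
      qed
      also have "\<dots> = (E * M) * ((r / 2) * (LBINT \<tau>. (?a \<tau>)\<^sup>2) + (1 / (2 * r)) * (LBINT \<tau>. (?b \<tau>)\<^sup>2))"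
      proof -
        have "(LBINT \<tau>. (r / 2) * (?a \<tau>)\<^sup>2 + (1 / (2 * r)) * (?b \<tau>)\<^sup>2) = (LBINT \<tau>. (r / 2) * (?a \<tau>)\<^sup>2)
            + (LBINT \<tau>. (1 / (2 * r)) * (?b \<tau>)\<^sup>2)"
          by (rule Bochner_Integration.integral_add) (intro integrable_mult_right qT qS)+
        then show ?thesis by (simp only: integral_mult_right_zero)
      qed
      also have "\<dots> \<le> (E * M) * ((r / 2) * (b * (norm y)\<^sup>2) + (1 / (2 * r)) * (b' * (norm w)\<^sup>2))"
        using r by (intro mult_left_mono add_mono qT qS mult_nonneg_nonneg E M) auto
      also have "\<dots> = (E * M * ((b + b') / 2) * norm y) * norm w"
        using False by (simp add: r_def power2_eq_square field_simps)
      finally have "(c * norm w) * norm w \<le> (E * M * ((b + b') / 2) * norm y) * norm w"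
          by (simp only: power2_eq_square mult.assoc)
      then have "c * norm w \<le> E * M * ((b + b') / 2) * norm y"
          by (subst (asm) mult_le_cancel_right_pos) (use False in auto)
      also have "\<dots> \<le> (E * (b + b') + 1) * M * norm y"
      proof -
        have "E * ((b + b') / 2) \<le> E * (b + b')" using E b by (intro mult_left_mono) auto
        then have "E * ((b + b') / 2) * (M * norm y) \<le> (E * (b + b') + 1) * (M * norm y)" using M
            by (intro mult_right_mono) auto
        then show ?thesis by (simp only: mult_ac)
      qed
      finally show ?thesis using c by (simp add: field_simps)
    qed
    then show ?thesis unfolding w_def y_def g0_def[abs_def] .
  qed
  moreover have "(E * (b + b') + 1) / c > 0" using E b c
      by (intro divide_pos_pos add_nonneg_pos mult_nonneg_nonneg) auto
  ultimately show thesis using that by blast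
qed

end

section \<open>Bounded functions\<close>

context sect_op
begin

lemma Q_i_off: "emb \<i> \<notin> qsector \<omega>"
proof -
  have "exp (\<i> * of_real (pi / 2)) = \<i>" by (simp add: complex_eq_iff Re_exp Im_exp)
  then show ?thesis using reg_off[OF half_pi_reg(1)] by simp
qed

lemma A_Q: "A u = T (Q \<i> u)" by (simp add: A_def Q_def emb_i)

lemma A_inj: assumes inj: "inj_on T D" and "A u = 0" shows "u = 0"
proof -
  have "T (Q \<i> u) = T 0" using assms(2) T_scaleR[OF D0, of 0] by (simp add: A_Q)
  then have q: "Q \<i> u = 0" using inj_onD[OF inj _ Q_D(1)[OF Q_i_off] D0] by blast
  have T0: "T 0 = 0" using T_scaleR[OF D0, of 0] by simp
  show ?thesis using Q_right[OF Q_i_off, of u] by (simp add: q T0)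
qed

lemma A_range: assumes "y \<in> D" "T y \<in> D" shows "T y \<in> range A"
proof -
  have "Q \<i> (T (T y) + y) = y" using Q_left[OF Q_i_off assms] by simp
  then have "T y = A (T (T y) + y)" by (simp add: A_Q)
  then show ?thesis by blast
qed

text \<open>Negative reals have argument pi and lie outside the sector. For real \<open>s\<close>
  left and right multiplication agree, so \<open>SLinv\<close> is the complex resolvent itself and
  its bound carries over directly.\<close>

lemma R_neg_bound: "\<exists>C>0. \<forall>n>0. \<forall>u. emb (- of_real n) \<notin> qsector \<omega> \<and> norm (R (- of_real n) u) \<le> C / n * norm u"
proof -
  obtain C where C: "C > 0" "\<And>s u. s \<noteq> 0 \<Longrightarrow> s \<notin> qsector \<theta>0 \<Longrightarrow> norm (SLinv rm ip N D T s u) \<le> C / norm s * norm u"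
    using SL[of \<theta>0] theta by fastforce
  have "emb (- of_real n) \<notin> qsector \<omega> \<and> norm (R (- of_real n) u) \<le> C / n * norm u" if n: "n > 0" for n u
  proof -
    have e: "- of_real n = exp (Complex (ln n) pi)" using n by (simp add: exp_Complex)
    have o: "emb (- of_real n) \<notin> qsector \<omega>" "emb (- of_real n) \<notin> qsector \<theta>0"
      unfolding e by (rule emb_exp_not_sector; use theta pi_gt_zero in simp)+
    have m: "emb (cnj (- of_real n)) = of_real (- n)" by (simp add: quat_eq_iff)
    have c: "csc (- of_real n) v = (- n) *\<^sub>R v" for v using sc_of_real[of "- n" v] by simp
    have "SLinv rm ip N D T (emb (- of_real n)) u = R (- of_real n) u"
      unfolding SLinv_emb R_def m lmul_of_real
          by (simp only: Q_scaleR[OF o(1)] complex_cnj_minus complex_cnj_complex_of_real c)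
    moreover have "norm (SLinv rm ip N D T (emb (- of_real n)) u) \<le> C / norm (emb (- of_real n)) * norm u"
      by (rule C(2)) (use o n in auto)
    ultimately show ?thesis using n o by simp
  qed
  then show ?thesis using C(1) by blast
qed

text \<open>The operators \<open>Y n\<close> map into the domain, commute with \<open>T\<close> and
  tend strongly to the identity. For \<open>x\<close> in the domain,
  \<open>Y n (T x) = T (Y n x)\<close> lies in the range of \<open>A\<close> by
  \<open>A_range\<close>, so \<open>T x\<close> is a limit of such vectors.\<close>

lemma A_dense: assumes dD: "closure D = UNIV" and dR: "closure (T ` D) = UNIV" shows "closure (range A) = UNIV"
proof -
  obtain C where C: "C > 0" "\<And>n u. n > 0 \<Longrightarrow> emb (- of_real n) \<notin> qsector \<omega>"
      "\<And>n u. n > 0 \<Longrightarrow> norm (R (- of_real n) u) \<le> C / n * norm u"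
    using R_neg_bound by metis
  \<comment> \<open>With m = n + 1 this is m times the inverse of m + T; the sign compensates for
    \<open>R\<close> being the inverse of z - T at z = -m.\<close>
  define Y where "Y n u = (- real (Suc n)) *\<^sub>R R (- of_real (real (Suc n))) u" for n u
  have o: "emb (- of_real (real (Suc n))) \<notin> qsector \<omega>" for n by (rule C(2)) simp
  have Yb: "norm (Y n u) \<le> C * norm u" for n u
  proof -
    have "norm (Y n u) = real (Suc n) * norm (R (- of_real (real (Suc n))) u)" by (simp add: Y_def del: of_nat_Suc)
    also have "\<dots> \<le> real (Suc n) * (C / real (Suc n) * norm u)" by (intro mult_left_mono C(3)) auto
    finally show ?thesis by (simp del: of_nat_Suc)
  qed
  have YD: "Y n u \<in> D" for n u unfolding Y_def by (intro D_scaleR R_D o)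
  have YT: "T (Y n u) = Y n (T u)" if "u \<in> D" for n u unfolding Y_def
      by (simp only: T_scaleR[OF R_D[OF o]] R_T[OF o that])
  have Ydiff: "Y n (u - v) = Y n u - Y n v" for n u v unfolding Y_def
      by (simp only: R_diff[OF o] scaleR_diff_right)
  have Y1: "norm (Y n u - u) \<le> C / real (Suc n) * norm (T u)" if u: "u \<in> D" for n u
  proof -
    have c: "csc (- of_real (real (Suc n))) v = (- real (Suc n)) *\<^sub>R v" for v
        using sc_of_real[of "- real (Suc n)" v] by simp
    have "Y n u - u = T (R (- of_real (real (Suc n))) u)"
      using R_right[OF o, of n u] unfolding c Y_def by (simp only: diff_eq_eq) (simp add: algebra_simps)
    also have "\<dots> = R (- of_real (real (Suc n))) (T u)" by (rule R_T[OF o u, symmetric])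
    finally show ?thesis using C(3)[of "real (Suc n)" "T u"] by (simp del: of_nat_Suc)
  qed
  have Ylim: "(\<lambda>n. Y n v) \<longlonglongrightarrow> v" for v
  proof (rule LIMSEQ_I)
    fix e :: real assume e: "e > 0"
    have "v \<in> closure D" using dD by simp
    moreover have "e / (3 * (C + 1)) > 0" using e C(1) by simp
    ultimately obtain u where u: "u \<in> D" "dist u v < e / (3 * (C + 1))" unfolding closure_approachable by blast
    have uv: "norm (u - v) * (C + 1) < e / 3"
      using u(2) C(1) by (simp add: dist_norm pos_less_divide_eq field_simps)
    obtain n0 :: nat where n0: "3 * (C * norm (T u)) / e < real n0" using reals_Archimedean2 by blast
    show "\<exists>n0. \<forall>n\<ge>n0. norm (Y n v - v) < e"
    proof (intro exI allI impI)
      fix n assume "n \<ge> n0"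
      then have "3 * (C * norm (T u)) / e < real (Suc n)" using n0 by linarith
      then have s: "C / real (Suc n) * norm (T u) < e / 3" using e by (simp add: field_simps)
      have "Y n v - v = (Y n u - u) - Y n (u - v) + (u - v)" by (simp add: Ydiff)
      then have "norm (Y n v - v) \<le> norm (Y n u - u) + norm (Y n (u - v)) + norm (u - v)"
        by (metis norm_triangle_ineq4 norm_triangle_le add_mono_thms_linordered_semiring(3))
      also have "\<dots> \<le> C / real (Suc n) * norm (T u) + C * norm (u - v) + norm (u - v)"
          by (intro add_mono Y1 u Yb order_refl)
      also have "\<dots> < e"
        using s uv e by (simp only: distrib_left mult_1_right mult.commute[of C "norm (u - v)"])
      finally show "norm (Y n v - v) < e" .
    qed
  qed
  have "T ` D \<subseteq> closure (range A)"
  proof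
    fix w assume "w \<in> T ` D"
    then obtain x where x: "x \<in> D" "w = T x" by blast
    have "T (Y n x) \<in> range A" for n by (rule A_range) (simp_all add: YD YT x)
    then have "Y n w \<in> range A" for n by (simp add: YT x)
    then show "w \<in> closure (range A)" unfolding closure_sequential using Ylim[of w]
        by (intro exI[of _ "\<lambda>n. Y n w"]) simp
  qed
  then have "closure (T ` D) \<subseteq> closure (range A)" by (rule closure_minimal) simp
  with dR show ?thesis by auto
qed

lemma A_pow_dense: assumes "closure (range A) = UNIV" shows "closure (range (A ^^ k)) = UNIV"
proof (induction k)
  case (Suc k)
  have c: "continuous_on UNIV A" by (rule linear_continuous_on[OF A_bounded_linear])
  have "A ` closure (range (A ^^ k)) \<subseteq> closure (A ` range (A ^^ k))"
    by (rule image_closure_subset) (auto intro: continuous_on_subset[OF c] closure_subset[THEN subsetD])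
  then have "range A \<subseteq> closure (range (A ^^ Suc k))" using Suc by (simp add: image_comp)
  then have "closure (range A) \<subseteq> closure (range (A ^^ Suc k))" by (rule closure_minimal) simp
  with assms show ?case by auto
qed simp

lemma A_pow_zero: "inj_on T D \<Longrightarrow> (A ^^ k) u = 0 \<Longrightarrow> u = 0"
  by (induction k) (auto dest: A_inj)

lemma A_pow_bounded_linear: "bounded_linear (A ^^ k)"
proof (induction k)
  case 0 then show ?case by (simp add: bounded_linear_ident[unfolded id_def[symmetric]] id_def)
next
  case (Suc k) then show ?case using bounded_linear_compose[OF A_bounded_linear Suc] by (simp add: o_def)
qed

text \<open>By \<open>est\<close> the operator \<open>PHI g \<circ> (A ^^ k)\<^sup>-\<^sup>1\<close> is bounded on the dense range of \<open>A ^^ k\<close>; its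
  closure maps \<open>v\<close> to the vector \<open>z\<close>.\<close>

lemma PHI_range:
  assumes g: "symb \<mu> g" and d: "closure (range A) = UNIV"
    and est: "\<And>u. norm (PHI g u) \<le> M * norm ((A ^^ k) u)"
  shows "\<exists>z. (A ^^ k) z = PHI g v \<and> norm z \<le> M * norm v"
proof -
  let ?B = "A ^^ k"
  interpret B: bounded_linear ?B by (rule A_pow_bounded_linear)
  interpret P: bounded_linear "PHI g" by (rule PHI_cont[OF g])
  have "v \<in> closure (range ?B)" using A_pow_dense[OF d] by simp
  then obtain y where y: "\<And>n. y n \<in> range ?B" "y \<longlonglongrightarrow> v" unfolding closure_sequential by blast
  then have "\<forall>n. \<exists>x. y n = ?B x" by blast
  then obtain x where x: "\<And>n. y n = ?B (x n)" using choice[of "\<lambda>n x. y n = ?B x"] by blast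
  \<comment> \<open>The preimages \<open>x n\<close> need not converge, but \<open>est\<close>
    applied to their differences bounds the images under \<open>PHI g\<close> by differences of the
    convergent sequence \<open>y\<close>.\<close>
  have "Cauchy (\<lambda>n. PHI g (x n))"
  proof (rule CauchyI)
    fix e :: real assume e: "e > 0"
    obtain N where N: "\<And>m n. m \<ge> N \<Longrightarrow> n \<ge> N \<Longrightarrow> norm (y m - y n) < e / (\<bar>M\<bar> + 1)"
      using CauchyD[OF LIMSEQ_imp_Cauchy[OF y(2)], of "e / (\<bar>M\<bar> + 1)"] e by auto
    show "\<exists>N. \<forall>m\<ge>N. \<forall>n\<ge>N. norm (PHI g (x m) - PHI g (x n)) < e"
    proof (intro exI allI impI)
      fix m n assume mn: "N \<le> m" "N \<le> n"
      have "norm (PHI g (x m) - PHI g (x n)) \<le> M * norm (y m - y n)"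
        using est[of "x m - x n"] by (simp add: P.diff B.diff x)
      also have "\<dots> \<le> (\<bar>M\<bar> + 1) * norm (y m - y n)" by (intro mult_right_mono) auto
      also have "\<dots> < e" using N[OF mn] by (simp add: pos_less_divide_eq mult.commute)
      finally show "norm (PHI g (x m) - PHI g (x n)) < e" .
    qed
  qed
  then obtain z where z: "(\<lambda>n. PHI g (x n)) \<longlonglongrightarrow> z" by (auto simp: Cauchy_convergent_iff convergent_def)
  \<comment> \<open>\<open>PHI g\<close> commutes with the power of \<open>A\<close>, so the limit
    \<open>z\<close> can be identified from the convergent vectors \<open>y n\<close>.\<close>
  have "(\<lambda>n. ?B (PHI g (x n))) \<longlonglongrightarrow> ?B z" by (rule B.tendsto[OF z])
  moreover have "(\<lambda>n. ?B (PHI g (x n))) = (\<lambda>n. PHI g (y n))" by (simp add: x A_pow_PHI(3)[OF g])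
  moreover have "(\<lambda>n. PHI g (y n)) \<longlonglongrightarrow> PHI g v" by (rule P.tendsto[OF y(2)])
  ultimately have "?B z = PHI g v" using LIMSEQ_unique by metis
  moreover have "norm z \<le> M * norm v"
  proof (rule LIMSEQ_le[OF tendsto_norm[OF z] tendsto_mult_left[OF tendsto_norm[OF y(2)]]])
    show "\<exists>N. \<forall>n\<ge>N. norm (PHI g (x n)) \<le> M * norm (y n)" using est x by auto
  qed
  ultimately show ?thesis by blast
qed

end

text \<open>For X the power of the modulus with exponent \<open>\<alpha>\<close>, the quotient
  \<open>X / (1 + X * X)\<close> is at most X and at most 1/X.\<close>

lemma decays_exp:
  assumes f: "decays \<mu> f"
  obtains c \<alpha> where "\<alpha> > 0" "\<And>\<zeta>. emb (exp \<zeta>) \<in> qsector0 \<mu> \<Longrightarrow> norm (f (emb (exp \<zeta>))) \<le> c * exp (- \<alpha> * \<bar>Re \<zeta>\<bar>)"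
proof -
  obtain \<alpha> c where *: "\<alpha> > 0" "c > 0" "\<And>s. s \<in> qsector0 \<mu> \<Longrightarrow> norm (f s) \<le> c * norm s powr \<alpha>
      / (1 + norm s powr (2 * \<alpha>))"
    using f unfolding decays_def by blast
  have "norm (f (emb (exp \<zeta>))) \<le> c * exp (- \<alpha> * \<bar>Re \<zeta>\<bar>)" if "emb (exp \<zeta>) \<in> qsector0 \<mu>" for \<zeta>
  proof -
    define X where "X = exp (\<alpha> * Re \<zeta>)"
    have X: "X > 0" by (simp add: X_def)
    have p: "exp (Re \<zeta>) powr \<alpha> = X" "exp (Re \<zeta>) powr (2 * \<alpha>) = X * X"
      by (simp_all add: X_def powr_def mult_exp_exp algebra_simps)
    have "norm (f (emb (exp \<zeta>))) \<le> c * (X / (1 + X * X))"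
      using *(3)[OF that] by (simp add: p)
    also have "X / (1 + X * X) \<le> exp (- \<alpha> * \<bar>Re \<zeta>\<bar>)"
    proof (cases "Re \<zeta> \<ge> 0")
      case True
      then have e: "exp (- \<alpha> * \<bar>Re \<zeta>\<bar>) = 1 / X" by (simp add: X_def exp_minus field_simps)
      have "X / (1 + X * X) \<le> X / (X * X)" using X by (intro divide_left_mono) (auto simp: add_pos_pos)
      then show ?thesis unfolding e using X by simp
    next
      case False
      then have e: "exp (- \<alpha> * \<bar>Re \<zeta>\<bar>) = X" by (simp add: X_def)
      have "X / (1 + X * X) \<le> X / 1" using X by (intro divide_left_mono) (auto simp: add_pos_pos)
      then show ?thesis unfolding e by simp
    qed
    finally show ?thesis using *(2) by (simp add: mult_left_mono)
  qed
  then show ?thesis using *(1) that by blast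
qed

lemma strip_emb: assumes "\<zeta> \<in> strip (- \<mu>) \<mu>" "\<mu> \<le> pi"
  shows "emb (exp \<zeta>) \<in> qsector0 \<mu>" "emb (cnj (exp \<zeta>)) \<in> qsector0 \<mu>" "emb (exp (cnj \<zeta>)) \<in> qsector0 \<mu>"
  using assms emb_exp_sector0[of \<zeta> \<mu>] emb_exp_sector0[of "cnj \<zeta>" \<mu>] by (auto simp: strip_def exp_cnj)

text \<open>Positivity on the half axis makes the components \<open>qI\<close>, \<open>qJ\<close>,
  \<open>qK\<close> vanish on the real line of the logarithmic coordinate, and the identity theorem
  extends this to the strip. Hence such a function is represented by the single symbol
  \<open>Fc qRe \<psi>\<close>.\<close>

lemma Psi_plus_symb:
  assumes psi: "\<psi> \<in> Psi_plus \<mu>" and m: "0 < \<mu>" "\<mu> \<le> pi"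
  shows "symb \<mu> (\<lambda>\<zeta>. Fc qRe \<psi> (exp \<zeta>))"
    and "p \<in> {qI, qJ, qK} \<Longrightarrow> \<zeta> \<in> strip (- \<mu>) \<mu> \<Longrightarrow> Fc p \<psi> (exp \<zeta>) = 0"
    and "\<exists>r>0. Fc qRe \<psi> (exp (of_real x)) = of_real r"
proof -
  have hol: "left_slice_hol (qsector0 \<mu>) \<psi>" and dec: "decays \<mu> \<psi>"
      and pos: "\<And>t. t > 0 \<Longrightarrow> \<exists>r>0. \<psi> (of_real t) = of_real r"
    using psi by (auto simp: Psi_plus_def Psi_def intrinsic_def)
  obtain c \<alpha> where c: "\<alpha> > 0" "\<And>\<zeta>. emb (exp \<zeta>) \<in> qsector0 \<mu> \<Longrightarrow> norm (\<psi> (emb (exp \<zeta>))) \<le> c * exp (- \<alpha> * \<bar>Re \<zeta>\<bar>)"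
    using decays_exp[OF dec] by blast
  show "symb \<mu> (\<lambda>\<zeta>. Fc qRe \<psi> (exp \<zeta>))"
    unfolding symb_def
  proof
    show "(\<lambda>\<zeta>. Fc qRe \<psi> (exp \<zeta>)) holomorphic_on strip (- \<mu>) \<mu>" by (rule Fc_exp_holomorphic[OF hol m(2)]) simp
    have "cmod (Fc qRe \<psi> (exp \<zeta>)) \<le> (2 * c) * exp (- \<alpha> * \<bar>Re \<zeta>\<bar>)" if "\<zeta> \<in> strip (- \<mu>) \<mu>" for \<zeta>
      using norm_Fc_le[of qRe \<psi> "exp \<zeta>"] c(2)[of \<zeta>] c(2)[of "cnj \<zeta>"] strip_emb[OF that m(2)] by (simp add: exp_cnj)
    then show "\<exists>c \<alpha>. \<alpha> > 0 \<and> (\<forall>z\<in>strip (- \<mu>) \<mu>. cmod (Fc qRe \<psi> (exp z)) \<le> c * exp (- \<alpha> * \<bar>Re z\<bar>))" using c(1)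
        by blast
  qed
  have real: "Fc p \<psi> (exp (of_real x)) = of_real (p (\<psi> (of_real (exp x))))" if "p \<in> coords" for p x
  proof -
    interpret p: bounded_linear p by (rule coords_linear[OF that])
    have pm: "p (- q) = - p q" for q using p.scaleR[of "- 1" q] by simp
    have e: "emb (exp (of_real x)) = of_real (exp x)" "emb (cnj (exp (of_real x))) = of_real (exp x)"
      by (simp_all add: exp_of_real emb_of_real del: of_real_exp)
    show ?thesis unfolding Fc_def e cmpA_def cmpB_def by (simp add: complex_eq_iff pm)
  qed
  show "\<exists>r>0. Fc qRe \<psi> (exp (of_real x)) = of_real r"
  proof -
    obtain r where "r > 0" "\<psi> (of_real (exp x)) = of_real r" using pos[of "exp x"] by auto
    then show ?thesis using real[of qRe x] by auto
  qed
  assume p: "p \<in> {qI, qJ, qK}" and z: "\<zeta> \<in> strip (- \<mu>) \<mu>"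
  have p': "p \<in> coords" using p by auto
  have zero: "Fc p \<psi> (exp (of_real x)) = 0" for x
  proof -
    obtain r where "r > 0" "\<psi> (of_real (exp x)) = of_real r" using pos[of "exp x"] by auto
    then show ?thesis using real[OF p', of x] p by auto
  qed
  show "Fc p \<psi> (exp \<zeta>) = 0"
  proof (rule analytic_continuation[of "\<lambda>\<zeta>. Fc p \<psi> (exp \<zeta>)" "strip (- \<mu>) \<mu>" "range of_real" 0 \<zeta>])
    show "(\<lambda>\<zeta>. Fc p \<psi> (exp \<zeta>)) holomorphic_on strip (- \<mu>) \<mu>" by (rule Fc_exp_holomorphic[OF hol m(2) p'])
    show "connected (strip (- \<mu>) \<mu>)" by (rule convex_connected[OF convex_strip])
    show "range of_real \<subseteq> strip (- \<mu>) \<mu>" "0 \<in> strip (- \<mu>) \<mu>" using m by (auto simp: strip_def)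
    show "0 islimpt range complex_of_real"
      unfolding islimpt_approachable
    proof (intro allI impI)
      fix e :: real assume "e > 0"
      then show "\<exists>x'\<in>range complex_of_real. x' \<noteq> 0 \<and> dist x' 0 < e"
        by (intro bexI[of _ "of_real (e / 2)"] conjI rangeI) (auto simp: norm_divide)
    qed
  qed (use zero z in \<open>auto simp: open_strip\<close>)
qed

lemma psik_emb: "psik k (emb z) = emb ((z / (1 + z * z)) ^ Suc k)"
  by (simp add: psik_def emb_power emb_mult emb_add divide_inverse emb_inverse del: power_Suc)

text \<open>On the unit circle \<open>s / (1 + s * s)\<close> equals
  \<open>1 / (2 * cos (arg s))\<close>, which is unbounded as the argument approaches pi/2, whereas
  a function with \<open>decays\<close> is bounded on its sector.\<close>

lemma regularizable_angle:
  assumes adm: "admissible \<mu> k (\<lambda>s. 1)" shows "\<mu> < pi / 2"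
proof (rule ccontr)
  assume "\<not> \<mu> < pi / 2"
  then have m: "pi / 2 \<le> \<mu>" by simp
  have "decays \<mu> (\<lambda>s. psik k s)" using adm by (simp add: admissible_def PsiL_def)
  then obtain c \<alpha> where c: "\<And>\<zeta>. emb (exp \<zeta>) \<in> qsector0 \<mu> \<Longrightarrow> norm (psik k (emb (exp \<zeta>))) \<le> c * exp (- \<alpha> * \<bar>Re \<zeta>\<bar>)"
    using decays_exp by blast
  \<comment> \<open>At the angle \<open>pi / 2 - e\<close> the cosine is at most \<open>e\<close>,
    so the base of the power is at least \<open>\<bar>c\<bar> + 2\<close>. This exceeds
    \<open>c\<close>, and being at least 1 it does not shrink under powers.\<close>
  define e where "e = 1 / (2 * (\<bar>c\<bar> + 2))"
  have e: "0 < e" "e \<le> 1 / 4" by (auto simp: e_def field_simps)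
  define y where "y = pi / 2 - e"
  have y: "0 < y" "y < pi / 2" using e pi_gt3 by (auto simp: y_def)
  let ?\<zeta> = "Complex 0 y"
  have "qarg (emb (exp ?\<zeta>)) = y" using y by (subst qarg_emb_exp) auto
  then have "emb (exp ?\<zeta>) \<in> qsector0 \<mu>" using y m by (simp add: qsector0_def)
  from c[OF this] have b: "norm (psik k (emb (exp ?\<zeta>))) \<le> c" by simp
  have cy: "0 < cos y" "cos y \<le> e"
    using e y sin_x_le_x[of e] by (auto simp: y_def cos_diff intro!: cos_gt_zero_pi sin_gt_zero)
  have w: "exp ?\<zeta> = cis y" by (simp add: complex_eq_iff Re_exp Im_exp)
  have q: "cis y / (1 + cis y * cis y) = of_real (1 / (2 * cos y))"
  proof -
    have "1 + cis y * cis y = cis y * of_real (2 * cos y)"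
    proof -
      have "1 = cis y * cnj (cis y)" by (simp add: cis_cnj cis_mult)
      then have "1 + cis y * cis y = cis y * (cnj (cis y) + cis y)" by (simp only: distrib_left)
      then show ?thesis by (simp add: complex_eq_iff)
    qed
    then show ?thesis using cy by simp
  qed
  have "norm (psik k (emb (exp ?\<zeta>))) = (1 / (2 * cos y)) ^ Suc k"
    unfolding psik_emb norm_emb w q using cy by (simp add: norm_power norm_divide norm_mult)
  also have "\<dots> \<ge> (\<bar>c\<bar> + 2) ^ Suc k"
  proof (rule power_mono)
    have "1 / (2 * cos y) \<ge> 1 / (2 * e)" using cy e by (intro divide_left_mono) auto
    also have "1 / (2 * e) = \<bar>c\<bar> + 2" by (simp add: e_def)
    finally show "\<bar>c\<bar> + 2 \<le> 1 / (2 * cos y)" .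
  qed auto
  finally have "(\<bar>c\<bar> + 2) ^ Suc k \<le> c" using b by simp
  moreover have "(\<bar>c\<bar> + 2) ^ 1 \<le> (\<bar>c\<bar> + 2) ^ Suc k" by (rule power_increasing) auto
  ultimately show False by simp
qed

lemma const_SHinf: "(\<lambda>s. 1) \<in> SHinf \<mu>"
proof -
  have "(\<lambda>s. 1 :: quat) ` qsector0 \<mu> \<subseteq> {1}" by auto
  then have "bounded ((\<lambda>s. 1 :: quat) ` qsector0 \<mu>)" using bounded_subset[OF finite_imp_bounded[of "{1}"]] by simp
  moreover have "left_slice_hol (qsector0 \<mu>) (\<lambda>s. 1)"
    unfolding left_slice_hol_def
  proof (intro conjI ballI allI impI)
    fix i :: quat and u v :: real
    show "\<exists>D1 D2. ((\<lambda>t. 1 :: quat) has_vector_derivative D1) (at u)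
        \<and> ((\<lambda>t. 1 :: quat) has_vector_derivative D2) (at v) \<and> (1 / 2) *\<^sub>R (D1 + i * D2) = 0"
      by (intro exI[of _ 0] conjI has_vector_derivative_const) simp
  qed simp
  ultimately show ?thesis by (simp add: SHinf_def)
qed

lemma supnorm_upper: assumes "f \<in> SHinf \<mu>" "s \<in> qsector0 \<mu>" shows "norm (f s) \<le> supnorm \<mu> f"
proof -
  have "bounded (f ` qsector0 \<mu>)" using assms by (simp add: SHinf_def)
  then have "bdd_above ((\<lambda>s. norm (f s)) ` qsector0 \<mu>)" unfolding bounded_iff bdd_above_def by auto
  then show ?thesis unfolding supnorm_def using assms(2) by (rule cSUP_upper[rotated])
qed

context qhil
begin

text \<open>\<open>adj\<close> is a definite description. Two candidates have a difference
  orthogonal to the dense set \<open>D\<close>, hence coincide, and the described vector is the one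
  provided by \<open>adj_dom\<close>.\<close>

lemma adj_works:
  assumes d: "closure D = UNIV" and y: "y \<in> adj_dom ip D T" and x: "x \<in> D"
  shows "ip (T x) y = ip x (adj ip D T y)"
proof -
  obtain z where z: "\<forall>x\<in>D. ip (T x) y = ip x z" using y by (auto simp: adj_dom_def)
  have uniq: "z' = z" if z': "\<forall>x\<in>D. ip (T x) y = ip x z'" for z'
  proof -
    have "D \<subseteq> {x. ip x (z' - z) = 0}" using z z' by (auto simp: ip_diff_right)
    moreover have "closed {x. ip x (z' - z) = 0}"
      by (intro closed_Collect_eq linear_continuous_on bounded_linear_ip continuous_on_const)
    ultimately have "closure D \<subseteq> {x. ip x (z' - z) = 0}" by (rule closure_minimal)
    then have "ip (z' - z) (z' - z) = 0" using d by auto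
    then show ?thesis by (simp add: ip_self del: of_real_power)
  qed
  have "adj ip D T y = z" unfolding adj_def using z uniq by (intro the_equality) auto
  then show ?thesis using z x by simp
qed

end

theorem theorem6p3:
  fixes rm :: "'h::{real_normed_vector,complete_space} \<Rightarrow> quat \<Rightarrow> 'h"
    and ip :: "'h \<Rightarrow> 'h \<Rightarrow> quat" and N :: "'h set"
    and D :: "'h set" and T :: "'h \<Rightarrow> 'h"
    and \<omega> \<mu> :: real and \<psi> \<psi>' :: "quat \<Rightarrow> quat"
  assumes "0 \<le> \<omega>" and "\<omega> < \<mu>" and "\<mu> \<le> pi"
    and "qhilbert rm ip" and "hilbert_basis rm ip N"
    and "Omega_op rm ip N \<omega> D T"
    and "imag_units \<subseteq> rhoS rm D T"
    and "\<forall>f\<in>SHinf \<mu>. \<exists>k. admissible \<mu> k f"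
    and "type_op rm ip N \<omega> (adj_dom ip D T) (adj ip D T)"
    and "\<psi> \<in> Psi_plus \<mu>" and "quad_est rm ip N \<omega> \<mu> D T \<psi>"
    and "\<psi>' \<in> Psi_plus \<mu>" and "quad_est rm ip N \<omega> \<mu> (adj_dom ip D T) (adj ip D T) \<psi>'"
  shows "\<exists>C>0. \<forall>f\<in>SHinf \<mu>. hinf_dom rm ip N \<omega> \<mu> D T f = UNIV \<and>
           (\<forall>v. norm (hinf_op rm ip N \<omega> \<mu> D T f v) \<le> C * supnorm \<mu> f * norm v)"
proof -
  obtain k0 where "admissible \<mu> k0 (\<lambda>s. 1)" using assms(8) const_SHinf by blast
  then have mu2: "\<mu> < pi / 2" by (rule regularizable_angle)
  have mu: "0 < \<mu>" using assms(1,2) by simp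
  have tT: "type_op rm ip N \<omega> D T" and inj: "inj_on T D" and dR: "closure (T ` D) = UNIV"
    using assms(6) by (auto simp: Omega_op_def)
  have dD: "closure D = UNIV" using tT by (simp add: type_op_def)
  interpret H: qhilb rm ip N by unfold_locales (fact assms(4), fact assms(5))
  interpret T: sect_op rm ip N D T \<omega> \<mu> by (rule H.sect_op_type_op[OF tT assms(1,2) mu2])
  interpret S: sect_op rm ip N "adj_dom ip D T" "adj ip D T" \<omega> \<mu> by (rule H.sect_op_type_op[OF assms(9,1,2) mu2])
  interpret P: adj_pair rm ip N D T \<omega> \<mu> "adj_dom ip D T" "adj ip D T"
    by unfold_locales (rule H.adj_works[OF dD])
  let ?g = "\<lambda>\<zeta>. Fc qRe \<psi> (exp \<zeta>)" and ?g' = "\<lambda>\<zeta>. Fc qRe \<psi>' (exp \<zeta>)"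
  note g = Psi_plus_symb[OF assms(10) mu assms(3)] and g' = Psi_plus_symb[OF assms(12) mu assms(3)]
  obtain \<beta> where b: "\<beta> > 0" "\<And>u. (\<integral>\<^sup>+ t. indicator {0<..} t * ennreal
      ((norm (SFC rm ip N \<omega> \<mu> D (\<lambda>x. t *\<^sub>R T x) \<psi> u))\<^sup>2 / t) \<partial>lborel)
       \<le> ennreal (\<beta>\<^sup>2 * (norm u)\<^sup>2)" using assms(11) unfolding quad_est_def by blast
  obtain \<beta>' where b': "\<beta>' > 0" "\<And>u. (\<integral>\<^sup>+ t. indicator {0<..} t
      * ennreal ((norm (SFC rm ip N \<omega> \<mu> (adj_dom ip D T) (\<lambda>x. t *\<^sub>R adj ip D T x) \<psi>' u))\<^sup>2 / t) \<partial>lborel)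
       \<le> ennreal (\<beta>'\<^sup>2 * (norm u)\<^sup>2)" using assms(13) unfolding quad_est_def by blast
  \<comment> \<open>The calculus of t T is identified only for positive \<open>t\<close>; elsewhere
    the indicator makes both integrands 0.\<close>
  have q: "(\<integral>\<^sup>+ t. indicator {0<..} t * ennreal ((norm (T.orb ?g u (ln t)))\<^sup>2 / t) \<partial>lborel)
      \<le> ennreal (\<beta>\<^sup>2 * (norm u)\<^sup>2)" for u
  proof -
    have "indicator {0<..} t * ennreal ((norm (T.orb ?g u (ln t)))\<^sup>2 / t) = indicator {0<..} t
        * ennreal ((norm (SFC rm ip N \<omega> \<mu> D (\<lambda>x. t *\<^sub>R T x) \<psi> u))\<^sup>2 / t)" for t :: real
      using T.SFC_scale_intrinsic[OF _ g(1), of t u] g(2) by (cases "t > 0") (simp_all add: T.orb_def)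
    then show ?thesis using b(2)[of u] by simp
  qed
  have q': "(\<integral>\<^sup>+ t. indicator {0<..} t * ennreal ((norm (S.orb ?g' u (ln t)))\<^sup>2 / t) \<partial>lborel)
      \<le> ennreal (\<beta>'\<^sup>2 * (norm u)\<^sup>2)" for u
  proof -
    have "indicator {0<..} t * ennreal ((norm (S.orb ?g' u (ln t)))\<^sup>2 / t) = indicator {0<..} t
        * ennreal ((norm (SFC rm ip N \<omega> \<mu> (adj_dom ip D T) (\<lambda>x. t *\<^sub>R adj ip D T x) \<psi>' u))\<^sup>2 / t)" for t :: real
      using S.SFC_scale_intrinsic[OF _ g'(1), of t u] g'(2) by (cases "t > 0") (simp_all add: S.orb_def)
    then show ?thesis using b'(2)[of u] by simp
  qed
  have sym: "?g' (cnj z) = cnj (?g' z)" for z by (simp only: exp_cnj[symmetric]) (rule Fc_cnj, simp)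
  have oT: "integrable lborel (\<lambda>\<tau>. (norm (T.orb ?g u \<tau>))\<^sup>2)" "(LBINT \<tau>. (norm (T.orb ?g u \<tau>))\<^sup>2) \<le> \<beta>\<^sup>2 * (norm u)\<^sup>2"
      for u
    using T.orb_quadratic[OF g(1) _ q] by simp_all
  have oS: "integrable lborel (\<lambda>\<tau>. (norm (S.orb ?g' u \<tau>))\<^sup>2)" "(LBINT \<tau>. (norm (S.orb ?g' u \<tau>))\<^sup>2) \<le> \<beta>'\<^sup>2 * (norm u)\<^sup>2"
      for u
    using S.orb_quadratic[OF g'(1) _ q'] by simp_all
  obtain C where C: "C > 0" "\<And>F M k u. F holomorphic_on strip (- \<mu>) \<mu> \<Longrightarrow> (\<And>z. z \<in> strip (- \<mu>) \<mu> \<Longrightarrow> cmod (F z) \<le> M) \<Longrightarrow>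
    norm (T.PHI (\<lambda>z. p0 z ^ Suc k * F z) u) \<le> C * M * norm ((T.A ^^ Suc k) u)"
  proof (rule P.PHI_estimate[OF g(1) g'(1) sym g(3) g'(3) oT oS zero_le_power2 zero_le_power2])
    fix C :: real
    assume "0 < C" "\<And>F M k u. F holomorphic_on strip (- \<mu>) \<mu> \<Longrightarrow> (\<And>z. z \<in> strip (- \<mu>) \<mu> \<Longrightarrow> cmod (F z) \<le> M) \<Longrightarrow>
      norm (T.PHI (\<lambda>z. p0 z ^ Suc k * F z) u) \<le> C * M * norm ((T.A ^^ Suc k) u)"
    then show thesis by (rule that)
  qed
  have dA: "closure (range T.A) = UNIV" by (rule T.A_dense[OF dD dR])
  have Apsik: "psikT rm D T k = T.A ^^ Suc k" for k by (simp add: psikT_def T.A_def[abs_def])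
  have p0: "symb \<mu> p0" by (rule p0_symb[OF mu mu2])
  show ?thesis
  proof (intro exI conjI ballI)
    \<comment> \<open>The factor 8 counts four components, each with symbol bounded by
      \<open>2 * supnorm \<mu> f\<close> because \<open>Fc\<close> uses the values of
      \<open>f\<close> at two conjugate points.\<close>
    show "0 < 8 * C" using C(1) by simp
    fix f assume f: "f \<in> SHinf \<mu>"
    \<comment> \<open>The least regularizer may vary with \<open>f\<close>; this is harmless because
      \<open>C\<close> was obtained before \<open>f\<close> and is uniform in the power.\<close>
    let ?k = "regk \<mu> f" and ?s = "supnorm \<mu> f"
    let ?f = "\<lambda>s. psik ?k s * f s"
    have hol: "left_slice_hol (qsector0 \<mu>) f" using f by (simp add: SHinf_def)
    have F: "(\<lambda>\<zeta>. Fc p f (exp \<zeta>)) holomorphic_on strip (- \<mu>) \<mu>"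
        "\<And>z. z \<in> strip (- \<mu>) \<mu> \<Longrightarrow> cmod (Fc p f (exp z)) \<le> 2 * ?s" if "p \<in> coords" for p
    proof -
      show "(\<lambda>\<zeta>. Fc p f (exp \<zeta>)) holomorphic_on strip (- \<mu>) \<mu>" by (rule Fc_exp_holomorphic[OF hol assms(3) that])
      fix z assume z: "z \<in> strip (- \<mu>) \<mu>"
      show "cmod (Fc p f (exp z)) \<le> 2 * ?s"
        using norm_Fc_le[OF that, of f "exp z"] supnorm_upper[OF f strip_emb(1)[OF z assms(3)]]
            supnorm_upper[OF f strip_emb(2)[OF z assms(3)]] by simp
    qed
    have s: "symb \<mu> (\<lambda>\<zeta>. p0 \<zeta> ^ Suc ?k * Fc p f (exp \<zeta>))" if "p \<in> coords" for p
    proof -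
      have "symb \<mu> (\<lambda>z. p0 z ^ Suc ?k)" using T.A_pow_PHI(1)[OF p0, of ?k] by (simp add: mult.commute)
      from symb_mult_bounded[OF this F[OF that]] show ?thesis by (simp only: mult.commute)
    qed
    \<comment> \<open>The regularizer is intrinsic, so it multiplies each component of
      \<open>f\<close> by the same scalar symbol.\<close>
    have Fcf: "Fc p ?f (exp \<zeta>) = p0 \<zeta> ^ Suc ?k * Fc p f (exp \<zeta>)" if "p \<in> coords" for p \<zeta>
      unfolding p0_def by (rule Fc_mult[OF that]) (simp_all add: psik_emb del: power_Suc)
    have ex: "\<exists>z. (T.A ^^ Suc ?k) z = T.PHI (\<lambda>\<zeta>. p0 \<zeta> ^ Suc ?k * Fc p f (exp \<zeta>)) v \<and> norm z \<le> C * (2 * ?s)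
        * norm v" if "p \<in> coords" for p v
      by (rule T.PHI_range[OF s[OF that] dA]) (rule C(2)[OF F[OF that]])
    have key: "\<exists>w. (T.A ^^ Suc ?k) w = SFC rm ip N \<omega> \<mu> D T ?f v \<and> norm w \<le> 8 * C * ?s * norm v" for v
    proof -
      \<comment> \<open>Left multiplication by the basis units is isometric, so the four preimages
        obey the same bound in terms of \<open>v\<close>.\<close>
      have ne: "norm (H.lm qii v) = norm v" "norm (H.lm qjj v) = norm v" "norm (H.lm qkk v) = norm v"
        by (simp_all add: H.norm_lmul norm_quat_def)
      obtain z1 where z1: "(T.A ^^ Suc ?k) z1 = T.PHI (\<lambda>\<zeta>. p0 \<zeta> ^ Suc ?k * Fc qRe f (exp \<zeta>)) v"
          "norm z1 \<le> C * (2 * ?s) * norm v"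
        using ex[of qRe v] by auto
      obtain z2 where z2: "(T.A ^^ Suc ?k) z2 = T.PHI (\<lambda>\<zeta>. p0 \<zeta> ^ Suc ?k * Fc qI f (exp \<zeta>)) (H.lm qii v)"
          "norm z2 \<le> C * (2 * ?s) * norm v"
        using ex[of qI "H.lm qii v"] ne by auto
      obtain z3 where z3: "(T.A ^^ Suc ?k) z3 = T.PHI (\<lambda>\<zeta>. p0 \<zeta> ^ Suc ?k * Fc qJ f (exp \<zeta>)) (H.lm qjj v)"
          "norm z3 \<le> C * (2 * ?s) * norm v"
        using ex[of qJ "H.lm qjj v"] ne by auto
      obtain z4 where z4: "(T.A ^^ Suc ?k) z4 = T.PHI (\<lambda>\<zeta>. p0 \<zeta> ^ Suc ?k * Fc qK f (exp \<zeta>)) (H.lm qkk v)"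
          "norm z4 \<le> C * (2 * ?s) * norm v"
        using ex[of qK "H.lm qkk v"] ne by auto
      interpret B: bounded_linear "T.A ^^ Suc ?k" by (rule T.A_pow_bounded_linear)
      have "SFC rm ip N \<omega> \<mu> D T ?f v = (T.A ^^ Suc ?k) (z1 + z2 + z3 + z4)"
      proof -
        have "symb \<mu> (\<lambda>\<zeta>. Fc p ?f (exp \<zeta>))" if "p \<in> coords" for p unfolding Fcf[OF that] by (rule s[OF that])
        from T.SFC_PHI[of ?f v, OF this] show ?thesis
          unfolding B.add z1(1) z2(1) z3(1) z4(1) by (simp add: Fcf del: power_Suc)
      qed
      moreover have "norm (z1 + z2 + z3 + z4) \<le> norm z1 + norm z2 + norm z3 + norm z4"
        by (intro norm_triangle_le add_mono norm_triangle_ineq order_refl)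
      then have "norm (z1 + z2 + z3 + z4) \<le> 8 * C * ?s * norm v" using z1(2) z2(2) z3(2) z4(2)
          by (simp add: algebra_simps)
      ultimately show ?thesis by metis
    qed
    have uniq: "w = w'" if "(T.A ^^ Suc ?k) w = (T.A ^^ Suc ?k) w'" for w w'
    proof -
      interpret B: bounded_linear "T.A ^^ Suc ?k" by (rule T.A_pow_bounded_linear)
      have "(T.A ^^ Suc ?k) (w - w') = 0" using that by (simp only: B.diff) simp
      then have "w - w' = 0" by (rule T.A_pow_zero[OF inj])
      then show ?thesis by simp
    qed
    show "hinf_dom rm ip N \<omega> \<mu> D T f = UNIV"
      unfolding hinf_dom_def Apsik using key by (metis (mono_tags, lifting) UNIV_eq_I mem_Collect_eq rangeI)
    show "\<forall>v. norm (hinf_op rm ip N \<omega> \<mu> D T f v) \<le> 8 * C * ?s * norm v"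
    proof
      fix v
      obtain w where w: "(T.A ^^ Suc ?k) w = SFC rm ip N \<omega> \<mu> D T ?f v" "norm w \<le> 8 * C * ?s * norm v" using key
          by blast
      have "hinf_op rm ip N \<omega> \<mu> D T f v = w"
        unfolding hinf_op_def Apsik by (rule the_equality) (use w(1) uniq in metis)+
      then show "norm (hinf_op rm ip N \<omega> \<mu> D T f v) \<le> 8 * C * ?s * norm v" using w(2) by simp
    qed
  qed
qed

end
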